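(* The spectrum of $\mathcal{H}_R^*\mathcal{H}_R$ and the spectrum of $\mathcal{H}_L^*\mathcal{H}_L$ are simple and purely absolutely continuous.
   Context: Fix real numbers $b_L<0<b_R$. The finite Hilbert transforms $\mathcal{H}_L:L^2([b_L,0])\to L^2([0,b_R])$, $\mathcal{H}_R:L^2([0,b_R])\to L^2([b_L,0])$ are $\mathcal{H}_L[f](y)=\frac{1}{\pi}\int_{b_L}^0\frac{f(x)}{x-y}dx$, $\mathcal{H}_R[g](x)=\frac{1}{\pi}\int_{0}^{b_R}\frac{g(y)}{y-x}dy$. A self-adjoint operator on a Hilbert space $\mathcal K$ with resolution of the identity (spectral family) $\hat E_t$ has simple spectrum if there is a vector $g\in\mathcal K$ (a generating vector) such that the span of $\hat E_\Delta[g]$, with $\Delta$ running over all subintervals of $\mathbb R$, is dense in $\mathcal K$. *)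

theory Defs
  imports "HOL-Analysis.Analysis"
begin

(* Complex L^2 spaces are handled on representatives: a vector is a square-integrable function,
   equality of vectors is equality almost everywhere, and operators act on representatives. *)

definition L2 :: "'a measure \<Rightarrow> ('a \<Rightarrow> complex) set" where
  "L2 M = {f \<in> borel_measurable M. integrable M (\<lambda>x. (cmod (f x))\<^sup>2)}"

definition L2_inner :: "'a measure \<Rightarrow> ('a \<Rightarrow> complex) \<Rightarrow> ('a \<Rightarrow> complex) \<Rightarrow> complex" where
  "L2_inner M f g = (LINT x|M. f x * cnj (g x))"

definition L2_norm :: "'a measure \<Rightarrow> ('a \<Rightarrow> complex) \<Rightarrow> real" where
  "L2_norm M f = sqrt (LINT x|M. (cmod (f x))\<^sup>2)"

(* Boundedness together with linearity a.e. makes T respect equality a.e. *)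
definition bounded_operator ::
    "'a measure \<Rightarrow> 'b measure \<Rightarrow> (('a \<Rightarrow> complex) \<Rightarrow> ('b \<Rightarrow> complex)) \<Rightarrow> bool" where
  "bounded_operator M N T \<longleftrightarrow>
     (\<forall>f\<in>L2 M. T f \<in> L2 N) \<and>
     (\<forall>f\<in>L2 M. \<forall>g\<in>L2 M. AE y in N. T (\<lambda>x. f x + g x) y = T f y + T g y) \<and>
     (\<forall>c. \<forall>f\<in>L2 M. AE y in N. T (\<lambda>x. c * f x) y = c * T f y) \<and>
     (\<exists>C. \<forall>f\<in>L2 M. L2_norm N (T f) \<le> C * L2_norm M f)"

(* As for the library constant adjoint, the choice is meaningful when an adjoint exists;
   the value at g is then unique up to equality a.e. *)
definition L2_adjoint ::
    "'a measure \<Rightarrow> 'b measure \<Rightarrow> (('a \<Rightarrow> complex) \<Rightarrow> ('b \<Rightarrow> complex))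
      \<Rightarrow> ('b \<Rightarrow> complex) \<Rightarrow> ('a \<Rightarrow> complex)" where
  "L2_adjoint M N T g =
     (SOME h. h \<in> L2 M \<and> (\<forall>f\<in>L2 M. L2_inner N (T f) g = L2_inner M f h))"

definition self_adjoint :: "'a measure \<Rightarrow> (('a \<Rightarrow> complex) \<Rightarrow> ('a \<Rightarrow> complex)) \<Rightarrow> bool" where
  "self_adjoint M A \<longleftrightarrow>
     bounded_operator M M A \<and> (\<forall>f\<in>L2 M. \<forall>g\<in>L2 M. L2_inner M (A f) g = L2_inner M f (A g))"

(* The idempotence of each E t is the case s = t of the second clause. *)
definition spectral_family ::
    "'a measure \<Rightarrow> (real \<Rightarrow> ('a \<Rightarrow> complex) \<Rightarrow> ('a \<Rightarrow> complex)) \<Rightarrow> bool" where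
  "spectral_family M E \<longleftrightarrow>
     (\<forall>t. self_adjoint M (E t)) \<and>
     (\<forall>s t. \<forall>f\<in>L2 M. AE x in M. E s (E t f) x = E (min s t) f x) \<and>
     (\<forall>t. \<forall>f\<in>L2 M. ((\<lambda>s. L2_norm M (\<lambda>x. E s f x - E t f x)) \<longlongrightarrow> 0) (at_right t)) \<and>
     (\<forall>f\<in>L2 M. ((\<lambda>t. L2_norm M (E t f)) \<longlongrightarrow> 0) at_bot) \<and>
     (\<forall>f\<in>L2 M. ((\<lambda>t. L2_norm M (\<lambda>x. E t f x - f x)) \<longlongrightarrow> 0) at_top)"

(* The Stieltjes measure d(E_t f, f). *)
definition spectral_measure ::
    "'a measure \<Rightarrow> (real \<Rightarrow> ('a \<Rightarrow> complex) \<Rightarrow> ('a \<Rightarrow> complex)) \<Rightarrow> ('a \<Rightarrow> complex) \<Rightarrow> real measure"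
    where
  "spectral_measure M E f = interval_measure (\<lambda>t. Re (L2_inner M (E t f) f))"

(* A is the integral of t against dE_t, read weakly: (A f, f) is the integral of t d(E_t f, f).
   By polarization the quadratic form determines A, and by the spectral theorem E is
   unique up to equality a.e. *)
definition resolution_of_identity ::
    "'a measure \<Rightarrow> (('a \<Rightarrow> complex) \<Rightarrow> ('a \<Rightarrow> complex))
      \<Rightarrow> (real \<Rightarrow> ('a \<Rightarrow> complex) \<Rightarrow> ('a \<Rightarrow> complex)) \<Rightarrow> bool" where
  "resolution_of_identity M A E \<longleftrightarrow>
     spectral_family M E \<and>
     (\<forall>f\<in>L2 M. integrable (spectral_measure M E f) (\<lambda>t. t) \<and>
        L2_inner M (A f) f = complex_of_real (LINT t|spectral_measure M E f. t))"

(* The vectors E_\<Delta> g = E_b g - E_a g for \<Delta> = (a,b] have dense span. For the other kinds of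
   subintervals E_\<Delta> g is a norm limit of these, so they do not change the closed span. *)
definition generating_vector ::
    "'a measure \<Rightarrow> (real \<Rightarrow> ('a \<Rightarrow> complex) \<Rightarrow> ('a \<Rightarrow> complex)) \<Rightarrow> ('a \<Rightarrow> complex) \<Rightarrow> bool" where
  "generating_vector M E g \<longleftrightarrow>
     g \<in> L2 M \<and>
     (\<forall>f\<in>L2 M. \<forall>\<epsilon>>0. \<exists>(n::nat) (c::nat \<Rightarrow> complex) (a::nat \<Rightarrow> real) (b::nat \<Rightarrow> real).
        (\<forall>k<n. a k < b k) \<and>
        L2_norm M (\<lambda>x. f x - (\<Sum>k<n. c k * (E (b k) g x - E (a k) g x))) < \<epsilon>)"

definition simple_spectrum :: "'a measure \<Rightarrow> (('a \<Rightarrow> complex) \<Rightarrow> ('a \<Rightarrow> complex)) \<Rightarrow> bool" where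
  "simple_spectrum M A \<longleftrightarrow>
     self_adjoint M A \<and> (\<exists>E. resolution_of_identity M A E \<and> (\<exists>g. generating_vector M E g))"

(* Every vector lies in the absolutely continuous subspace of A. *)
definition purely_ac_spectrum :: "'a measure \<Rightarrow> (('a \<Rightarrow> complex) \<Rightarrow> ('a \<Rightarrow> complex)) \<Rightarrow> bool"
    where
  "purely_ac_spectrum M A \<longleftrightarrow>
     self_adjoint M A \<and>
     (\<exists>E. resolution_of_identity M A E \<and>
        (\<forall>f\<in>L2 M. absolutely_continuous lborel (spectral_measure M E f)))"

abbreviation interval_lborel :: "real \<Rightarrow> real \<Rightarrow> real measure" where
  "interval_lborel a b \<equiv> restrict_space lborel {a..b}"

(* The two intervals share only the point 0, so for y > 0 (x < 0 below) the kernel is bounded on the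
   domain of integration and no principal value is needed; the value at 0 is immaterial. *)
definition fht_L :: "real \<Rightarrow> (real \<Rightarrow> complex) \<Rightarrow> (real \<Rightarrow> complex)" where
  "fht_L bL f y = 1 / complex_of_real pi *
     (LINT x|interval_lborel bL 0. f x / complex_of_real (x - y))"

definition fht_R :: "real \<Rightarrow> (real \<Rightarrow> complex) \<Rightarrow> (real \<Rightarrow> complex)" where
  "fht_R bR g x = 1 / complex_of_real pi *
     (LINT y|interval_lborel 0 bR. g y / complex_of_real (y - x))"

definition fht_L_adj_L :: "real \<Rightarrow> real \<Rightarrow> (real \<Rightarrow> complex) \<Rightarrow> (real \<Rightarrow> complex)" where
  "fht_L_adj_L bL bR f =
     L2_adjoint (interval_lborel bL 0) (interval_lborel 0 bR) (fht_L bL) (fht_L bL f)"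

definition fht_R_adj_R :: "real \<Rightarrow> real \<Rightarrow> (real \<Rightarrow> complex) \<Rightarrow> (real \<Rightarrow> complex)" where
  "fht_R_adj_R bL bR g =
     L2_adjoint (interval_lborel 0 bR) (interval_lborel bL 0) (fht_R bR) (fht_R bR g)"

end

theory Submission
  imports Defs "HOL-Probability.Probability" "HOL-Complex_Analysis.Complex_Analysis" "HOL-Real_Asymp.Real_Asymp"
begin

text \<open>Let \<open>a = -bL\<close> and \<open>b = bR\<close>. A Moebius map sends \<open>0\<close> to infinity and turns both transforms, up to
  sign, into the operator with kernel \<open>1 / (\<pi> (u + v))\<close> on \<open>L\<^sup>2(1,\<infinity>)\<close>, which the Mehler--Fock transform
  diagonalises. Legendre functions can be avoided. The derivatives \<open>r_t\<close> with respect to \<open>t\<close> of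
  \<open>v \<mapsto> (v + cosh t) powr (-1/2)\<close> form a total family with the elementary Gram matrix
  \<open>(1 / cosh\<^sup>2 ((t-s)/4) - 1 / cosh\<^sup>2 ((t+s)/4)) / 8\<close>, which is also the Gram matrix of the functions
  \<open>\<tau> \<mapsto> sin (\<tau> t)\<close> for the weight \<open>4\<tau> / sinh (2\<pi>\<tau>)\<close> on the half line; hence \<open>r_t \<mapsto> sin (\<tau> t)\<close> extends
  to a unitary operator. An elementary substitution shows that the transform acts on \<open>r_t\<close> as convolution
  in \<open>t\<close> with \<open>1 / (2\<pi> cosh (t/2))\<close>, that is, as multiplication by \<open>1 / cosh (\<pi>\<tau>)\<close>. So the operator in
  question is unitarily equivalent to multiplication by the strictly decreasing function
  \<open>1 / cosh\<^sup>2 (\<pi>\<tau>)\<close>.\<close>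

section \<open>The space of square-integrable functions\<close>

text \<open>The functions \<open>(v + cosh t) powr (-1/2)\<close> generate the Mehler--Fock
  transform: their transform is a multiple of cos(\<tau> t) / (\<tau> sinh(pi \<tau>)). They decay
  only like v^(-1/2), so they are not square-integrable; differentiating in t improves the decay to
  v^(-3/2), removes the factor 1/\<tau> and turns the cosine into a sine. The weight 4 \<tau> /
  sinh(2 pi \<tau>) is the Mehler--Fock density \<tau> tanh(pi \<tau>) times 2 / sinh(pi \<tau>)^2.

  Two difficulties shape the rest. No bound on the transforms is available beforehand, and the
  adjoint is a choice. But at each point other than 0 the value of a transform is an inner product
  with a bounded kernel, so combinations of the vectors that converge in norm have pointwise
  convergent transforms, and Fatou's lemma identifies the limit. Totality of the two families and
  the generating vector all rest on one fact: an integrable function is determined by its integrals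
  over the sublevel sets of a strictly monotone function.\<close>

lemma borel_measurable_cnj [measurable (raw)]:
  "f \<in> borel_measurable M \<Longrightarrow> (\<lambda>x. cnj (f x)) \<in> borel_measurable M"
  by (rule borel_measurable_continuous_on[of cnj]) (auto intro: continuous_intros)

lemma L2_measurable: "f \<in> L2 M \<Longrightarrow> f \<in> borel_measurable M"
  and L2_integrable: "f \<in> L2 M \<Longrightarrow> integrable M (\<lambda>x. (cmod (f x))\<^sup>2)"
  by (auto simp: L2_def)

lemma L2_scale: "f \<in> L2 M \<Longrightarrow> (\<lambda>x. c * f x) \<in> L2 M"
  by (auto simp: L2_def norm_mult power_mult_distrib)

lemma L2_bounded_mult:
  assumes "f \<in> L2 M" "g \<in> borel_measurable M" "\<And>x. x \<in> space M \<Longrightarrow> cmod (g x) \<le> C"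
  shows "(\<lambda>x. g x * f x) \<in> L2 M"
proof -
  have "integrable M (\<lambda>x. (cmod (g x * f x))\<^sup>2)"
  proof (rule Bochner_Integration.integrable_bound)
    show "integrable M (\<lambda>x. C\<^sup>2 * (cmod (f x))\<^sup>2)"
      using assms(1) by (auto simp: L2_def)
    show "AE x in M. norm ((cmod (g x * f x))\<^sup>2) \<le> norm (C\<^sup>2 * (cmod (f x))\<^sup>2)"
    proof (rule AE_I2)
      fix x assume "x \<in> space M"
      then have "(cmod (g x))\<^sup>2 \<le> C\<^sup>2" by (simp add: assms(3) power_mono)
      then show "norm ((cmod (g x * f x))\<^sup>2) \<le> norm (C\<^sup>2 * (cmod (f x))\<^sup>2)"
        by (auto simp: norm_mult power_mult_distrib mult_right_mono)
    qed
    show "(\<lambda>x. (cmod (g x * f x))\<^sup>2) \<in> borel_measurable M"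
      using assms(1,2) by (auto simp: L2_def)
  qed
  then show ?thesis using assms by (auto simp: L2_def)
qed

lemma L2_add:
  assumes "f \<in> L2 M" "g \<in> L2 M"
  shows "(\<lambda>x. f x + g x) \<in> L2 M"
proof -
  have "integrable M (\<lambda>x. (cmod (f x + g x))\<^sup>2)"
  proof (rule Bochner_Integration.integrable_bound)
    show "integrable M (\<lambda>x. 2 * (cmod (f x))\<^sup>2 + 2 * (cmod (g x))\<^sup>2)"
      using assms by (auto simp: L2_def)
    show "AE x in M. norm ((cmod (f x + g x))\<^sup>2) \<le> norm (2 * (cmod (f x))\<^sup>2 + 2 * (cmod (g x))\<^sup>2)"
    proof (rule AE_I2)
      fix x
      have "(cmod (f x + g x))\<^sup>2 \<le> (cmod (f x) + cmod (g x))\<^sup>2"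
        by (intro power_mono norm_triangle_ineq) auto
      also have "\<dots> \<le> 2 * (cmod (f x))\<^sup>2 + 2 * (cmod (g x))\<^sup>2"
        using zero_le_power2[of "cmod (f x) - cmod (g x)"] by (simp add: power2_eq_square algebra_simps)
      finally show "norm ((cmod (f x + g x))\<^sup>2) \<le> norm (2 * (cmod (f x))\<^sup>2 + 2 * (cmod (g x))\<^sup>2)"
        by simp
    qed
    show "(\<lambda>x. (cmod (f x + g x))\<^sup>2) \<in> borel_measurable M"
      using assms by (auto simp: L2_def)
  qed
  then show ?thesis using assms by (auto simp: L2_def)
qed

lemma L2_zero: "(\<lambda>x. 0) \<in> L2 M"
  by (auto simp: L2_def)

lemma L2_diff:
  assumes "f \<in> L2 M" "g \<in> L2 M"
  shows "(\<lambda>x. f x - g x) \<in> L2 M"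
  using L2_add[OF assms(1) L2_scale[OF assms(2), of "-1"]] by simp

lemma L2_cnj: "f \<in> L2 M \<Longrightarrow> (\<lambda>x. cnj (f x)) \<in> L2 M"
  by (auto simp: L2_def)

lemma L2_AE_cong:
  assumes "f \<in> L2 M" "g \<in> borel_measurable M" "AE x in M. f x = g x"
  shows "g \<in> L2 M"
proof -
  have "integrable M (\<lambda>x. (cmod (g x))\<^sup>2) \<longleftrightarrow> integrable M (\<lambda>x. (cmod (f x))\<^sup>2)"
    by (rule integrable_cong_AE) (use assms in \<open>auto simp: L2_def\<close>)
  then show ?thesis using assms by (auto simp: L2_def)
qed

lemma L2_mult_integrable:
  assumes "f \<in> L2 M" "g \<in> L2 M"
  shows "integrable M (\<lambda>x. f x * g x)"
proof (rule Bochner_Integration.integrable_bound)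
  show "integrable M (\<lambda>x. (cmod (f x))\<^sup>2 + (cmod (g x))\<^sup>2)"
    using assms by (auto simp: L2_def)
  show "AE x in M. norm (f x * g x) \<le> norm ((cmod (f x))\<^sup>2 + (cmod (g x))\<^sup>2)"
  proof (rule AE_I2)
    fix x
    have "2 * (cmod (f x) * cmod (g x)) \<le> (cmod (f x))\<^sup>2 + (cmod (g x))\<^sup>2"
      using zero_le_power2[of "cmod (f x) - cmod (g x)"] by (simp add: power2_eq_square algebra_simps)
    moreover have "0 \<le> cmod (f x) * cmod (g x)" by simp
    ultimately show "norm (f x * g x) \<le> norm ((cmod (f x))\<^sup>2 + (cmod (g x))\<^sup>2)"
      unfolding norm_mult real_norm_def by linarith
  qed
  show "(\<lambda>x. f x * g x) \<in> borel_measurable M"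
    using assms by (auto simp: L2_def)
qed

lemma L2_inner_integrable:
  assumes "f \<in> L2 M" "g \<in> L2 M"
  shows "integrable M (\<lambda>x. f x * cnj (g x))"
  using L2_mult_integrable[OF assms(1) L2_cnj[OF assms(2)]] .

lemma L2_inner_cong_AE:
  assumes "AE x in M. f x = f' x" "AE x in M. g x = g' x"
    "f \<in> borel_measurable M" "f' \<in> borel_measurable M" "g \<in> borel_measurable M" "g' \<in> borel_measurable M"
  shows "L2_inner M f g = L2_inner M f' g'"
  unfolding L2_inner_def using assms by (intro integral_cong_AE) auto

lemma L2_inner_add_left:
  assumes "f \<in> L2 M" "g \<in> L2 M" "h \<in> L2 M"
  shows "L2_inner M (\<lambda>x. f x + g x) h = L2_inner M f h + L2_inner M g h"
  unfolding L2_inner_def distrib_right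
  by (intro Bochner_Integration.integral_add L2_inner_integrable assms)

lemma L2_inner_diff_left:
  assumes "f \<in> L2 M" "g \<in> L2 M" "h \<in> L2 M"
  shows "L2_inner M (\<lambda>x. f x - g x) h = L2_inner M f h - L2_inner M g h"
  unfolding L2_inner_def left_diff_distrib
  by (intro Bochner_Integration.integral_diff L2_inner_integrable assms)

lemma L2_inner_scale_left: "L2_inner M (\<lambda>x. c * f x) g = c * L2_inner M f g"
  unfolding L2_inner_def by (simp add: mult.assoc)

lemma L2_inner_commute: "L2_inner M g f = cnj (L2_inner M f g)"
  unfolding L2_inner_def by (subst Bochner_Integration.integral_cnj[symmetric]) (simp add: mult.commute)

lemma L2_inner_add_right:
  assumes "f \<in> L2 M" "g \<in> L2 M" "h \<in> L2 M"
  shows "L2_inner M h (\<lambda>x. f x + g x) = L2_inner M h f + L2_inner M h g"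
  by (subst (1 2 3) L2_inner_commute) (simp add: L2_inner_add_left assms)

lemma L2_inner_diff_right:
  assumes "f \<in> L2 M" "g \<in> L2 M" "h \<in> L2 M"
  shows "L2_inner M h (\<lambda>x. f x - g x) = L2_inner M h f - L2_inner M h g"
  by (subst (1 2 3) L2_inner_commute) (simp add: L2_inner_diff_left assms)

lemma L2_inner_scale_right: "L2_inner M g (\<lambda>x. c * f x) = cnj c * L2_inner M g f"
  by (subst (1 2) L2_inner_commute) (simp add: L2_inner_scale_left)

lemma L2_norm_nonneg: "0 \<le> L2_norm M f"
  by (simp add: L2_norm_def)

lemma L2_norm_sq: "(L2_norm M f)\<^sup>2 = (LINT x|M. (cmod (f x))\<^sup>2)"
  by (simp add: L2_norm_def)

lemma L2_inner_self: "L2_inner M f f = complex_of_real ((L2_norm M f)\<^sup>2)"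
  by (simp add: L2_inner_def L2_norm_sq complex_norm_square[symmetric] del: of_real_power)

lemma L2_norm_sq_inner: "(L2_norm M f)\<^sup>2 = Re (L2_inner M f f)"
  by (simp add: L2_inner_self)

lemma L2_norm_eq_0:
  assumes "f \<in> L2 M" shows "L2_norm M f = 0 \<longleftrightarrow> (AE x in M. f x = 0)"
  using integral_nonneg_eq_0_iff_AE[OF L2_integrable[OF assms]] by (simp add: L2_norm_def)

lemma L2_norm_cong_AE:
  assumes "AE x in M. f x = g x" "f \<in> borel_measurable M" "g \<in> borel_measurable M"
  shows "L2_norm M f = L2_norm M g"
proof -
  have "(LINT x|M. (cmod (f x))\<^sup>2) = (LINT x|M. (cmod (g x))\<^sup>2)"
    using assms by (intro integral_cong_AE) auto
  then show ?thesis by (simp add: L2_norm_def)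
qed

lemma L2_norm_scale: "L2_norm M (\<lambda>x. c * f x) = cmod c * L2_norm M f"
  by (simp add: L2_norm_def norm_mult power_mult_distrib real_sqrt_mult)

text \<open>Taking the coefficient to be a real multiple \<open>r\<close> of the inner product makes
  both cross terms real and equal. One choice of \<open>r\<close> gives the Cauchy-Schwarz
  inequality, another the decay of inner products along a minimising sequence.\<close>

lemma L2_norm_sq_diff_projection:
  assumes "f \<in> L2 M" "g \<in> L2 M"
  shows "(L2_norm M (\<lambda>x. f x - of_real r * L2_inner M f g * g x))\<^sup>2
    = (L2_norm M f)\<^sup>2 - 2 * r * (cmod (L2_inner M f g))\<^sup>2 + r\<^sup>2 * (cmod (L2_inner M f g))\<^sup>2 * (L2_norm M g)\<^sup>2"
proof -
  define I where "I = L2_inner M f g"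
  define c where "c = of_real r * I"
  have cg: "(\<lambda>x. c * g x) \<in> L2 M" by (rule L2_scale[OF assms(2)])
  have "L2_inner M (\<lambda>x. f x - c * g x) (\<lambda>x. f x - c * g x)
    = L2_inner M f f - cnj c * I - c * cnj I + c * cnj c * L2_inner M g g"
    using assms cg L2_diff[OF assms(1) cg] L2_inner_commute[of M g f]
    by (simp add: L2_inner_diff_left L2_inner_diff_right L2_inner_scale_left L2_inner_scale_right I_def algebra_simps)
  also have "\<dots> = of_real ((L2_norm M f)\<^sup>2 - 2 * r * (cmod I)\<^sup>2 + r\<^sup>2 * (cmod I)\<^sup>2 * (L2_norm M g)\<^sup>2)"
  proof -
    have 1: "cnj c * I = of_real (r * (cmod I)\<^sup>2)" "c * cnj I = of_real (r * (cmod I)\<^sup>2)"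
      "c * cnj c = of_real (r\<^sup>2 * (cmod I)\<^sup>2)"
      using complex_norm_square[of I] by (simp_all add: c_def power2_eq_square mult_ac)
    show ?thesis unfolding 1 L2_inner_self by (simp add: algebra_simps)
  qed
  finally show ?thesis
    unfolding L2_inner_self of_real_eq_iff by (simp add: c_def I_def)
qed

lemma L2_Cauchy_Schwarz:
  assumes "f \<in> L2 M" "g \<in> L2 M"
  shows "cmod (L2_inner M f g) \<le> L2_norm M f * L2_norm M g"
proof -
  define I where "I = L2_inner M f g"
  define G where "G = (L2_norm M g)\<^sup>2"
  have *: "0 \<le> (L2_norm M f)\<^sup>2 - 2 * r * (cmod I)\<^sup>2 + r\<^sup>2 * (cmod I)\<^sup>2 * G" for r :: real
    using L2_norm_sq_diff_projection[OF assms, of r] by (metis G_def I_def zero_le_power2)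
  have "(cmod I)\<^sup>2 \<le> (L2_norm M f)\<^sup>2 * G"
  proof (cases "G = 0")
    case True
    have "(cmod I)\<^sup>2 = 0"
    proof (rule ccontr)
      \<comment> \<open>When \<open>g\<close> has norm zero, the nonnegative expression is affine in
        \<open>r\<close> with negative slope; this \<open>r\<close> would make it equal to
        -1.\<close>
      assume "(cmod I)\<^sup>2 \<noteq> 0"
      then have "2 * (((L2_norm M f)\<^sup>2 + 1) / (2 * (cmod I)\<^sup>2)) * (cmod I)\<^sup>2 = (L2_norm M f)\<^sup>2 + 1"
        by simp
      then show False
        using *[of "((L2_norm M f)\<^sup>2 + 1) / (2 * (cmod I)\<^sup>2)"] True by simp
    qed
    then show ?thesis using True by simp
  next
    case False
    then have "0 < G" unfolding G_def by (simp add: zero_less_power2)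
    have "2 * (1 / G) * (cmod I)\<^sup>2 = 2 * ((cmod I)\<^sup>2 / G)" "(1 / G)\<^sup>2 * (cmod I)\<^sup>2 * G = (cmod I)\<^sup>2 / G"
      using \<open>0 < G\<close> by (simp_all add: power2_eq_square)
    then have "(cmod I)\<^sup>2 / G \<le> (L2_norm M f)\<^sup>2" using *[of "1 / G"] by linarith
    then show ?thesis using \<open>0 < G\<close> by (simp add: pos_divide_le_eq)
  qed
  then have "(cmod I)\<^sup>2 \<le> (L2_norm M f * L2_norm M g)\<^sup>2"
    by (simp add: G_def power_mult_distrib)
  then show ?thesis unfolding I_def
    by (rule power2_le_imp_le) (simp add: L2_norm_nonneg)
qed

lemma L2_norm_triangle:
  assumes "f \<in> L2 M" "g \<in> L2 M"
  shows "L2_norm M (\<lambda>x. f x + g x) \<le> L2_norm M f + L2_norm M g"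
proof (rule power2_le_imp_le)
  have "(L2_norm M (\<lambda>x. f x + g x))\<^sup>2 = (L2_norm M f)\<^sup>2 + (L2_norm M g)\<^sup>2 + 2 * Re (L2_inner M f g)"
    using assms L2_inner_commute[of M g f]
    by (simp add: L2_norm_sq_inner L2_inner_add_left L2_inner_add_right L2_add)
  also have "Re (L2_inner M f g) \<le> L2_norm M f * L2_norm M g"
    using L2_Cauchy_Schwarz[OF assms] complex_Re_le_cmod order_trans by blast
  finally show "(L2_norm M (\<lambda>x. f x + g x))\<^sup>2 \<le> (L2_norm M f + L2_norm M g)\<^sup>2"
    by (simp add: power2_sum)
qed (simp add: L2_norm_nonneg)

lemma L2_norm_minus_commute: "L2_norm M (\<lambda>x. f x - g x) = L2_norm M (\<lambda>x. g x - f x)"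
  by (simp add: L2_norm_def norm_minus_commute)

lemma L2_norm_triangle3:
  assumes "f \<in> L2 M" "g \<in> L2 M" "h \<in> L2 M"
  shows "L2_norm M (\<lambda>x. f x - h x) \<le> L2_norm M (\<lambda>x. f x - g x) + L2_norm M (\<lambda>x. g x - h x)"
  using L2_norm_triangle[OF L2_diff[OF assms(1,2)] L2_diff[OF assms(2,3)]] by simp

lemma L2_parallelogram:
  assumes "f \<in> L2 M" "g \<in> L2 M"
  shows "(L2_norm M (\<lambda>x. f x + g x))\<^sup>2 + (L2_norm M (\<lambda>x. f x - g x))\<^sup>2
    = 2 * (L2_norm M f)\<^sup>2 + 2 * (L2_norm M g)\<^sup>2"
  using assms
  by (simp add: L2_norm_sq_inner L2_inner_add_left L2_inner_add_right L2_add L2_diff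
      L2_inner_diff_left L2_inner_diff_right)

lemma L2_orthogonal_all_imp_0:
  assumes "h \<in> L2 M" "\<And>f. f \<in> L2 M \<Longrightarrow> L2_inner M f h = 0"
  shows "AE x in M. h x = 0"
  using L2_norm_eq_0[OF assms(1)] assms(2)[OF assms(1)] by (simp add: L2_inner_self)

lemma L2_inner_tendsto:
  assumes "\<And>n. u n \<in> L2 M" "\<And>n. v n \<in> L2 M" "f \<in> L2 M" "g \<in> L2 M"
    "(\<lambda>n. L2_norm M (\<lambda>x. f x - u n x)) \<longlonglongrightarrow> 0" "(\<lambda>n. L2_norm M (\<lambda>x. g x - v n x)) \<longlonglongrightarrow> 0"
  shows "(\<lambda>n. L2_inner M (u n) (v n)) \<longlonglongrightarrow> L2_inner M f g"
proof -
  let ?a = "\<lambda>n. L2_norm M (\<lambda>x. f x - u n x)" and ?b = "\<lambda>n. L2_norm M (\<lambda>x. g x - v n x)"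
  have "(\<lambda>n. L2_inner M f g - L2_inner M (u n) (v n)) \<longlonglongrightarrow> 0"
  proof (rule Lim_null_comparison)
    show "\<forall>\<^sub>F n in sequentially. norm (L2_inner M f g - L2_inner M (u n) (v n))
       \<le> ?a n * L2_norm M g + L2_norm M f * ?b n + ?a n * ?b n"
    proof (rule always_eventually, rule allI)
      fix n
      have d: "(\<lambda>x. f x - u n x) \<in> L2 M" "(\<lambda>x. g x - v n x) \<in> L2 M"
        using assms by (auto intro: L2_diff)
      have eq: "L2_inner M f g - L2_inner M (u n) (v n)
        = L2_inner M (\<lambda>x. f x - u n x) g + L2_inner M f (\<lambda>x. g x - v n x)
          - L2_inner M (\<lambda>x. f x - u n x) (\<lambda>x. g x - v n x)"
        using assms d by (simp add: L2_inner_diff_left L2_inner_diff_right)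
      have "norm (L2_inner M f g - L2_inner M (u n) (v n)) \<le> cmod (L2_inner M (\<lambda>x. f x - u n x) g) + cmod (L2_inner M f (\<lambda>x. g x - v n x))
          + cmod (L2_inner M (\<lambda>x. f x - u n x) (\<lambda>x. g x - v n x))"
        unfolding eq using norm_triangle_ineq4[of "L2_inner M (\<lambda>x. f x - u n x) g + L2_inner M f (\<lambda>x. g x - v n x)"
            "L2_inner M (\<lambda>x. f x - u n x) (\<lambda>x. g x - v n x)"]
          norm_triangle_ineq[of "L2_inner M (\<lambda>x. f x - u n x) g" "L2_inner M f (\<lambda>x. g x - v n x)"]
        by linarith
      also have "\<dots> \<le> ?a n * L2_norm M g + L2_norm M f * ?b n + ?a n * ?b n"
        using L2_Cauchy_Schwarz[OF d(1) assms(4)] L2_Cauchy_Schwarz[OF assms(3) d(2)]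
          L2_Cauchy_Schwarz[OF d] by linarith
      finally show "norm (L2_inner M f g - L2_inner M (u n) (v n))
         \<le> ?a n * L2_norm M g + L2_norm M f * ?b n + ?a n * ?b n" .
    qed
    have "(\<lambda>n. ?a n * L2_norm M g + L2_norm M f * ?b n + ?a n * ?b n) \<longlonglongrightarrow> 0 * L2_norm M g + L2_norm M f * 0 + 0 * 0"
      by (intro tendsto_intros assms)
    then show "(\<lambda>n. ?a n * L2_norm M g + L2_norm M f * ?b n + ?a n * ?b n) \<longlonglongrightarrow> 0" by simp
  qed
  from tendsto_diff[OF tendsto_const[of "L2_inner M f g"] this] show ?thesis by simp
qed

text \<open>Fatou's lemma turns pointwise convergence of an \<open>L\<^sup>2\<close> Cauchy sequence into norm convergence.\<close>

lemma L2_Cauchy_AE_limit: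
  assumes u: "\<And>n. u n \<in> L2 M" and f: "f \<in> borel_measurable M"
    and lim: "AE x in M. (\<lambda>n. u n x) \<longlonglongrightarrow> f x"
    and Cauchy: "\<And>e. 0 < e \<Longrightarrow> \<exists>N. \<forall>m\<ge>N. \<forall>n\<ge>N. L2_norm M (\<lambda>x. u m x - u n x) < e"
  shows "f \<in> L2 M" "(\<lambda>n. L2_norm M (\<lambda>x. f x - u n x)) \<longlonglongrightarrow> 0"
proof -
  have [measurable]: "f \<in> borel_measurable M" "\<And>n. u n \<in> borel_measurable M"
    using f L2_measurable[OF u] by auto
  have key: "(\<lambda>x. f x - u n x) \<in> L2 M \<and> L2_norm M (\<lambda>x. f x - u n x) \<le> e"
    if N: "\<forall>m\<ge>N. \<forall>n\<ge>N. L2_norm M (\<lambda>x. u m x - u n x) < e" and "n \<ge> N" "0 < e" for N n e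
  proof -
    have "(\<integral>\<^sup>+x. ennreal ((cmod (f x - u n x))\<^sup>2) \<partial>M)
      = (\<integral>\<^sup>+x. liminf (\<lambda>m. ennreal ((cmod (u m x - u n x))\<^sup>2)) \<partial>M)"
    proof (rule nn_integral_cong_AE)
      show "AE x in M. ennreal ((cmod (f x - u n x))\<^sup>2) = liminf (\<lambda>m. ennreal ((cmod (u m x - u n x))\<^sup>2))"
        using lim
      proof eventually_elim
        case (elim x)
        have "(\<lambda>m. ennreal ((cmod (u m x - u n x))\<^sup>2)) \<longlonglongrightarrow> ennreal ((cmod (f x - u n x))\<^sup>2)"
          by (intro tendsto_ennrealI tendsto_intros elim)
        then show ?case by (metis lim_imp_Liminf trivial_limit_sequentially)
      qed
    qed
    also have "\<dots> \<le> liminf (\<lambda>m. \<integral>\<^sup>+x. ennreal ((cmod (u m x - u n x))\<^sup>2) \<partial>M)"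
      by (intro nn_integral_liminf) auto
    also have "\<dots> \<le> ennreal (e\<^sup>2)"
    proof (rule Liminf_le, simp)
      show "\<forall>\<^sub>F m in sequentially. (\<integral>\<^sup>+x. ennreal ((cmod (u m x - u n x))\<^sup>2) \<partial>M) \<le> ennreal (e\<^sup>2)"
        using eventually_ge_at_top[of N]
      proof eventually_elim
        case (elim m)
        have "(\<integral>\<^sup>+x. ennreal ((cmod (u m x - u n x))\<^sup>2) \<partial>M) = ennreal ((L2_norm M (\<lambda>x. u m x - u n x))\<^sup>2)"
          unfolding L2_norm_sq by (intro nn_integral_eq_integral L2_integrable L2_diff u) auto
        also have "\<dots> \<le> ennreal (e\<^sup>2)"
          using N elim \<open>n \<ge> N\<close> by (intro ennreal_leI power_mono L2_norm_nonneg) (auto intro: less_imp_le)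
        finally show ?case .
      qed
    qed
    finally have le: "(\<integral>\<^sup>+x. ennreal ((cmod (f x - u n x))\<^sup>2) \<partial>M) \<le> ennreal (e\<^sup>2)" .
    then have "integrable M (\<lambda>x. (cmod (f x - u n x))\<^sup>2)"
      by (intro integrableI_bounded) (auto intro: le_less_trans)
    then have L2: "(\<lambda>x. f x - u n x) \<in> L2 M" by (simp add: L2_def)
    have "ennreal ((L2_norm M (\<lambda>x. f x - u n x))\<^sup>2) \<le> ennreal (e\<^sup>2)"
      using le nn_integral_eq_integral[OF L2_integrable[OF L2]] by (simp add: L2_norm_sq)
    then have "(L2_norm M (\<lambda>x. f x - u n x))\<^sup>2 \<le> e\<^sup>2" by (simp add: ennreal_le_iff)
    then show ?thesis using L2 \<open>0 < e\<close> by (auto intro: power2_le_imp_le)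
  qed
  obtain N where "\<forall>m\<ge>N. \<forall>n\<ge>N. L2_norm M (\<lambda>x. u m x - u n x) < 1"
    using Cauchy[of 1] by auto
  from key[OF this order_refl] have "(\<lambda>x. f x - u N x) \<in> L2 M" by simp
  from L2_add[OF this u[of N]] show "f \<in> L2 M" by simp
  show "(\<lambda>n. L2_norm M (\<lambda>x. f x - u n x)) \<longlonglongrightarrow> 0"
  proof (rule LIMSEQ_I)
    fix r :: real assume "0 < r"
    then obtain N where "\<forall>m\<ge>N. \<forall>n\<ge>N. L2_norm M (\<lambda>x. u m x - u n x) < r / 2"
      using Cauchy[of "r / 2"] by auto
    from key[OF this] \<open>0 < r\<close>
    show "\<exists>no. \<forall>n\<ge>no. norm (L2_norm M (\<lambda>x. f x - u n x) - 0) < r"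
      by (intro exI[of _ N]) (force simp: L2_norm_nonneg)
  qed
qed

text \<open>Riesz-Fischer. A rapidly Cauchy subsequence converges almost everywhere, and
  \<open>L2_Cauchy_AE_limit\<close> upgrades this to convergence in norm.\<close>

theorem L2_complete:
  assumes u: "\<And>n. u n \<in> L2 M"
    and Cauchy: "\<And>e. 0 < e \<Longrightarrow> \<exists>N. \<forall>m\<ge>N. \<forall>n\<ge>N. L2_norm M (\<lambda>x. u m x - u n x) < e"
  obtains f where "f \<in> L2 M" "(\<lambda>n. L2_norm M (\<lambda>x. f x - u n x)) \<longlonglongrightarrow> 0"
proof -
  have [measurable]: "\<And>n. u n \<in> borel_measurable M" using L2_measurable[OF u] by auto
  obtain N where N: "\<And>k m n. m \<ge> N k \<Longrightarrow> n \<ge> N k \<Longrightarrow> L2_norm M (\<lambda>x. u m x - u n x) < (1/2)^k"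
  proof -
    have "\<forall>k. \<exists>N. \<forall>m\<ge>N. \<forall>n\<ge>N. L2_norm M (\<lambda>x. u m x - u n x) < (1/2)^k"
      using Cauchy by simp
    from choice[OF this] that show thesis by blast
  qed
  \<comment> \<open>The summand \<open>k\<close> makes \<open>s\<close> strictly increasing, and the
    sum dominates \<open>N k\<close> although \<open>N\<close> itself may fail to be
    monotone.\<close>
  define s where "s k = k + (\<Sum>j\<le>k. N j)" for k :: nat
  have sN: "s k \<ge> N k" for k
    unfolding s_def using member_le_sum[of k "{..k}" N] by (simp add: trans_le_add2)
  have s_mono: "s k < s (Suc k)" for k by (simp add: s_def)
  have ss: "strict_mono s" by (simp add: s_mono strict_mono_Suc_iff)
  have d: "L2_norm M (\<lambda>x. u (s (Suc k)) x - u (s k) x) < (1/2)^k" for k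
    by (rule N) (use sN[of k] s_mono[of k] in auto)
  define v where "v k x = u (s (Suc k)) x - u (s k) x" for k x
  have v: "v k \<in> L2 M" for k unfolding v_def by (intro L2_diff u)
  have [measurable]: "\<And>k. v k \<in> borel_measurable M" using L2_measurable[OF v] by auto
  \<comment> \<open>The weight \<open>2^k\<close> against squared norms of at most
    \<open>(1/4)^k\<close> leaves a convergent series. Hence almost everywhere the norm of
    \<open>v k x\<close> is at most a constant times \<open>2^(-k/2)\<close>, which is
    summable.\<close>
  have "(\<integral>\<^sup>+x. (\<Sum>k. ennreal (2^k * (cmod (v k x))\<^sup>2)) \<partial>M) = (\<Sum>k. \<integral>\<^sup>+x. ennreal (2^k * (cmod (v k x))\<^sup>2) \<partial>M)"
    by (intro nn_integral_suminf) auto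
  also have "\<dots> \<le> (\<Sum>k. ennreal ((1/2)^k))"
  proof (intro suminf_le)
    fix k
    have "(\<integral>\<^sup>+x. ennreal (2^k * (cmod (v k x))\<^sup>2) \<partial>M) = ennreal (2^k * (L2_norm M (v k))\<^sup>2)"
      unfolding L2_norm_sq
      by (subst nn_integral_eq_integral) (use L2_integrable[OF v] in auto)
    also have "2^k * (L2_norm M (v k))\<^sup>2 \<le> 2^k * ((1/2)^k)\<^sup>2"
      using d[of k] by (intro mult_left_mono power_mono) (auto simp: v_def[abs_def] L2_norm_nonneg)
    also have "\<dots> = (1/2)^k"
      by (simp add: power2_eq_square power_one_over)
    finally show "(\<integral>\<^sup>+x. ennreal (2^k * (cmod (v k x))\<^sup>2) \<partial>M) \<le> ennreal ((1/2)^k)"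
      by (simp add: ennreal_leI)
  qed auto
  also have "\<dots> = ennreal (\<Sum>k. (1/2)^k)"
    by (intro suminf_ennreal2 summable_geometric) auto
  also have "\<dots> < \<infinity>" by simp
  finally have fin: "(\<integral>\<^sup>+x. (\<Sum>k. ennreal (2^k * (cmod (v k x))\<^sup>2)) \<partial>M) \<noteq> \<infinity>" by simp
  have "AE x in M. (\<Sum>k. ennreal (2^k * (cmod (v k x))\<^sup>2)) \<noteq> \<infinity>"
    by (rule nn_integral_PInf_AE[OF _ fin]) measurable
  then have conv: "AE x in M. (\<lambda>n. u (s n) x) \<longlonglongrightarrow> lim (\<lambda>n. u (s n) x)"
  proof eventually_elim
    case (elim x)
    have sm: "summable (\<lambda>k. 2^k * (cmod (v k x))\<^sup>2)"
      by (rule summable_suminf_not_top) (use elim in auto)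
    have "Bseq (\<lambda>k. 2^k * (cmod (v k x))\<^sup>2)"
      using summable_LIMSEQ_zero[OF sm] by (intro convergent_imp_Bseq convergentI)
    then obtain K where K: "\<And>k. 2^k * (cmod (v k x))\<^sup>2 \<le> K\<^sup>2" "0 < K"
    proof -
      from \<open>Bseq _\<close> obtain B where B: "0 < B" "\<And>k. norm (2^k * (cmod (v k x))\<^sup>2) \<le> B"
        by (auto simp: Bseq_def)
      show thesis
        by (rule that[of "sqrt B"]) (use B in auto)
    qed
    have "summable (\<lambda>k. v k x)"
    proof (rule summable_comparison_test')
      show "summable (\<lambda>k. K * (1 / sqrt 2)^k)"
        by (intro summable_mult summable_geometric) (simp add: real_less_lsqrt)
      fix k :: nat
      have "(cmod (v k x))\<^sup>2 \<le> (K * (1 / sqrt 2)^k)\<^sup>2"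
        proof -
        have "((1 / sqrt 2)^k)\<^sup>2 = 1 / (2::real)^k"
          by (simp add: power_one_over power2_eq_square flip: power_mult_distrib)
        then show ?thesis using K(1)[of k] by (simp add: power_mult_distrib field_simps)
      qed
      then show "norm (v k x) \<le> K * (1 / sqrt 2)^k"
        by (rule power2_le_imp_le) (use K in auto)
    qed
    then have "(\<lambda>n. \<Sum>k<n. v k x) \<longlonglongrightarrow> (\<Sum>k. v k x)" by (rule summable_LIMSEQ)
    moreover have "(\<Sum>k<n. v k x) = u (s n) x - u (s 0) x" for n
      unfolding v_def by (rule sum_lessThan_telescope)
    ultimately have "(\<lambda>n. u (s n) x - u (s 0) x) \<longlonglongrightarrow> (\<Sum>k. v k x)" by simp
    then have "(\<lambda>n. u (s n) x - u (s 0) x + u (s 0) x) \<longlonglongrightarrow> (\<Sum>k. v k x) + u (s 0) x"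
      by (intro tendsto_intros)
    then show ?case by (simp add: limI)
  qed
  define f where "f x = lim (\<lambda>n. u (s n) x)" for x
  have fm: "f \<in> borel_measurable M" unfolding f_def by measurable
  have Cs: "\<exists>K. \<forall>m\<ge>K. \<forall>n\<ge>K. L2_norm M (\<lambda>x. u (s m) x - u (s n) x) < e" if e: "0 < e" for e
  proof -
    obtain K where "\<forall>m\<ge>K. \<forall>n\<ge>K. L2_norm M (\<lambda>x. u m x - u n x) < e" using Cauchy[OF e] by auto
    then show ?thesis using order_trans[OF _ seq_suble[OF ss]] by (intro exI[of _ K]) blast
  qed
  note lim = L2_Cauchy_AE_limit[of "\<lambda>n. u (s n)", OF u fm conv[folded f_def] Cs]
  show thesis
  proof (rule that[OF lim(1)])
    show "(\<lambda>n. L2_norm M (\<lambda>x. f x - u n x)) \<longlonglongrightarrow> 0"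
    proof (rule LIMSEQ_I)
      fix r :: real assume "0 < r"
      then obtain K where K: "\<forall>m\<ge>K. \<forall>n\<ge>K. L2_norm M (\<lambda>x. u m x - u n x) < r/2"
        using Cauchy[of "r/2"] by auto
      obtain K2 where K2: "\<forall>n\<ge>K2. norm (L2_norm M (\<lambda>x. f x - u (s n) x) - 0) < r/2"
        using LIMSEQ_D[OF lim(2), of "r/2"] \<open>0 < r\<close> by auto
      have "L2_norm M (\<lambda>x. f x - u n x) < r" if "n \<ge> K" for n
      proof -
        define j where "j = max K K2"
        have "L2_norm M (\<lambda>x. f x - u n x) \<le> L2_norm M (\<lambda>x. f x - u (s j) x) + L2_norm M (\<lambda>x. u (s j) x - u n x)"
          by (intro L2_norm_triangle3 u lim(1))
        also have "\<dots> < r/2 + r/2"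
          using K[rule_format, of "s j" n] K2[rule_format, of j] that seq_suble[OF ss, of j]
          by (intro add_strict_mono) (auto simp: j_def)
        finally show ?thesis by simp
      qed
      then show "\<exists>no. \<forall>n\<ge>no. norm (L2_norm M (\<lambda>x. f x - u n x) - 0) < r"
        by (intro exI[of _ K]) (simp add: L2_norm_nonneg)
    qed
  qed
qed

section \<open>Total families and unitary operators\<close>

text \<open>Lists of coefficient-index pairs allow repeated indices, so that sums and scalar
  multiples of combinations are plain list operations.\<close>

definition lin_comb :: "('i \<Rightarrow> 'a \<Rightarrow> complex) \<Rightarrow> (complex \<times> 'i) list \<Rightarrow> 'a \<Rightarrow> complex" where
  "lin_comb a cs x = (\<Sum>(c, i)\<leftarrow>cs. c * a i x)"

lemma lin_comb_Nil: "lin_comb a [] = (\<lambda>x. 0)"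
  and lin_comb_Cons: "lin_comb a ((c, i) # cs) = (\<lambda>x. c * a i x + lin_comb a cs x)"
  and lin_comb_append: "lin_comb a (cs @ ds) = (\<lambda>x. lin_comb a cs x + lin_comb a ds x)"
  by (auto simp: lin_comb_def)

lemma lin_comb_scale: "lin_comb a (map (apfst ((*) c)) cs) = (\<lambda>x. c * lin_comb a cs x)"
  by (induction cs) (auto simp: lin_comb_Nil lin_comb_Cons fun_eq_iff algebra_simps)

lemma L2_lin_comb:
  assumes "\<And>i. a i \<in> L2 M" shows "lin_comb a cs \<in> L2 M"
  by (induction cs) (auto simp: lin_comb_Nil lin_comb_Cons intro!: L2_add L2_scale L2_zero assms)

text \<open>Stated through the orthogonal complement because that is what the moment arguments
  verify; density of the span follows in \<open>total_family_dense\<close>.\<close>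

definition total_family :: "'a measure \<Rightarrow> ('i \<Rightarrow> 'a \<Rightarrow> complex) \<Rightarrow> bool" where
  "total_family M a \<longleftrightarrow> (\<forall>i. a i \<in> L2 M) \<and>
     (\<forall>f\<in>L2 M. (\<forall>i. L2_inner M f (a i) = 0) \<longrightarrow> (AE x in M. f x = 0))"

text \<open>A sequence of linear combinations minimising the distance to \<open>f\<close> is Cauchy by the
  parallelogram law, and \<open>f\<close> minus its limit is orthogonal to the family.\<close>

lemma total_family_dense:
  assumes "total_family M a" "f \<in> L2 M" "0 < e"
  obtains cs where "L2_norm M (\<lambda>x. f x - lin_comb a cs x) < e"
proof -
  have a: "\<And>i. a i \<in> L2 M" using assms(1) by (simp add: total_family_def)
  note lc = L2_lin_comb[of a, OF a]
  define D where "D cs = (L2_norm M (\<lambda>x. f x - lin_comb a cs x))\<^sup>2" for cs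
  define d where "d = Inf (range D)"
  have bdd: "bdd_below (range D)" by (rule bdd_belowI[of _ 0]) (auto simp: D_def)
  have d_le: "d \<le> D cs" for cs unfolding d_def by (rule cInf_lower) (auto simp: bdd)
  have "\<exists>cs. D cs < d + inverse (real (Suc n))" for n
  proof -
    have "Inf (range D) < d + inverse (real (Suc n))" by (simp add: d_def)
    from cInf_lessD[OF _ this] show ?thesis by auto
  qed
  then obtain cs where cs: "\<And>n. D (cs n) < d + inverse (real (Suc n))" by metis
  define u where "u n = lin_comb a (cs n)" for n
  have u: "u n \<in> L2 M" for n unfolding u_def by (rule lc)
  have fu: "(\<lambda>x. f x - u n x) \<in> L2 M" for n by (intro L2_diff assms u)
  have Cauchy: "(L2_norm M (\<lambda>x. u m x - u n x))\<^sup>2 \<le> 2 * inverse (real (Suc m)) + 2 * inverse (real (Suc n))" for m n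
  proof -
    \<comment> \<open>The midpoint of two almost minimising combinations is again a combination, so
      its squared distance from \<open>f\<close> is at least \<open>d\<close>. This bounds the sum
      term of the parallelogram law from below.\<close>
    let ?mid = "map (apfst ((*) (1/2))) (cs m @ cs n)"
    have "(L2_norm M (\<lambda>x. (f x - u m x) + (f x - u n x)))\<^sup>2 = (L2_norm M (\<lambda>x. 2 * (f x - lin_comb a ?mid x)))\<^sup>2"
      by (simp only: lin_comb_scale lin_comb_append u_def) (simp add: algebra_simps)
    also have "\<dots> = 4 * D ?mid"
      unfolding L2_norm_scale D_def by (simp add: power_mult_distrib)
    finally have "4 * d \<le> (L2_norm M (\<lambda>x. (f x - u m x) + (f x - u n x)))\<^sup>2"
      using d_le[of ?mid] by simp
    moreover have "L2_norm M (\<lambda>x. (f x - u m x) - (f x - u n x)) = L2_norm M (\<lambda>x. u m x - u n x)"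
      by (subst L2_norm_minus_commute) simp
    ultimately show ?thesis
      using L2_parallelogram[OF fu[of m] fu[of n]] cs[of m] cs[of n] by (simp add: D_def u_def)
  qed
  have Cau: "\<exists>N. \<forall>m\<ge>N. \<forall>n\<ge>N. L2_norm M (\<lambda>x. u m x - u n x) < r" if r: "0 < r" for r
  proof -
    obtain N where N: "inverse (real (Suc N)) < r\<^sup>2 / 4"
      using reals_Archimedean[of "r\<^sup>2 / 4"] r by auto
    have "L2_norm M (\<lambda>x. u m x - u n x) < r" if "m \<ge> N" "n \<ge> N" for m n
    proof -
      have "inverse (real (Suc m)) \<le> inverse (real (Suc N))" "inverse (real (Suc n)) \<le> inverse (real (Suc N))"
        using that by (auto intro!: le_imp_inverse_le)
      then have "(L2_norm M (\<lambda>x. u m x - u n x))\<^sup>2 < r\<^sup>2" using Cauchy[of m n] N by linarith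
      then show ?thesis using r by (auto intro: power2_less_imp_less)
    qed
    then show ?thesis by blast
  qed
  obtain g where g: "g \<in> L2 M" "(\<lambda>n. L2_norm M (\<lambda>x. g x - u n x)) \<longlonglongrightarrow> 0"
    using L2_complete[OF u Cau] by blast
  define r where "r x = f x - g x" for x
  have r: "r \<in> L2 M" unfolding r_def by (intro L2_diff assms g)
  have lim: "(\<lambda>n. L2_norm M (\<lambda>x. r x - (f x - u n x))) \<longlonglongrightarrow> 0"
  proof -
    have "L2_norm M (\<lambda>x. r x - (f x - u n x)) = L2_norm M (\<lambda>x. g x - u n x)" for n
      by (subst L2_norm_minus_commute) (simp add: r_def)
    then show ?thesis using g(2) by simp
  qed
  have "L2_inner M r (a i) = 0" for i
  proof -
    define A where "A = (L2_norm M (a i))\<^sup>2"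
    define I where "I n = L2_inner M (\<lambda>x. f x - u n x) (a i)" for n
    have A0: "0 \<le> A" by (simp add: A_def)
    have bound: "(cmod (I n))\<^sup>2 \<le> (A + 1) * inverse (real (Suc n))" for n
    proof -
      \<comment> \<open>The exact minimiser would be \<open>1 / A\<close>; adding 1 avoids a
        division by zero and costs only a constant.\<close>
      define s where "s = 1 / (A + 1)"
      have s: "0 < s" "s\<^sup>2 * A \<le> s" using A0
        by (auto simp: s_def power2_eq_square divide_simps)
      have "D (cs n @ [(of_real s * I n, i)]) = (L2_norm M (\<lambda>x. (f x - u n x) - of_real s * I n * a i x))\<^sup>2"
        by (simp only: D_def lin_comb_append lin_comb_Cons lin_comb_Nil u_def) (simp add: algebra_simps)
      also have "\<dots> = D (cs n) - 2 * s * (cmod (I n))\<^sup>2 + s\<^sup>2 * (cmod (I n))\<^sup>2 * A"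
        using L2_norm_sq_diff_projection[OF fu a, of n s i] by (simp add: I_def A_def D_def u_def)
      finally have "d \<le> D (cs n) - 2 * s * (cmod (I n))\<^sup>2 + s\<^sup>2 * (cmod (I n))\<^sup>2 * A"
        using d_le by metis
      moreover have "s\<^sup>2 * (cmod (I n))\<^sup>2 * A \<le> s * (cmod (I n))\<^sup>2"
        using mult_right_mono[OF s(2), of "(cmod (I n))\<^sup>2"] by (simp add: mult_ac)
      ultimately have "s * (cmod (I n))\<^sup>2 \<le> inverse (real (Suc n))" using cs[of n] by linarith
      then show ?thesis using A0 unfolding s_def by (simp add: pos_divide_le_eq mult_ac)
    qed
    have "(\<lambda>n. (cmod (I n))\<^sup>2) \<longlonglongrightarrow> 0"
    proof (rule Lim_null_comparison)
      show "\<forall>\<^sub>F n in sequentially. norm ((cmod (I n))\<^sup>2) \<le> (A + 1) * inverse (real (Suc n))"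
        using bound by simp
      show "(\<lambda>n. (A + 1) * inverse (real (Suc n))) \<longlonglongrightarrow> 0"
        using tendsto_mult_right_zero[OF LIMSEQ_inverse_real_of_nat, of "A + 1"] by simp
    qed
    moreover have "(\<lambda>n. (cmod (I n))\<^sup>2) \<longlonglongrightarrow> (cmod (L2_inner M r (a i)))\<^sup>2"
    proof -
      have "I \<longlonglongrightarrow> L2_inner M r (a i)"
        unfolding I_def
        by (rule L2_inner_tendsto[where v = "\<lambda>n. a i"]) (use fu a r lim in \<open>auto simp: L2_norm_def\<close>)
      then show ?thesis by (intro tendsto_intros)
    qed
    ultimately show ?thesis using LIMSEQ_unique by fastforce
  qed
  then have "AE x in M. r x = 0" using assms(1) r by (auto simp: total_family_def)
  then have "L2_norm M (\<lambda>x. g x - u n x) = L2_norm M (\<lambda>x. f x - u n x)" for n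
    using assms(2) g(1) u[of n] by (intro L2_norm_cong_AE) (auto simp: r_def intro!: L2_measurable L2_diff)
  then have "(\<lambda>n. L2_norm M (\<lambda>x. f x - u n x)) \<longlonglongrightarrow> 0" using g(2) by simp
  from LIMSEQ_D[OF this assms(3)] obtain n where "norm (L2_norm M (\<lambda>x. f x - u n x) - 0) < e" by blast
  then have "L2_norm M (\<lambda>x. f x - u n x) < e" by simp
  then show thesis using that by (auto simp: u_def)
qed

lemma total_family_seq:
  assumes "total_family M a" "f \<in> L2 M"
  obtains cs where "(\<lambda>n. L2_norm M (\<lambda>x. f x - lin_comb a (cs n) x)) \<longlonglongrightarrow> 0"
proof -
  have "\<exists>cs. L2_norm M (\<lambda>x. f x - lin_comb a cs x) < inverse (real (Suc n))" for n
    by (rule total_family_dense[OF assms, of "inverse (real (Suc n))"]) auto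
  then obtain cs where cs: "\<And>n. L2_norm M (\<lambda>x. f x - lin_comb a (cs n) x) < inverse (real (Suc n))" by metis
  have "(\<lambda>n. L2_norm M (\<lambda>x. f x - lin_comb a (cs n) x)) \<longlonglongrightarrow> 0"
  proof (rule Lim_null_comparison)
    show "\<forall>\<^sub>F n in sequentially. norm (L2_norm M (\<lambda>x. f x - lin_comb a (cs n) x)) \<le> inverse (real (Suc n))"
      using cs by (intro always_eventually allI) (auto simp: L2_norm_nonneg intro: less_imp_le)
    show "(\<lambda>n. inverse (real (Suc n))) \<longlonglongrightarrow> 0" by (rule LIMSEQ_inverse_real_of_nat)
  qed
  then show thesis using that by blast
qed

lemma L2_norm_diff_eqI:
  assumes "f \<in> L2 M" "g \<in> L2 M" "\<phi> \<in> L2 N" "\<psi> \<in> L2 N"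
    "L2_inner M f f = L2_inner N \<phi> \<phi>" "L2_inner M f g = L2_inner N \<phi> \<psi>" "L2_inner M g g = L2_inner N \<psi> \<psi>"
  shows "L2_norm M (\<lambda>x. f x - g x) = L2_norm N (\<lambda>x. \<phi> x - \<psi> x)"
proof -
  have "L2_inner M g f = L2_inner N \<psi> \<phi>"
    using assms(6) L2_inner_commute by metis
  then have "(L2_norm M (\<lambda>x. f x - g x))\<^sup>2 = (L2_norm N (\<lambda>x. \<phi> x - \<psi> x))\<^sup>2"
    using assms by (simp add: L2_norm_sq_inner L2_inner_diff_left L2_inner_diff_right L2_diff)
  then show ?thesis by (simp add: L2_norm_nonneg)
qed

lemma L2_inner_lin_comb_left:
  assumes "\<And>i. a i \<in> L2 M" "g \<in> L2 M"
  shows "L2_inner M (lin_comb a cs) g = (\<Sum>(c, i)\<leftarrow>cs. c * L2_inner M (a i) g)"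
proof (induction cs)
  case Nil
  then show ?case by (simp add: lin_comb_Nil L2_inner_def)
next
  case (Cons p cs)
  then show ?case
    using assms by (cases p) (simp add: lin_comb_Cons L2_inner_add_left L2_scale L2_lin_comb L2_inner_scale_left)
qed

lemma gram_lin_comb:
  assumes "\<And>i. a i \<in> L2 M" "\<And>i. b i \<in> L2 N" "\<And>i j. L2_inner M (a i) (a j) = L2_inner N (b i) (b j)"
  shows "L2_inner M (lin_comb a cs) (lin_comb a ds) = L2_inner N (lin_comb b cs) (lin_comb b ds)"
proof -
  have "L2_inner M (a i) (lin_comb a ds) = L2_inner N (b i) (lin_comb b ds)" for i
  proof -
    have "L2_inner M (lin_comb a ds) (a i) = L2_inner N (lin_comb b ds) (b i)"
      using assms by (simp add: L2_inner_lin_comb_left)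
    then show ?thesis using L2_inner_commute by metis
  qed
  then show ?thesis
    using assms by (simp add: L2_inner_lin_comb_left L2_lin_comb)
qed

text \<open>Equal Gram matrices give equal distances between combinations with the same
  coefficients, so convergence on one side forces the Cauchy property on the other.\<close>

lemma equal_gram_limit:
  assumes f: "f \<in> L2 M" and cs: "(\<lambda>n. L2_norm M (\<lambda>x. f x - lin_comb a (cs n) x)) \<longlonglongrightarrow> 0"
    and aL: "\<And>i. a i \<in> L2 M" and bL: "\<And>i. b i \<in> L2 N"
    and gram: "\<And>i j. L2_inner M (a i) (a j) = L2_inner N (b i) (b j)"
  shows "\<exists>\<phi>. \<phi> \<in> L2 N \<and> (\<lambda>n. L2_norm N (\<lambda>x. \<phi> x - lin_comb b (cs n) x)) \<longlonglongrightarrow> 0"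
proof -
  note lca = L2_lin_comb[of a, OF aL] and lcb = L2_lin_comb[of b, OF bL]
  have eq: "L2_norm N (\<lambda>x. lin_comb b (cs m) x - lin_comb b (cs n) x)
    = L2_norm M (\<lambda>x. lin_comb a (cs m) x - lin_comb a (cs n) x)" for m n
    by (intro L2_norm_diff_eqI lca lcb gram_lin_comb[symmetric] aL bL gram)
  have "\<exists>K. \<forall>m\<ge>K. \<forall>n\<ge>K. L2_norm N (\<lambda>x. lin_comb b (cs m) x - lin_comb b (cs n) x) < e" if e: "0 < e" for e
  proof -
    obtain K where K: "\<forall>n\<ge>K. norm (L2_norm M (\<lambda>x. f x - lin_comb a (cs n) x) - 0) < e / 2"
      using LIMSEQ_D[OF cs, of "e / 2"] e by auto
    have "L2_norm N (\<lambda>x. lin_comb b (cs m) x - lin_comb b (cs n) x) < e" if "m \<ge> K" "n \<ge> K" for m n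
    proof -
      have "L2_norm M (\<lambda>x. lin_comb a (cs m) x - lin_comb a (cs n) x)
        \<le> L2_norm M (\<lambda>x. lin_comb a (cs m) x - f x) + L2_norm M (\<lambda>x. f x - lin_comb a (cs n) x)"
        by (intro L2_norm_triangle3 lca f)
      then show ?thesis
        using K[rule_format, of m] K[rule_format, of n] that
        unfolding eq L2_norm_minus_commute[of M "lin_comb a (cs m)" f]
        by (simp add: L2_norm_nonneg)
    qed
    then show ?thesis by blast
  qed
  from L2_complete[OF lcb this] show ?thesis by blast
qed

section \<open>Unitary operators from equal Gram matrices\<close>

definition L2_unitary ::
    "'a measure \<Rightarrow> 'b measure \<Rightarrow> (('a \<Rightarrow> complex) \<Rightarrow> ('b \<Rightarrow> complex)) \<Rightarrow> bool" where
  "L2_unitary M N U \<longleftrightarrow>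
     (\<forall>f\<in>L2 M. U f \<in> L2 N) \<and>
     (\<forall>f\<in>L2 M. \<forall>g\<in>L2 M. L2_inner N (U f) (U g) = L2_inner M f g) \<and>
     (\<forall>\<phi>\<in>L2 N. \<exists>f\<in>L2 M. AE x in N. U f x = \<phi> x)"

text \<open>\<open>U\<close> is the continuous extension of \<open>a i\<close> \<mapsto>
  \<open>b i\<close>. The distance identity in the conclusion pins \<open>U\<close> down and lets
  every approximation by combinations of \<open>a\<close> be carried over with unchanged
  error.\<close>

theorem equal_gram_imp_unitary:
  assumes a: "total_family M a" and b: "total_family N b"
    and gram: "\<And>i j. L2_inner M (a i) (a j) = L2_inner N (b i) (b j)"
  obtains U where "L2_unitary M N U"
    "\<And>f cs. f \<in> L2 M \<Longrightarrow> L2_norm N (\<lambda>x. U f x - lin_comb b cs x) = L2_norm M (\<lambda>x. f x - lin_comb a cs x)"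
proof -
  have aL: "\<And>i. a i \<in> L2 M" and bL: "\<And>i. b i \<in> L2 N" using a b by (auto simp: total_family_def)
  note lca = L2_lin_comb[of a, OF aL] and lcb = L2_lin_comb[of b, OF bL]
  \<comment> \<open>Two vectors are related if a single sequence of coefficients approximates both.
    Inner products agree on related pairs by passing to the limit, so the related vector is unique
    up to null functions and \<open>U\<close> may pick any.\<close>
  define R where "R f \<phi> \<longleftrightarrow> f \<in> L2 M \<and> \<phi> \<in> L2 N \<and>
     (\<exists>cs. (\<lambda>n. L2_norm M (\<lambda>x. f x - lin_comb a (cs n) x)) \<longlonglongrightarrow> 0 \<and>
           (\<lambda>n. L2_norm N (\<lambda>x. \<phi> x - lin_comb b (cs n) x)) \<longlonglongrightarrow> 0)" for f \<phi>
  have ex1: "\<exists>\<phi>. R f \<phi>" if f: "f \<in> L2 M" for f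
  proof -
    obtain cs where cs: "(\<lambda>n. L2_norm M (\<lambda>x. f x - lin_comb a (cs n) x)) \<longlonglongrightarrow> 0"
      using total_family_seq[OF a f] by blast
    from equal_gram_limit[of f M a cs b N, OF f cs aL bL gram] show ?thesis using f cs unfolding R_def by blast
  qed
  have ex2: "\<exists>f. R f \<phi>" if \<phi>: "\<phi> \<in> L2 N" for \<phi>
  proof -
    obtain cs where cs: "(\<lambda>n. L2_norm N (\<lambda>x. \<phi> x - lin_comb b (cs n) x)) \<longlonglongrightarrow> 0"
      using total_family_seq[OF b \<phi>] by blast
    from equal_gram_limit[of \<phi> N b cs a M, OF \<phi> cs bL aL gram[symmetric]] show ?thesis using \<phi> cs unfolding R_def by blast
  qed
  have inner: "L2_inner M f g = L2_inner N \<phi> \<psi>" if R: "R f \<phi>" "R g \<psi>" for f g \<phi> \<psi>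
  proof -
    from R obtain cs ds where
      1: "(\<lambda>n. L2_norm M (\<lambda>x. f x - lin_comb a (cs n) x)) \<longlonglongrightarrow> 0" "(\<lambda>n. L2_norm N (\<lambda>x. \<phi> x - lin_comb b (cs n) x)) \<longlonglongrightarrow> 0"
      "(\<lambda>n. L2_norm M (\<lambda>x. g x - lin_comb a (ds n) x)) \<longlonglongrightarrow> 0" "(\<lambda>n. L2_norm N (\<lambda>x. \<psi> x - lin_comb b (ds n) x)) \<longlonglongrightarrow> 0"
      and 2: "f \<in> L2 M" "g \<in> L2 M" "\<phi> \<in> L2 N" "\<psi> \<in> L2 N"
      by (auto simp: R_def)
    have "(\<lambda>n. L2_inner M (lin_comb a (cs n)) (lin_comb a (ds n))) \<longlonglongrightarrow> L2_inner M f g"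
      by (rule L2_inner_tendsto[OF lca lca 2(1,2) 1(1,3)])
    moreover have "(\<lambda>n. L2_inner N (lin_comb b (cs n)) (lin_comb b (ds n))) \<longlonglongrightarrow> L2_inner N \<phi> \<psi>"
      by (rule L2_inner_tendsto[OF lcb lcb 2(3,4) 1(2,4)])
    ultimately show ?thesis
      unfolding gram_lin_comb[of a M b N, OF aL bL gram] by (rule LIMSEQ_unique)
  qed
  define U where "U f = (SOME \<phi>. R f \<phi>)" for f
  have U: "R f (U f)" if "f \<in> L2 M" for f
    unfolding U_def using ex1[OF that] by (rule someI_ex)
  have UL: "U f \<in> L2 N" if "f \<in> L2 M" for f using U[OF that] by (simp add: R_def)
  show thesis
  proof (rule that[of U])
    show "L2_unitary M N U"
      unfolding L2_unitary_def
    proof (intro conjI ballI)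
      fix \<phi> assume \<phi>: "\<phi> \<in> L2 N"
      then obtain f where f: "R f \<phi>" using ex2 by blast
      then have fL: "f \<in> L2 M" by (simp add: R_def)
      have "L2_norm N (\<lambda>x. U f x - \<phi> x) = L2_norm M (\<lambda>x. f x - f x)"
        by (rule L2_norm_diff_eqI[symmetric])
          (use fL \<phi> UL[OF fL] inner[OF U[OF fL] U[OF fL]] inner[OF U[OF fL] f] inner[OF f f] in simp_all)
      then have "L2_norm N (\<lambda>x. U f x - \<phi> x) = 0" by (simp add: L2_norm_def)
      then have "AE x in N. U f x = \<phi> x"
        using L2_norm_eq_0[OF L2_diff[OF UL[OF fL] \<phi>]] by simp
      then show "\<exists>f\<in>L2 M. AE x in N. U f x = \<phi> x" using fL by blast
    next
      fix f g assume "f \<in> L2 M" "g \<in> L2 M"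
      then show "L2_inner N (U f) (U g) = L2_inner M f g" using inner[OF U U] by simp
    qed (rule UL)
    show "L2_norm N (\<lambda>x. U f x - lin_comb b cs x) = L2_norm M (\<lambda>x. f x - lin_comb a cs x)" if "f \<in> L2 M" for f cs
    proof (rule L2_norm_diff_eqI[symmetric])
      have "R (lin_comb a cs) (lin_comb b cs)"
        unfolding R_def by (intro conjI lca lcb exI[of _ "\<lambda>n. cs"]) (auto simp: L2_norm_def)
      then show "L2_inner M f (lin_comb a cs) = L2_inner N (U f) (lin_comb b cs)"
        "L2_inner M (lin_comb a cs) (lin_comb a cs) = L2_inner N (lin_comb b cs) (lin_comb b cs)"
        "L2_inner M f f = L2_inner N (U f) (U f)"
        using inner U[OF that] by blast+
    qed (use that UL lca lcb in auto)
  qed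
qed

section \<open>Uniqueness in the moment problem\<close>

lemma emeasure_density_eq_integral:
  fixes q :: "'a \<Rightarrow> real"
  assumes q: "integrable N q" "\<And>x. 0 \<le> q x" and X[measurable]: "X \<in> sets N"
  shows "emeasure (density N q) X = ennreal (LINT x|N. indicator X x * q x)"
proof -
  have [measurable]: "q \<in> borel_measurable N" using q by auto
  have "emeasure (density N q) X = (\<integral>\<^sup>+x. ennreal (indicator X x * q x) \<partial>N)"
    by (subst emeasure_density) (auto intro!: nn_integral_cong split: split_indicator)
  also have "\<dots> = ennreal (LINT x|N. indicator X x * q x)"
    using q integrable_mult_indicator[of X N q] by (intro nn_integral_eq_integral) auto
  finally show ?thesis .
qed

lemma finite_borel_measure_density:
  fixes h :: "real \<Rightarrow> real"
  assumes "integrable lborel h" "\<And>x. 0 \<le> h x"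
  shows "finite_borel_measure (density lborel h)"
    and "cdf (density lborel h) a = (LINT x|lborel. indicator {..a} x * h x)"
proof -
  have [measurable]: "h \<in> borel_measurable borel" using assms(1) by auto
  have e: "emeasure (density lborel h) X = ennreal (LINT x|lborel. indicator X x * h x)" if "X \<in> sets borel" for X
    using emeasure_density_eq_integral[OF assms, of X] that by simp
  show "finite_borel_measure (density lborel h)"
    by (intro finite_borel_measure.intro finite_measureI finite_borel_measure_axioms.intro)
      (auto simp: e)
  show "cdf (density lborel h) a = (LINT x|lborel. indicator {..a} x * h x)"
    unfolding cdf_def measure_def
    by (subst e) (auto intro!: enn2real_ennreal Bochner_Integration.integral_nonneg mult_nonneg_nonneg assms)
qed

text \<open>The positive and negative parts are densities of two finite measures with the same
  distribution function, so the measures coincide.\<close>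

lemma half_line_integrals_zero_imp_AE_zero_real:
  fixes h :: "real \<Rightarrow> real"
  assumes h: "integrable lborel h" and 0: "\<And>a. (LINT x|lborel. indicator {..a} x * h x) = 0"
  shows "AE x in lborel. h x = 0"
proof -
  have [measurable]: "h \<in> borel_measurable borel" using h by auto
  define p q where "p x = max 0 (h x)" and "q x = max 0 (- h x)" for x
  have pq: "integrable lborel p" "integrable lborel q" "\<And>x. 0 \<le> p x" "\<And>x. 0 \<le> q x"
    unfolding p_def q_def using h by (auto intro!: integrable_max)
  have "cdf (density lborel p) a = cdf (density lborel q) a" for a
  proof -
    have i: "integrable lborel (\<lambda>x. indicator {..a} x * p x)" "integrable lborel (\<lambda>x. indicator {..a} x * q x)"
      using integrable_mult_indicator[of "{..a}" lborel p] integrable_mult_indicator[of "{..a}" lborel q] pq by auto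
    have "(LINT x|lborel. indicator {..a} x * p x) - (LINT x|lborel. indicator {..a} x * q x)
      = (LINT x|lborel. indicator {..a} x * h x)"
      by (subst Bochner_Integration.integral_diff[OF i, symmetric])
        (auto intro!: Bochner_Integration.integral_cong simp: p_def q_def split: split_indicator)
    then show ?thesis using 0[of a] by (simp add: finite_borel_measure_density pq)
  qed
  then have "density lborel p = density lborel q"
    by (intro cdf_unique' finite_borel_measure_density(1) pq) auto
  then have "AE x in lborel. ennreal (p x) = ennreal (q x)"
    using sigma_finite_measure.density_unique_iff[OF sigma_finite_lborel, of "\<lambda>x. ennreal (p x)" "\<lambda>x. ennreal (q x)"]
    by (auto simp: p_def q_def)
  then show ?thesis
    by eventually_elim (auto simp: p_def q_def max_def split: if_splits)
qed

lemma half_line_integrals_zero_imp_AE_zero: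
  fixes h :: "real \<Rightarrow> complex"
  assumes h: "integrable lborel h" and 0: "\<And>a. (LINT x|lborel. indicator {..a} x *\<^sub>R h x) = 0"
  shows "AE x in lborel. h x = 0"
proof -
  have i: "integrable lborel (\<lambda>x. indicator {..a} x *\<^sub>R h x)" for a :: real
    using h by (intro integrable_mult_indicator) auto
  have "AE x in lborel. Re (h x) = 0"
    using h arg_cong[OF 0, of Re] i
    by (intro half_line_integrals_zero_imp_AE_zero_real) (auto simp flip: integral_Re)
  moreover have "AE x in lborel. Im (h x) = 0"
    using h arg_cong[OF 0, of Im] i
    by (intro half_line_integrals_zero_imp_AE_zero_real) (auto simp flip: integral_Im)
  ultimately show ?thesis by eventually_elim (simp add: complex_eq_iff)
qed

text \<open>Weierstrass approximation on \<open>{0..1}\<close>, where \<open>m\<close> takes its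
  values: polynomials in \<open>m\<close> contribute zero by linearity, and the error is controlled
  by the integral of \<open>norm (h x)\<close>.\<close>

lemma moments_zero_imp_continuous_zero:
  fixes h :: "'a \<Rightarrow> complex" and m :: "'a \<Rightarrow> real"
  assumes h: "integrable M h" and [measurable]: "m \<in> borel_measurable M"
    and m: "\<And>x. x \<in> space M \<Longrightarrow> 0 \<le> m x \<and> m x \<le> 1"
    and 0: "\<And>n. (LINT x|M. of_real (m x ^ n) * h x) = 0"
    and c: "continuous_on UNIV \<phi>"
  shows "(LINT x|M. of_real (\<phi> (m x)) * h x) = 0"
proof -
  have [measurable]: "h \<in> borel_measurable M" using h by auto
  have [measurable]: "\<phi> \<in> borel_measurable borel" using c by (rule borel_measurable_continuous_onI)
  have int: "integrable M (\<lambda>x. of_real (\<psi> (m x)) * h x)"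
    if cont: "continuous_on UNIV \<psi>" for \<psi> :: "real \<Rightarrow> real"
  proof -
    have [measurable]: "\<psi> \<in> borel_measurable borel" using cont by (rule borel_measurable_continuous_onI)
    have "bounded (\<psi> ` {0..1})"
      by (intro compact_imp_bounded compact_continuous_image continuous_on_subset[OF cont]) auto
    then obtain B where B: "\<And>x. x \<in> {0..1} \<Longrightarrow> norm (\<psi> x) \<le> B" unfolding bounded_iff by blast
    show ?thesis
    proof (rule Bochner_Integration.integrable_bound)
      show "integrable M (\<lambda>x. B * norm (h x))" using h by auto
      show "AE x in M. norm (of_real (\<psi> (m x)) * h x) \<le> norm (B * norm (h x))"
      proof (rule AE_I2)
        fix x assume x: "x \<in> space M"
        have "\<bar>\<psi> (m x)\<bar> \<le> B" using B[of "m x"] m[OF x] by auto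
        then have "\<bar>\<psi> (m x)\<bar> * norm (h x) \<le> \<bar>B\<bar> * norm (h x)" by (intro mult_right_mono) auto
        then show "norm (of_real (\<psi> (m x)) * h x) \<le> norm (B * norm (h x))" by (simp add: norm_mult abs_mult)
      qed
    qed measurable
  qed
  define H where "H = (LINT x|M. norm (h x))"
  have "norm (LINT x|M. of_real (\<phi> (m x)) * h x) \<le> e * H" if e: "0 < e" for e
  proof -
    obtain p where p: "real_polynomial_function p" "\<And>x. x \<in> {0..1} \<Longrightarrow> \<bar>\<phi> x - p x\<bar> < e"
      using Stone_Weierstrass_real_polynomial_function[of "{0..1}" \<phi> e] e continuous_on_subset[OF c] by auto
    then obtain a n where a: "p = (\<lambda>x. \<Sum>i\<le>n. a i * x ^ i)"
      using real_polynomial_function_iff_sum by auto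
    have cp: "continuous_on UNIV p" by (auto simp: a intro!: continuous_intros)
    have "(LINT x|M. of_real (p (m x)) * h x) = (LINT x|M. (\<Sum>i\<le>n. of_real (a i) * (of_real (m x ^ i) * h x)))"
      by (simp add: a sum_distrib_right mult.assoc)
    also have "\<dots> = (\<Sum>i\<le>n. of_real (a i) * (LINT x|M. of_real (m x ^ i) * h x))"
    proof -
      have "integrable M (\<lambda>x. of_real (m x ^ i) * h x)" for i
        by (rule int) (intro continuous_intros)
      then show ?thesis by (subst Bochner_Integration.integral_sum) (auto simp del: of_real_power)
    qed
    also have "\<dots> = 0" using 0 by simp
    finally have "(LINT x|M. of_real (\<phi> (m x)) * h x) = (LINT x|M. of_real (\<phi> (m x)) * h x - of_real (p (m x)) * h x)"
      using int[OF c] int[OF cp] by simp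
    also have "norm \<dots> \<le> (LINT x|M. norm (of_real (\<phi> (m x)) * h x - of_real (p (m x)) * h x))"
      by (rule integral_norm_bound)
    also have "\<dots> \<le> (LINT x|M. e * norm (h x))"
    proof (rule integral_mono)
      show "integrable M (\<lambda>x. norm (of_real (\<phi> (m x)) * h x - of_real (p (m x)) * h x))"
        using int[OF c] int[OF cp] by auto
      fix x assume x: "x \<in> space M"
      have "norm (of_real (\<phi> (m x)) * h x - of_real (p (m x)) * h x) = \<bar>\<phi> (m x) - p (m x)\<bar> * norm (h x)"
        by (simp flip: left_diff_distrib of_real_diff add: norm_mult)
      also have "\<dots> \<le> e * norm (h x)"
        using p(2)[of "m x"] m[OF x] by (intro mult_right_mono) auto
      finally show "norm (of_real (\<phi> (m x)) * h x - of_real (p (m x)) * h x) \<le> e * norm (h x)" .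
    qed (use h in auto)
    finally show ?thesis by (simp add: H_def)
  qed note * = this
  have H0: "0 \<le> H" by (simp add: H_def)
  have "norm (LINT x|M. of_real (\<phi> (m x)) * h x) \<le> 0"
  proof (rule field_le_epsilon)
    fix e :: real assume e: "0 < e"
    have "norm (LINT x|M. of_real (\<phi> (m x)) * h x) \<le> (e / (H + 1)) * H"
      using e H0 by (intro *) auto
    also have "\<dots> \<le> e" using e H0 by (simp add: divide_simps)
    finally show "norm (LINT x|M. of_real (\<phi> (m x)) * h x) \<le> 0 + e" by simp
  qed
  then show ?thesis by simp
qed

lemma moments_zero_imp_sublevel_zero:
  fixes h :: "'a \<Rightarrow> complex" and m :: "'a \<Rightarrow> real"
  assumes h: "integrable M h" and [measurable]: "m \<in> borel_measurable M"
    and m: "\<And>x. x \<in> space M \<Longrightarrow> 0 \<le> m x \<and> m x \<le> 1"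
    and 0: "\<And>n. (LINT x|M. of_real (m x ^ n) * h x) = 0"
  shows "(LINT x|M. of_real (indicator {..c} (m x)) * h x) = 0"
proof -
  have [measurable]: "h \<in> borel_measurable M" using h by auto
  \<comment> \<open>Continuous ramps that, for \<open>n > 0\<close>, equal 1 up to \<open>c\<close>
    and 0 from \<open>c + 1/n\<close> on; they converge pointwise to the indicator, also at
    \<open>c\<close> itself.\<close>
  define \<phi> where "\<phi> n u = max 0 (1 - real n * max 0 (u - c))" for n u
  have "(\<lambda>n. LINT x|M. of_real (\<phi> n (m x)) * h x) \<longlonglongrightarrow> (LINT x|M. of_real (indicator {..c} (m x)) * h x)"
  proof (rule integral_dominated_convergence[where w = "\<lambda>x. norm (h x)"])
    show "AE x in M. (\<lambda>n. of_real (\<phi> n (m x)) * h x) \<longlonglongrightarrow> of_real (indicator {..c} (m x)) * h x"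
    proof (rule AE_I2)
      fix x
      have "(\<lambda>n. \<phi> n u) \<longlonglongrightarrow> indicator {..c} u" for u
      proof (cases "u \<le> c")
        case True then show ?thesis by (simp add: \<phi>_def)
      next
        case False
        then obtain n0 :: nat where n0: "1 / (u - c) < real n0" using reals_Archimedean2 by blast
        have "\<phi> n u = 0" if "n \<ge> n0" for n
        proof -
          have "1 / (u - c) < real n" using n0 that by linarith
          then have "1 < real n * (u - c)" using False by (simp add: field_simps)
          then show ?thesis using False by (simp add: \<phi>_def)
        qed
        then have "\<forall>\<^sub>F n in sequentially. \<phi> n u = 0" using eventually_sequentially by blast
        then show ?thesis using False by (simp add: tendsto_eventually)
      qed
      then show "(\<lambda>n. of_real (\<phi> n (m x)) * h x) \<longlonglongrightarrow> of_real (indicator {..c} (m x)) * h x"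
        by (intro tendsto_mult tendsto_of_real tendsto_const)
    qed
    show "AE x in M. norm (of_real (\<phi> n (m x)) * h x) \<le> norm (h x)" for n
    proof (rule AE_I2)
      fix x have "\<bar>\<phi> n (m x)\<bar> \<le> 1" by (auto simp: \<phi>_def)
      then show "norm (of_real (\<phi> n (m x)) * h x) \<le> norm (h x)"
        using mult_right_mono[of "\<bar>\<phi> n (m x)\<bar>" 1 "norm (h x)"] by (simp add: norm_mult)
    qed
  qed (use h in \<open>auto simp: \<phi>_def\<close>)
  moreover have "(LINT x|M. of_real (\<phi> n (m x)) * h x) = 0" for n
  proof (rule moments_zero_imp_continuous_zero[OF h assms(2) m 0, where \<phi> = "\<phi> n"])
    show "continuous_on UNIV (\<phi> n)" unfolding \<phi>_def by (intro continuous_intros)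
  qed
  ultimately show ?thesis by (simp add: LIMSEQ_const_iff)
qed

text \<open>The level is the supremum of \<open>m\<close> over \<open>T\<close>. A point of
  \<open>S\<close> outside \<open>T\<close> can satisfy the inequality only by attaining this level
  exactly, and injectivity allows one such point, which is harmless for Lebesgue measure.\<close>

lemma lower_set_eq_sublevel:
  fixes m :: "real \<Rightarrow> real"
  assumes "bdd_above (m ` T)" "T \<noteq> {}" "inj_on m S" "T \<subseteq> S"
    and lower: "\<And>x y. x \<in> T \<Longrightarrow> y \<in> S \<Longrightarrow> y \<notin> T \<Longrightarrow> m x \<le> m y"
  obtains c x0 where "\<And>x. x \<in> S \<Longrightarrow> x \<noteq> x0 \<Longrightarrow> m x \<le> c \<longleftrightarrow> x \<in> T"
proof -
  define c where "c = Sup (m ` T)"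
  have c1: "m x \<le> c" if "x \<in> T" for x unfolding c_def using that assms(1) by (intro cSup_upper) auto
  have c2: "c \<le> m y" if "y \<in> S" "y \<notin> T" for y
    unfolding c_def using assms(2) lower that by (intro cSup_least) auto
  show thesis
  proof (cases "\<exists>x\<in>S. x \<notin> T \<and> m x \<le> c")
    case True
    then obtain x0 where x0: "x0 \<in> S" "x0 \<notin> T" "m x0 \<le> c" by blast
    have "m x \<le> c \<longleftrightarrow> x \<in> T" if x: "x \<in> S" "x \<noteq> x0" for x
    proof
      assume *: "m x \<le> c"
      show "x \<in> T"
      proof (rule ccontr)
        assume "x \<notin> T"
        then have "m x = m x0" using c2[of x] c2[of x0] x x0 * by linarith
        then show False using inj_onD[OF assms(3)] x x0 by blast
      qed
    qed (rule c1)
    then show thesis using that by blast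
  next
    case False
    then have "m x \<le> c \<longleftrightarrow> x \<in> T" if "x \<in> S" for x using c1 that by blast
    then show thesis using that by blast
  qed
qed

text \<open>Trades sublevel sets of \<open>m\<close> for sets ordered by position, in practice half
  lines: within \<open>S\<close> a suitable sublevel set differs from \<open>T\<close> in at most
  one point, and outside \<open>S\<close> the function vanishes.\<close>

lemma sublevel_zero_imp_lower_set_zero:
  fixes h :: "real \<Rightarrow> complex" and m :: "real \<Rightarrow> real"
  assumes h: "integrable lborel h" and [measurable]: "m \<in> borel_measurable borel" "T \<in> sets borel"
    and m: "\<And>x. m x \<le> 1" and S: "\<And>x. x \<notin> S \<Longrightarrow> h x = 0" "inj_on m S"
    and lower: "\<And>x y. x \<in> S \<Longrightarrow> y \<in> S \<Longrightarrow> x \<in> T \<Longrightarrow> y \<notin> T \<Longrightarrow> m x \<le> m y"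
    and 0: "\<And>c. (LINT x|lborel. of_real (indicator {..c} (m x)) * h x) = 0"
  shows "(LINT x|lborel. indicator T x *\<^sub>R h x) = 0"
proof (cases "S \<inter> T = {}")
  case True
  then have "(\<lambda>x. indicator T x *\<^sub>R h x) = (\<lambda>x. 0)" using S(1) by (auto simp: indicator_def fun_eq_iff)
  then show ?thesis by simp
next
  case False
  have [measurable]: "h \<in> borel_measurable borel" using h by auto
  obtain c x0 where c: "\<And>x. x \<in> S \<Longrightarrow> x \<noteq> x0 \<Longrightarrow> m x \<le> c \<longleftrightarrow> x \<in> S \<inter> T"
    by (rule lower_set_eq_sublevel[of m "S \<inter> T" S]) (use m False S(2) lower in \<open>auto intro!: bdd_aboveI[of _ 1]\<close>)
  have "(LINT x|lborel. indicator T x *\<^sub>R h x) = (LINT x|lborel. of_real (indicator {..c} (m x)) * h x)"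
  proof (rule integral_cong_AE)
    show "AE x in lborel. indicator T x *\<^sub>R h x = of_real (indicator {..c} (m x)) * h x"
      using AE_lborel_singleton[of x0]
    proof eventually_elim
      case (elim x)
      then show ?case using c[of x] S(1)[of x] by (cases "x \<in> S") (auto split: split_indicator)
    qed
  qed measurable
  then show ?thesis using 0 by simp
qed

lemma sublevel_zero_decreasing_imp_AE_zero:
  fixes h :: "real \<Rightarrow> complex" and m :: "real \<Rightarrow> real"
  assumes h: "integrable lborel h" and [measurable]: "m \<in> borel_measurable borel"
    and m: "\<And>x. m x \<le> 1" and S: "\<And>x. x \<notin> S \<Longrightarrow> h x = 0" "strict_antimono_on S m"
    and 0: "\<And>c. (LINT x|lborel. of_real (indicator {..c} (m x)) * h x) = 0"
  shows "AE x in lborel. h x = 0"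
proof (rule half_line_integrals_zero_imp_AE_zero[OF h])
  fix a :: real
  have inj: "inj_on m S"
  proof (rule inj_onI, rule ccontr)
    fix x y assume *: "x \<in> S" "y \<in> S" "m x = m y" "x \<noteq> y"
    then show False
      using monotone_onD[OF S(2) *(1,2)] monotone_onD[OF S(2) *(2,1)] by (cases "x < y") auto
  qed
  have 1: "(LINT x|lborel. indicator {a<..} x *\<^sub>R h x) = 0"
  proof (rule sublevel_zero_imp_lower_set_zero[OF h _ _ m S(1) inj _ 0])
    fix x y assume *: "x \<in> S" "y \<in> S" "x \<in> {a<..}" "y \<notin> {a<..}"
    then have "y < x" by auto
    from monotone_onD[OF S(2) *(2,1) this] show "m x \<le> m y" by simp
  qed auto
  \<comment> \<open>Since \<open>m\<close> is at most 1, the sublevel set of level 1 is the whole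
    line. For decreasing \<open>m\<close> the lower sets are the right half lines, so left half
    lines are reached as complements.\<close>
  have 2: "(LINT x|lborel. h x) = 0" using 0[of 1] m by simp
  have "indicator {..a} x *\<^sub>R h x = h x - indicator {a<..} x *\<^sub>R h x" for x by (auto split: split_indicator)
  then have "(LINT x|lborel. indicator {..a} x *\<^sub>R h x) = (LINT x|lborel. h x - indicator {a<..} x *\<^sub>R h x)" by simp
  also have "\<dots> = 0"
    using h by (subst Bochner_Integration.integral_diff) (auto simp: 1 2 intro!: integrable_mult_indicator)
  finally show "(LINT x|lborel. indicator {..a} x *\<^sub>R h x) = 0" .
qed

lemma moments_zero_increasing_imp_AE_zero:
  fixes h :: "real \<Rightarrow> complex" and m :: "real \<Rightarrow> real"
  assumes h: "integrable lborel h" and [measurable]: "m \<in> borel_measurable borel"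
    and m: "\<And>x. 0 \<le> m x \<and> m x \<le> 1"
    and S: "\<And>x. x \<notin> S \<Longrightarrow> h x = 0" "strict_mono_on S m"
    and 0: "\<And>n. (LINT x|lborel. of_real (m x ^ n) * h x) = 0"
  shows "AE x in lborel. h x = 0"
proof (rule half_line_integrals_zero_imp_AE_zero[OF h])
  fix a :: real
  show "(LINT x|lborel. indicator {..a} x *\<^sub>R h x) = 0"
  proof (rule sublevel_zero_imp_lower_set_zero[OF h _ _ _ S(1)])
    show "inj_on m S" using S(2) by (rule strict_mono_on_imp_inj_on)
    fix x y assume *: "x \<in> S" "y \<in> S" "x \<in> {..a}" "y \<notin> {..a}"
    then have "x < y" by auto
    from strict_mono_onD[OF S(2) *(1,2) this] show "m x \<le> m y" by simp
  next
    show "(LINT x|lborel. of_real (indicator {..c} (m x)) * h x) = 0" for c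
      by (rule moments_zero_imp_sublevel_zero[OF h _ _ 0]) (use m in auto)
  qed (use m in auto)
qed

lemma moments_zero_decreasing_imp_AE_zero:
  fixes h :: "real \<Rightarrow> complex" and m :: "real \<Rightarrow> real"
  assumes h: "integrable lborel h" and [measurable]: "m \<in> borel_measurable borel"
    and m: "\<And>x. 0 \<le> m x \<and> m x \<le> 1"
    and S: "\<And>x. x \<notin> S \<Longrightarrow> h x = 0" "strict_antimono_on S m"
    and 0: "\<And>n. (LINT x|lborel. of_real (m x ^ n) * h x) = 0"
  shows "AE x in lborel. h x = 0"
proof (rule sublevel_zero_decreasing_imp_AE_zero[OF h _ _ S])
  show "(LINT x|lborel. of_real (indicator {..c} (m x)) * h x) = 0" for c
    by (rule moments_zero_imp_sublevel_zero[OF h _ _ 0]) (use m in auto)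
qed (use m in auto)

section \<open>Multiplication operators\<close>

lemma L2_unitary_L2: "L2_unitary M N U \<Longrightarrow> f \<in> L2 M \<Longrightarrow> U f \<in> L2 N"
  and L2_unitary_inner: "L2_unitary M N U \<Longrightarrow> f \<in> L2 M \<Longrightarrow> g \<in> L2 M \<Longrightarrow> L2_inner N (U f) (U g) = L2_inner M f g"
  and L2_unitary_surj: "L2_unitary M N U \<Longrightarrow> \<phi> \<in> L2 N \<Longrightarrow> \<exists>f\<in>L2 M. AE x in N. U f x = \<phi> x"
  by (auto simp: L2_unitary_def)

lemma L2_unitary_norm_diff:
  assumes "L2_unitary M N U" "f \<in> L2 M" "g \<in> L2 M"
  shows "L2_norm N (\<lambda>x. U f x - U g x) = L2_norm M (\<lambda>x. f x - g x)"
  by (rule L2_norm_diff_eqI) (use assms in \<open>auto simp: L2_unitary_L2 L2_unitary_inner\<close>)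

lemma L2_unitary_norm:
  assumes "L2_unitary M N U" "f \<in> L2 M"
  shows "L2_norm N (U f) = L2_norm M f"
proof -
  have "(L2_norm N (U f))\<^sup>2 = (L2_norm M f)\<^sup>2" using assms by (simp add: L2_norm_sq_inner L2_unitary_inner)
  then show ?thesis by (simp add: L2_norm_nonneg)
qed

lemma L2_unitary_AE_eqI:
  assumes "L2_unitary M N U" "f \<in> L2 M" "g \<in> L2 M" "AE x in N. U f x = U g x"
  shows "AE x in M. f x = g x"
proof -
  have "L2_norm N (\<lambda>x. U f x - U g x) = 0"
    using L2_norm_eq_0[OF L2_diff[OF L2_unitary_L2[OF assms(1,2)] L2_unitary_L2[OF assms(1,3)]]] assms(4) by simp
  then have "L2_norm M (\<lambda>x. f x - g x) = 0" using L2_unitary_norm_diff[OF assms(1-3)] by simp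
  then show ?thesis using L2_norm_eq_0[OF L2_diff[OF assms(2,3)]] by simp
qed

text \<open>\<open>L2_unitary\<close> does not postulate linearity. It follows from this lemma,
  since preserved inner products make the defect of linearity orthogonal to the range of
  \<open>U\<close>, which is everything.\<close>

lemma L2_unitary_AE_0I:
  assumes U: "L2_unitary M N U" and \<psi>: "\<psi> \<in> L2 N" and 0: "\<And>k. k \<in> L2 M \<Longrightarrow> L2_inner N (U k) \<psi> = 0"
  shows "AE x in N. \<psi> x = 0"
proof (rule L2_orthogonal_all_imp_0[OF \<psi>])
  fix \<phi> assume \<phi>: "\<phi> \<in> L2 N"
  then obtain f where f: "f \<in> L2 M" "AE x in N. U f x = \<phi> x" using L2_unitary_surj[OF U] by blast
  have "L2_inner N \<phi> \<psi> = L2_inner N (U f) \<psi>"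
    by (rule L2_inner_cong_AE) (use f \<phi> \<psi> L2_unitary_L2[OF U f(1)] in \<open>auto simp: L2_measurable\<close>)
  then show "L2_inner N \<phi> \<psi> = 0" using 0 f by simp
qed

lemma L2_unitary_add:
  assumes U: "L2_unitary M N U" and fg: "f \<in> L2 M" "g \<in> L2 M"
  shows "AE x in N. U (\<lambda>x. f x + g x) x = U f x + U g x"
proof -
  have "AE x in N. U (\<lambda>x. f x + g x) x - (U f x + U g x) = 0"
    by (rule L2_unitary_AE_0I[OF U])
      (use U fg in \<open>auto simp: L2_inner_diff_right L2_inner_add_right L2_unitary_L2 L2_unitary_inner L2_add
        intro!: L2_diff\<close>)
  then show ?thesis by simp
qed

lemma L2_unitary_scale:
  assumes U: "L2_unitary M N U" and f: "f \<in> L2 M"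
  shows "AE x in N. U (\<lambda>x. c * f x) x = c * U f x"
proof -
  have "AE x in N. U (\<lambda>x. c * f x) x - c * U f x = 0"
    by (rule L2_unitary_AE_0I[OF U])
      (use U f in \<open>auto simp: L2_inner_diff_right L2_inner_scale_right L2_unitary_L2 L2_unitary_inner L2_scale
        intro!: L2_diff\<close>)
  then show ?thesis by simp
qed

lemma L2_norm_mult_le:
  assumes "f \<in> L2 M" and [measurable]: "m \<in> borel_measurable M" and m: "\<And>x. x \<in> space M \<Longrightarrow> cmod (m x) \<le> 1"
  shows "L2_norm M (\<lambda>x. m x * f x) \<le> L2_norm M f"
proof -
  have "(LINT x|M. (cmod (m x * f x))\<^sup>2) \<le> (LINT x|M. (cmod (f x))\<^sup>2)"
  proof (rule integral_mono)
    show "integrable M (\<lambda>x. (cmod (m x * f x))\<^sup>2)"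
      by (rule L2_integrable[OF L2_bounded_mult[OF assms(1,2) m]])
    fix x assume "x \<in> space M"
    then have "cmod (m x * f x) \<le> cmod (f x)" using m mult_right_mono[of "cmod (m x)" 1 "cmod (f x)"] by (simp add: norm_mult)
    then show "(cmod (m x * f x))\<^sup>2 \<le> (cmod (f x))\<^sup>2" by (simp add: power_mono)
  qed (rule L2_integrable[OF assms(1)])
  then show ?thesis by (simp add: L2_norm_def)
qed

text \<open>\<open>B\<close> is given only through its sesquilinear form, because it is chosen up to
  null functions; linearity is recovered by pairing with all vectors and the bound by pairing with
  \<open>B f\<close> itself. It serves both for \<open>A\<close> and for the projections
  \<open>E t\<close>.\<close>

lemma self_adjoint_multiplier:
  assumes U: "L2_unitary M N U" and [measurable]: "m \<in> borel_measurable N"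
    and m: "\<And>x. x \<in> space N \<Longrightarrow> \<bar>m x\<bar> \<le> (1::real)"
    and B: "\<And>f. f \<in> L2 M \<Longrightarrow> B f \<in> L2 M"
      "\<And>f g. f \<in> L2 M \<Longrightarrow> g \<in> L2 M \<Longrightarrow> L2_inner M f (B g) = L2_inner N (U f) (\<lambda>x. of_real (m x) * U g x)"
  shows "self_adjoint M B"
proof -
  have mU: "(\<lambda>x. of_real (m x) * U f x) \<in> L2 N" if "f \<in> L2 M" for f
    by (rule L2_bounded_mult[where C = 1]) (use m L2_unitary_L2[OF U that] in auto)
  have add: "AE x in M. B (\<lambda>x. f x + g x) x = B f x + B g x" if fg: "f \<in> L2 M" "g \<in> L2 M" for f g
  proof -
    have "AE x in M. B (\<lambda>x. f x + g x) x - (B f x + B g x) = 0"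
    proof (rule L2_orthogonal_all_imp_0)
      show "(\<lambda>x. B (\<lambda>x. f x + g x) x - (B f x + B g x)) \<in> L2 M" using fg by (intro L2_diff L2_add B)
      fix k assume k: "k \<in> L2 M"
      have "L2_inner N (U k) (\<lambda>x. of_real (m x) * U (\<lambda>x. f x + g x) x)
        = L2_inner N (U k) (\<lambda>x. of_real (m x) * U f x + of_real (m x) * U g x)"
      proof (rule L2_inner_cong_AE)
        show "AE x in N. of_real (m x) * U (\<lambda>x. f x + g x) x = of_real (m x) * U f x + of_real (m x) * U g x"
          using L2_unitary_add[OF U fg] by eventually_elim (simp add: distrib_left)
      qed (use fg k in \<open>auto intro!: L2_measurable mU L2_add L2_unitary_L2[OF U]\<close>)
      then show "L2_inner M k (\<lambda>x. B (\<lambda>x. f x + g x) x - (B f x + B g x)) = 0"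
        using fg k by (simp add: L2_inner_diff_right L2_inner_add_right B L2_add mU L2_unitary_L2[OF U])
    qed
    then show ?thesis by simp
  qed
  have scale: "AE x in M. B (\<lambda>x. c * f x) x = c * B f x" if f: "f \<in> L2 M" for c f
  proof -
    have "AE x in M. B (\<lambda>x. c * f x) x - c * B f x = 0"
    proof (rule L2_orthogonal_all_imp_0)
      show "(\<lambda>x. B (\<lambda>x. c * f x) x - c * B f x) \<in> L2 M" using f by (intro L2_diff L2_scale B)
      fix k assume k: "k \<in> L2 M"
      have "L2_inner N (U k) (\<lambda>x. of_real (m x) * U (\<lambda>x. c * f x) x)
        = L2_inner N (U k) (\<lambda>x. c * (of_real (m x) * U f x))"
      proof (rule L2_inner_cong_AE)
        show "AE x in N. of_real (m x) * U (\<lambda>x. c * f x) x = c * (of_real (m x) * U f x)"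
          using L2_unitary_scale[OF U f, of c] by eventually_elim simp
      qed (use f k in \<open>auto intro!: L2_measurable mU L2_scale L2_unitary_L2[OF U]\<close>)
      then show "L2_inner M k (\<lambda>x. B (\<lambda>x. c * f x) x - c * B f x) = 0"
        using f k by (simp add: L2_inner_diff_right L2_inner_scale_right B L2_scale mU L2_unitary_L2[OF U])
    qed
    then show ?thesis by simp
  qed
  have bound: "L2_norm M (B f) \<le> 1 * L2_norm M f" if f: "f \<in> L2 M" for f
  proof -
    have "(L2_norm M (B f))\<^sup>2 = Re (L2_inner N (U (B f)) (\<lambda>x. of_real (m x) * U f x))"
      using f by (simp add: L2_norm_sq_inner B)
    also have "\<dots> \<le> cmod (L2_inner N (U (B f)) (\<lambda>x. of_real (m x) * U f x))" by (rule complex_Re_le_cmod)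
    also have "\<dots> \<le> L2_norm N (U (B f)) * L2_norm N (\<lambda>x. of_real (m x) * U f x)"
      by (rule L2_Cauchy_Schwarz[OF L2_unitary_L2[OF U B(1)[OF f]] mU[OF f]])
    also have "\<dots> \<le> L2_norm M (B f) * L2_norm M f"
    proof (rule mult_mono)
      show "L2_norm N (\<lambda>x. of_real (m x) * U f x) \<le> L2_norm M f"
        using L2_norm_mult_le[OF L2_unitary_L2[OF U f], of "\<lambda>x. of_real (m x)"] m L2_unitary_norm[OF U f] by simp
    qed (use L2_unitary_norm[OF U B(1)[OF f]] in \<open>auto simp: L2_norm_nonneg\<close>)
    finally have "L2_norm M (B f) * L2_norm M (B f) \<le> L2_norm M (B f) * L2_norm M f" by (simp add: power2_eq_square)
    then show ?thesis
      using L2_norm_nonneg[of M "B f"] L2_norm_nonneg[of M f]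
      by (cases "L2_norm M (B f) = 0") (auto simp: mult_le_cancel_left)
  qed
  have sym: "L2_inner M (B f) g = L2_inner M f (B g)" if "f \<in> L2 M" "g \<in> L2 M" for f g
  proof -
    have "L2_inner M (B f) g = cnj (L2_inner N (U g) (\<lambda>x. of_real (m x) * U f x))"
      by (subst L2_inner_commute) (simp add: B that)
    also have "\<dots> = L2_inner N (\<lambda>x. of_real (m x) * U f x) (U g)" by (rule L2_inner_commute[symmetric])
    also have "\<dots> = L2_inner N (U f) (\<lambda>x. of_real (m x) * U g x)" by (simp add: L2_inner_def mult_ac)
    also have "\<dots> = L2_inner M f (B g)" by (simp add: B that)
    finally show ?thesis .
  qed
  show ?thesis
    unfolding self_adjoint_def bounded_operator_def
    using B(1) add scale bound sym by blast
qed

text \<open>\<open>l_mono\<close> is responsible for simplicity, as sublevel sets of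
  \<open>l\<close> then determine half lines, and \<open>l_null\<close> for absolute continuity, as
  null sets of spectral values pull back to null sets. The operator \<open>A\<close> enters through
  its form, which is what a chosen adjoint provides.\<close>

locale multiplication_model =
  fixes M :: "'a measure" and w l :: "real \<Rightarrow> real"
    and U :: "('a \<Rightarrow> complex) \<Rightarrow> real \<Rightarrow> complex" and A :: "('a \<Rightarrow> complex) \<Rightarrow> 'a \<Rightarrow> complex"
  assumes w: "integrable lborel w" "\<And>\<tau>. 0 \<le> w \<tau>" "\<And>\<tau>. \<tau> \<le> 0 \<Longrightarrow> w \<tau> = 0" "\<And>\<tau>. 0 < \<tau> \<Longrightarrow> 0 < w \<tau>"
    and l [measurable]: "l \<in> borel_measurable borel" and l01: "\<And>\<tau>. 0 \<le> l \<tau>" "\<And>\<tau>. l \<tau> \<le> 1"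
    and l_mono: "strict_antimono_on {0<..} l"
    and l_null: "\<And>Z. Z \<in> null_sets lborel \<Longrightarrow> {\<tau>. 0 < \<tau> \<and> l \<tau> \<in> Z} \<in> null_sets lborel"
    and U: "L2_unitary M (density lborel w) U"
    and A: "\<And>f. f \<in> L2 M \<Longrightarrow> A f \<in> L2 M"
      "\<And>f g. f \<in> L2 M \<Longrightarrow> g \<in> L2 M \<Longrightarrow>
        L2_inner M f (A g) = L2_inner (density lborel w) (U f) (\<lambda>\<tau>. of_real (l \<tau>) * U g \<tau>)"
begin

abbreviation N :: "real measure" where "N \<equiv> density lborel w"

lemma w_measurable [measurable]: "w \<in> borel_measurable borel" using w by auto

lemma U_L2: "f \<in> L2 M \<Longrightarrow> U f \<in> L2 N"
  by (rule L2_unitary_L2[OF U])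

lemma U_measurable: "f \<in> L2 M \<Longrightarrow> U f \<in> borel_measurable borel"
  using L2_measurable[OF U_L2] by simp

definition cutoff :: "real \<Rightarrow> real \<Rightarrow> real" where
  "cutoff t \<tau> = indicator {..t} (l \<tau>)"

lemma cutoff_measurable [measurable]: "cutoff t \<in> borel_measurable borel"
  unfolding cutoff_def by measurable

lemma cutoff_bound: "\<bar>cutoff t \<tau>\<bar> \<le> 1"
  by (simp add: cutoff_def split: split_indicator)

lemma cutoff_U: "f \<in> L2 M \<Longrightarrow> (\<lambda>\<tau>. of_real (cutoff t \<tau>) * U f \<tau>) \<in> L2 N"
  by (rule L2_bounded_mult[where C = 1, OF U_L2]) (auto simp: cutoff_bound)

lemma cutoff_U_measurable: "f \<in> L2 M \<Longrightarrow> (\<lambda>\<tau>. of_real (cutoff t \<tau>) * U f \<tau>) \<in> borel_measurable borel"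
  using L2_measurable[OF cutoff_U] by simp

definition E :: "real \<Rightarrow> ('a \<Rightarrow> complex) \<Rightarrow> 'a \<Rightarrow> complex" where
  "E t f = (SOME h. h \<in> L2 M \<and> (AE \<tau> in N. U h \<tau> = of_real (cutoff t \<tau>) * U f \<tau>))"

lemma E:
  assumes "f \<in> L2 M"
  shows "E t f \<in> L2 M" "AE \<tau> in N. U (E t f) \<tau> = of_real (cutoff t \<tau>) * U f \<tau>"
proof -
  have "\<exists>h. h \<in> L2 M \<and> (AE \<tau> in N. U h \<tau> = of_real (cutoff t \<tau>) * U f \<tau>)"
    using L2_unitary_surj[OF U cutoff_U[OF assms]] by blast
  from someI_ex[OF this] have "E t f \<in> L2 M \<and> (AE \<tau> in N. U (E t f) \<tau> = of_real (cutoff t \<tau>) * U f \<tau>)"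
    unfolding E_def .
  then show "E t f \<in> L2 M" "AE \<tau> in N. U (E t f) \<tau> = of_real (cutoff t \<tau>) * U f \<tau>" by auto
qed

lemma inner_E:
  assumes "f \<in> L2 M" "g \<in> L2 M"
  shows "L2_inner M f (E t g) = L2_inner N (U f) (\<lambda>\<tau>. of_real (cutoff t \<tau>) * U g \<tau>)"
proof -
  have "L2_inner M f (E t g) = L2_inner N (U f) (U (E t g))"
    by (rule L2_unitary_inner[OF U, symmetric]) (use assms E in auto)
  also have "\<dots> = L2_inner N (U f) (\<lambda>\<tau>. of_real (cutoff t \<tau>) * U g \<tau>)"
    by (rule L2_inner_cong_AE)
      (use assms E in \<open>auto simp: U_measurable cutoff_U_measurable\<close>)
  finally show ?thesis .
qed

lemma self_adjoint_A: "self_adjoint M A"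
  by (rule self_adjoint_multiplier[OF U, of l]) (use A l01 in auto)

lemma self_adjoint_E: "self_adjoint M (E t)"
  by (rule self_adjoint_multiplier[OF U, of "cutoff t"]) (use E(1) inner_E cutoff_bound in auto)

text \<open>The push-forward under \<open>l\<close> of the squared modulus of \<open>U f\<close>,
  which is the spectral measure of a multiplication operator. With it, statements about
  \<open>E\<close> become statements about distribution functions.\<close>

definition mass :: "('a \<Rightarrow> complex) \<Rightarrow> real measure" where
  "mass f = distr (density N (\<lambda>\<tau>. (cmod (U f \<tau>))\<^sup>2)) borel l"

lemma integrable_U: "f \<in> L2 M \<Longrightarrow> integrable N (\<lambda>\<tau>. (cmod (U f \<tau>))\<^sup>2)"
  by (rule L2_integrable[OF U_L2])

lemma finite_borel_measure_mass:
  assumes f: "f \<in> L2 M" shows "finite_borel_measure (mass f)"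
proof (intro finite_borel_measure.intro finite_measureI finite_borel_measure_axioms.intro)
  have "emeasure (mass f) (space (mass f)) = emeasure (density N (\<lambda>\<tau>. (cmod (U f \<tau>))\<^sup>2)) UNIV"
    unfolding mass_def by (subst emeasure_distr) auto
  also have "\<dots> \<noteq> \<infinity>"
    by (subst emeasure_density_eq_integral) (use integrable_U[OF f] in auto)
  finally show "emeasure (mass f) (space (mass f)) \<noteq> \<infinity>" .
qed (simp add: mass_def)

lemma cdf_mass:
  assumes f: "f \<in> L2 M"
  shows "cdf (mass f) t = (LINT \<tau>|N. cutoff t \<tau> * (cmod (U f \<tau>))\<^sup>2)"
proof -
  have "emeasure (mass f) {..t} = emeasure (density N (\<lambda>\<tau>. (cmod (U f \<tau>))\<^sup>2)) (l -` {..t})"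
    unfolding mass_def by (subst emeasure_distr) auto
  also have "\<dots> = ennreal (LINT \<tau>|N. indicator (l -` {..t}) \<tau> * (cmod (U f \<tau>))\<^sup>2)"
    by (rule emeasure_density_eq_integral) (use integrable_U[OF f] measurable_sets[OF l, of "{..t}"] in auto)
  also have "\<dots> = ennreal (LINT \<tau>|N. cutoff t \<tau> * (cmod (U f \<tau>))\<^sup>2)"
    by (intro arg_cong[of _ _ ennreal] Bochner_Integration.integral_cong) (auto simp: cutoff_def split: split_indicator)
  finally show ?thesis
    unfolding cdf_def measure_def
    by (simp add: enn2real_ennreal Bochner_Integration.integral_nonneg cutoff_def)
qed

lemma inner_E_self:
  assumes f: "f \<in> L2 M"
  shows "L2_inner M (E t f) f = of_real (cdf (mass f) t)"
proof -
  have "L2_inner M (E t f) f = cnj (L2_inner N (U f) (\<lambda>\<tau>. of_real (cutoff t \<tau>) * U f \<tau>))"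
    by (subst L2_inner_commute) (simp add: inner_E f)
  also have "L2_inner N (U f) (\<lambda>\<tau>. of_real (cutoff t \<tau>) * U f \<tau>) = (LINT \<tau>|N. of_real (cutoff t \<tau> * (cmod (U f \<tau>))\<^sup>2))"
    unfolding L2_inner_def by (intro Bochner_Integration.integral_cong)
      (auto simp: complex_norm_square mult_ac simp del: of_real_power)
  finally show ?thesis using f by (simp add: cdf_mass del: of_real_mult)
qed

lemma spectral_measure_eq:
  assumes f: "f \<in> L2 M" shows "spectral_measure M E f = mass f"
proof -
  interpret finite_borel_measure "mass f" by (rule finite_borel_measure_mass[OF f])
  have "spectral_measure M E f = interval_measure (cdf (mass f))"
    by (simp add: spectral_measure_def inner_E_self f)
  also have "\<dots> = mass f"
  proof (rule cdf_unique')
    show "finite_borel_measure (interval_measure (cdf (mass f)))"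
      by (rule finite_borel_measure_interval_measure[OF cdf_nondecreasing cdf_is_right_cont cdf_lim_at_bot cdf_lim_at_top]) auto
    show "cdf (interval_measure (cdf (mass f))) = cdf (mass f)"
      by (rule cdf_interval_measure[OF cdf_nondecreasing cdf_is_right_cont cdf_lim_at_bot])
  qed (rule finite_borel_measure_mass[OF f])
  finally show ?thesis .
qed

text \<open>The difference of two nested cutoffs takes only the values 0 and 1 and so equals its
  square. Strong right continuity of \<open>E\<close> thereby reduces to right continuity of a
  distribution function.\<close>

lemma norm_E_diff:
  assumes f: "f \<in> L2 M" and "t \<le> s"
  shows "L2_norm M (\<lambda>x. E s f x - E t f x) = sqrt (cdf (mass f) s - cdf (mass f) t)"
proof -
  have "L2_norm M (\<lambda>x. E s f x - E t f x) = L2_norm N (\<lambda>\<tau>. U (E s f) \<tau> - U (E t f) \<tau>)"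
    by (rule L2_unitary_norm_diff[OF U, symmetric]) (use E f in auto)
  also have "\<dots> = L2_norm N (\<lambda>\<tau>. of_real (cutoff s \<tau>) * U f \<tau> - of_real (cutoff t \<tau>) * U f \<tau>)"
  proof (rule L2_norm_cong_AE)
    show "AE \<tau> in N. U (E s f) \<tau> - U (E t f) \<tau> = of_real (cutoff s \<tau>) * U f \<tau> - of_real (cutoff t \<tau>) * U f \<tau>"
      using E(2)[OF f, of s] E(2)[OF f, of t] by eventually_elim simp
  qed (use f in \<open>auto simp: U_measurable cutoff_U_measurable E intro!: borel_measurable_diff\<close>)
  also have "\<dots> = sqrt (LINT \<tau>|N. cutoff s \<tau> * (cmod (U f \<tau>))\<^sup>2 - cutoff t \<tau> * (cmod (U f \<tau>))\<^sup>2)"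
    unfolding L2_norm_def using \<open>t \<le> s\<close>
    by (intro arg_cong[of _ _ sqrt] Bochner_Integration.integral_cong) (auto simp: cutoff_def split: split_indicator)
  also have "(LINT \<tau>|N. cutoff s \<tau> * (cmod (U f \<tau>))\<^sup>2 - cutoff t \<tau> * (cmod (U f \<tau>))\<^sup>2) = cdf (mass f) s - cdf (mass f) t"
  proof -
    have "integrable N (\<lambda>\<tau>. cutoff t \<tau> * (cmod (U f \<tau>))\<^sup>2)" for t
    proof (rule Bochner_Integration.integrable_bound[OF integrable_U[OF f]])
      show "(\<lambda>\<tau>. cutoff t \<tau> * (cmod (U f \<tau>))\<^sup>2) \<in> borel_measurable N" using U_measurable[OF f] by auto
    qed (auto simp: cutoff_def split: split_indicator)
    then show ?thesis by (simp add: cdf_mass f)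
  qed
  finally show ?thesis .
qed

lemma spectral_family_E: "spectral_family M E"
  unfolding spectral_family_def
proof (intro conjI allI ballI)
  fix s t f assume f: "f \<in> L2 M"
  show "AE x in M. E s (E t f) x = E (min s t) f x"
  proof (rule L2_unitary_AE_eqI[OF U])
    show "AE \<tau> in N. U (E s (E t f)) \<tau> = U (E (min s t) f) \<tau>"
      using E(2)[OF E(1)[OF f, of t], of s] E(2)[OF f, of t] E(2)[OF f, of "min s t"]
      by eventually_elim (auto simp: cutoff_def split: split_indicator)
  qed (use E f in auto)
next
  fix t f assume f: "f \<in> L2 M"
  interpret finite_borel_measure "mass f" by (rule finite_borel_measure_mass[OF f])
  have "((\<lambda>s. sqrt (cdf (mass f) s - cdf (mass f) t)) \<longlongrightarrow> sqrt (cdf (mass f) t - cdf (mass f) t)) (at_right t)"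
    using cdf_is_right_cont[of t] by (intro tendsto_intros) (simp add: continuous_within)
  then have "((\<lambda>s. sqrt (cdf (mass f) s - cdf (mass f) t)) \<longlongrightarrow> 0) (at_right t)" by simp
  moreover have "\<forall>\<^sub>F s in at_right t. sqrt (cdf (mass f) s - cdf (mass f) t) = L2_norm M (\<lambda>x. E s f x - E t f x)"
    unfolding eventually_at_filter by (intro always_eventually) (auto simp: norm_E_diff f)
  ultimately show "((\<lambda>s. L2_norm M (\<lambda>x. E s f x - E t f x)) \<longlongrightarrow> 0) (at_right t)"
    by (rule Lim_transform_eventually)
next
  fix f assume f: "f \<in> L2 M"
  \<comment> \<open>As \<open>l\<close> takes values in [0, 1], \<open>E t\<close> is zero below 0
    and the identity from 1 on, so both limits are those of eventually constant functions.\<close>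
  have "L2_norm M (E t f) = 0" if "t < 0" for t
  proof -
    have "L2_norm M (E t f) = L2_norm N (U (E t f))" by (rule L2_unitary_norm[OF U E(1)[OF f], symmetric])
    also have "\<dots> = L2_norm N (\<lambda>\<tau>. of_real (cutoff t \<tau>) * U f \<tau>)"
      by (rule L2_norm_cong_AE[OF E(2)[OF f]]) (use f in \<open>auto simp: U_measurable cutoff_U_measurable E\<close>)
    also have "(\<lambda>\<tau>. of_real (cutoff t \<tau>) * U f \<tau>) = (\<lambda>\<tau>. 0)"
      using l01(1) that by (auto simp: cutoff_def fun_eq_iff not_le split: split_indicator) (meson l01(1) leD le_less_trans)
    finally show ?thesis by (simp add: L2_norm_def)
  qed
  then show "((\<lambda>t. L2_norm M (E t f)) \<longlongrightarrow> 0) at_bot"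
    by (intro tendsto_eventually) (auto intro!: eventually_at_bot_linorderI[of "-1"])
next
  fix f assume f: "f \<in> L2 M"
  have "L2_norm M (\<lambda>x. E t f x - f x) = 0" if "1 \<le> t" for t
  proof -
    have "AE \<tau> in N. U (E t f) \<tau> = U f \<tau>"
      using E(2)[OF f, of t]
    proof eventually_elim
      case (elim \<tau>) then show ?case using l01(2)[of \<tau>] that by (simp add: cutoff_def)
    qed
    from L2_unitary_AE_eqI[OF U E(1)[OF f] f this] show ?thesis
      using L2_norm_eq_0[OF L2_diff[OF E(1)[OF f] f]] by simp
  qed
  then show "((\<lambda>t. L2_norm M (\<lambda>x. E t f x - f x)) \<longlongrightarrow> 0) at_top"
    by (intro tendsto_eventually) (auto intro!: eventually_at_top_linorderI[of 1])
qed (rule self_adjoint_E)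

lemma resolution_of_identity_E: "resolution_of_identity M A E"
  unfolding resolution_of_identity_def
proof (intro conjI ballI spectral_family_E)
  fix f assume f: "f \<in> L2 M"
  have [measurable]: "U f \<in> borel_measurable borel" by (rule U_measurable[OF f])
  have i: "integrable N (\<lambda>\<tau>. (cmod (U f \<tau>))\<^sup>2 * l \<tau>)"
  proof (rule Bochner_Integration.integrable_bound[OF integrable_U[OF f]])
    show "AE \<tau> in N. norm ((cmod (U f \<tau>))\<^sup>2 * l \<tau>) \<le> norm ((cmod (U f \<tau>))\<^sup>2)"
    proof (rule AE_I2)
      fix \<tau> show "norm ((cmod (U f \<tau>))\<^sup>2 * l \<tau>) \<le> norm ((cmod (U f \<tau>))\<^sup>2)"
        using mult_left_mono[OF l01(2)[of \<tau>], of "(cmod (U f \<tau>))\<^sup>2"] l01(1)[of \<tau>] by (simp add: abs_mult)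
    qed
  qed simp
  show "integrable (spectral_measure M E f) (\<lambda>t. t)"
    unfolding spectral_measure_eq[OF f] mass_def
    using i by (subst integrable_distr_eq) (auto simp: integrable_density)
  have "(LINT t|spectral_measure M E f. t) = (LINT \<tau>|N. (cmod (U f \<tau>))\<^sup>2 * l \<tau>)"
    unfolding spectral_measure_eq[OF f] mass_def
    by (subst integral_distr) (auto simp: integral_density)
  moreover have "L2_inner M (A f) f = of_real (LINT \<tau>|N. (cmod (U f \<tau>))\<^sup>2 * l \<tau>)"
  proof -
    have "L2_inner M (A f) f = cnj (L2_inner N (U f) (\<lambda>\<tau>. of_real (l \<tau>) * U f \<tau>))"
      by (subst L2_inner_commute) (simp add: A f)
    also have "L2_inner N (U f) (\<lambda>\<tau>. of_real (l \<tau>) * U f \<tau>) = (LINT \<tau>|N. of_real ((cmod (U f \<tau>))\<^sup>2 * l \<tau>))"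
      unfolding L2_inner_def by (intro Bochner_Integration.integral_cong)
        (auto simp: complex_norm_square mult_ac simp del: of_real_power)
    finally show ?thesis by (simp del: of_real_mult)
  qed
  ultimately show "L2_inner M (A f) f = of_real (LINT t|spectral_measure M E f. t)" by simp
qed

lemma absolutely_continuous_spectral_measure:
  assumes f: "f \<in> L2 M"
  shows "absolutely_continuous lborel (spectral_measure M E f)"
  unfolding absolutely_continuous_def
proof
  fix Z :: "real set" assume Z: "Z \<in> null_sets lborel"
  then have [measurable]: "Z \<in> sets borel" by auto
  have [measurable]: "U f \<in> borel_measurable borel" by (rule U_measurable[OF f])
  have Zl [measurable]: "l -` Z \<in> sets borel" using measurable_sets[OF l, of Z] by simp
  have "emeasure (mass f) Z = emeasure (density N (\<lambda>\<tau>. (cmod (U f \<tau>))\<^sup>2)) (l -` Z)"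
    unfolding mass_def by (subst emeasure_distr) auto
  also have "\<dots> = (\<integral>\<^sup>+\<tau>. ennreal (w \<tau>) * (ennreal ((cmod (U f \<tau>))\<^sup>2) * indicator (l -` Z) \<tau>) \<partial>lborel)"
    by (subst emeasure_density) (auto simp: nn_integral_density)
  also have "\<dots> = (\<integral>\<^sup>+\<tau>. 0 \<partial>(lborel::real measure))"
  proof (rule nn_integral_cong_AE)
    show "AE \<tau> in lborel. ennreal (w \<tau>) * (ennreal ((cmod (U f \<tau>))\<^sup>2) * indicator (l -` Z) \<tau>) = 0"
      using AE_not_in[OF l_null[OF Z]] by eventually_elim (auto simp: w(3) not_less split: split_indicator)
  qed
  finally show "Z \<in> null_sets (spectral_measure M E f)"
    unfolding spectral_measure_eq[OF f] by (auto simp: null_sets_def mass_def)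
qed

text \<open>The vector corresponding to the constant 1 generates: if \<open>f\<close> is orthogonal
  to all its projections, then \<open>U f\<close> times the weight integrates to zero over every
  sublevel set of \<open>l\<close> and hence vanishes.\<close>

lemma generating_vector_exists: "\<exists>g. generating_vector M E g"
proof -
  have "(\<lambda>\<tau>. 1) \<in> L2 N" using w by (auto simp: L2_def integrable_density)
  then obtain g where g: "g \<in> L2 M" "AE \<tau> in N. U g \<tau> = 1" using L2_unitary_surj[OF U] by blast
  \<comment> \<open>The lower endpoint lies below both \<open>t\<close> and 0: the interval is
    nonempty, as \<open>generating_vector\<close> demands, and the projection at its lower end
    vanishes.\<close>
  define a where "a t x = E t g x - E (- \<bar>t\<bar> - 1) g x" for t x
  have total: "total_family M a"
    unfolding total_family_def
  proof (intro conjI allI ballI impI)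
    show "a t \<in> L2 M" for t unfolding a_def by (intro L2_diff E g)
    fix f assume f: "f \<in> L2 M" and 0: "\<forall>t. L2_inner M f (a t) = 0"
    have [measurable]: "U f \<in> borel_measurable borel" by (rule U_measurable[OF f])
    have Ug: "L2_inner M f (E t g) = (LINT \<tau>|lborel. of_real (cutoff t \<tau>) * (of_real (w \<tau>) * U f \<tau>))" for t
    proof -
      have "L2_inner M f (E t g) = (LINT \<tau>|N. of_real (cutoff t \<tau>) * U f \<tau>)"
        unfolding inner_E[OF f g(1)]
        unfolding L2_inner_def
      proof (rule integral_cong_AE)
        show "AE \<tau> in N. U f \<tau> * cnj (of_real (cutoff t \<tau>) * U g \<tau>) = of_real (cutoff t \<tau>) * U f \<tau>"
          using g(2) by eventually_elim simp
      qed (use U_measurable[OF g(1)] in auto)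
      also have "\<dots> = (LINT \<tau>|lborel. w \<tau> *\<^sub>R (of_real (cutoff t \<tau>) * U f \<tau>))"
        by (rule integral_density) (use w in auto)
      finally show ?thesis by (simp add: scaleR_conv_of_real mult_ac)
    qed
    have cut0: "cutoff (- \<bar>t\<bar> - 1) \<tau> = 0" for t \<tau>
      using l01(1)[of \<tau>] by (auto simp: cutoff_def)
    have z: "(LINT \<tau>|lborel. of_real (indicator {..t} (l \<tau>)) * (of_real (w \<tau>) * U f \<tau>)) = 0" for t
    proof -
      have "0 = L2_inner M f (\<lambda>x. E t g x - E (- \<bar>t\<bar> - 1) g x)" using 0 unfolding a_def[abs_def] by simp
      also have "\<dots> = L2_inner M f (E t g) - L2_inner M f (E (- \<bar>t\<bar> - 1) g)"
        by (rule L2_inner_diff_right) (use E g f in auto)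
      finally show ?thesis by (simp add: Ug cut0) (simp add: cutoff_def)
    qed
    have "AE \<tau> in lborel. of_real (w \<tau>) * U f \<tau> = 0"
    proof (rule sublevel_zero_decreasing_imp_AE_zero[OF _ l l01(2) _ l_mono z])
      have "integrable N (\<lambda>\<tau>. U f \<tau> * cnj 1)" using L2_inner_integrable[OF U_L2[OF f] \<open>(\<lambda>\<tau>. 1) \<in> L2 N\<close>] by simp
      then have "integrable lborel (\<lambda>\<tau>. w \<tau> *\<^sub>R U f \<tau>)" using w by (subst (asm) integrable_density) auto
      then show "integrable lborel (\<lambda>\<tau>. of_real (w \<tau>) * U f \<tau>)" by (simp add: scaleR_conv_of_real)
    qed (use w in auto)
    then have "AE \<tau> in N. U f \<tau> = 0" by (subst AE_density) auto
    then have "L2_norm N (U f) = 0" using L2_norm_eq_0[OF U_L2[OF f]] by simp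
    then show "AE x in M. f x = 0" using L2_unitary_norm[OF U f] L2_norm_eq_0[OF f] by simp
  qed
  have "generating_vector M E g"
    unfolding generating_vector_def
  proof (intro conjI ballI allI impI g)
    fix f \<epsilon> assume f: "f \<in> L2 M" and e: "(0::real) < \<epsilon>"
    obtain cs where cs: "L2_norm M (\<lambda>x. f x - lin_comb a cs x) < \<epsilon>"
      using total_family_dense[OF total f e] by blast
    have "lin_comb a cs x = (\<Sum>k<length cs. fst (cs ! k) * (E (snd (cs ! k)) g x - E (- \<bar>snd (cs ! k)\<bar> - 1) g x))" for x
      unfolding lin_comb_def a_def by (simp add: sum_list_sum_nth atLeast0LessThan case_prod_unfold)
    then show "\<exists>(n::nat) (c::nat \<Rightarrow> complex) (a::nat \<Rightarrow> real) (b::nat \<Rightarrow> real).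
        (\<forall>k<n. a k < b k) \<and> L2_norm M (\<lambda>x. f x - (\<Sum>k<n. c k * (E (b k) g x - E (a k) g x))) < \<epsilon>"
      using cs by (intro exI[of _ "length cs"] exI[of _ "\<lambda>k. fst (cs ! k)"]
          exI[of _ "\<lambda>k. - \<bar>snd (cs ! k)\<bar> - 1"] exI[of _ "\<lambda>k. snd (cs ! k)"]) auto
  qed
  then show ?thesis by blast
qed

theorem simple_and_ac: "simple_spectrum M A \<and> purely_ac_spectrum M A"
  unfolding simple_spectrum_def purely_ac_spectrum_def
  using self_adjoint_A resolution_of_identity_E generating_vector_exists absolutely_continuous_spectral_measure
  by blast

end

section \<open>The Fourier transform of the hyperbolic secant\<close>

lemma integrable_sech: "integrable lborel (\<lambda>x::real. 1 / cosh (x / 2))"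
proof -
  have "set_integrable lborel (einterval (-\<infinity>) \<infinity>) (\<lambda>x::real. 1 / cosh (x / 2))"
  proof (rule interval_integral_FTC_nonneg(1)[where F = "\<lambda>x. 4 * arctan (exp (x / 2))" and A = 0 and B = "2 * pi"])
    fix x :: real
    have "4 * (inverse (1 + (exp (x / 2))\<^sup>2) * (exp (x / 2) * (1 / 2))) = 1 / cosh (x / 2)"
    proof -
      have "4 * (inverse (1 + e\<^sup>2) * (e * (1 / 2))) = 1 / ((e + inverse e) / 2)" if e: "0 < e" for e :: real
      proof -
        have "e + inverse e = (1 + e\<^sup>2) * inverse e" using e by (simp add: algebra_simps power2_eq_square)
        moreover have "4 * (inverse d * (e * (1 / 2))) = 1 / ((d * inverse e) / 2)" if "d \<noteq> 0" for d
          using e that by (simp add: field_simps)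
        moreover have "1 + e\<^sup>2 \<noteq> 0" by (metis add_pos_nonneg less_irrefl zero_le_power2 zero_less_one)
        ultimately show ?thesis by simp
      qed
      from this[of "exp (x / 2)"] show ?thesis unfolding cosh_field_def exp_minus by simp
    qed
    then show "((\<lambda>x. 4 * arctan (exp (x / 2))) has_real_derivative 1 / cosh (x / 2)) (at x)"
      by (auto intro!: derivative_eq_intros)
    show "isCont (\<lambda>x. 1 / cosh (x / 2)) x" by (auto intro!: continuous_intros)
  next
    have "((\<lambda>x::real. 4 * arctan (exp (x / 2))) \<longlongrightarrow> 0) at_bot" by real_asymp
    then show "(((\<lambda>x. 4 * arctan (exp (x / 2))) \<circ> real_of_ereal) \<longlongrightarrow> 0) (at_right (-\<infinity>))"
      by (simp add: ereal_tendsto_simps)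
    have "((\<lambda>x::real. 4 * arctan (exp (x / 2))) \<longlongrightarrow> 2 * pi) at_top" by real_asymp
    then show "(((\<lambda>x. 4 * arctan (exp (x / 2))) \<circ> real_of_ereal) \<longlongrightarrow> 2 * pi) (at_left \<infinity>)"
      by (simp add: ereal_tendsto_simps)
  qed auto
  then show ?thesis by (simp add: set_integrable_def)
qed

text \<open>The zeros of \<open>1 + exp z\<close> are the odd multiples of \<open>\<i> * pi\<close>;
  this strip isolates a single one of these poles of the integrand.\<close>

lemma exp_eq_minus_1_strip:
  fixes z :: complex
  assumes "1 + exp z = 0" "- pi < Im z" "Im z < 3 * pi"
  shows "z = \<i> * of_real pi"
proof -
  have "exp z = -1" using assms(1) unfolding add_eq_0_iff .
  then have "exp z = exp (\<i> * of_real pi)" by simp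
  then obtain n :: int where n: "z = \<i> * of_real pi + of_real (real_of_int (2 * n) * pi) * \<i>" unfolding exp_eq by blast
  then have "Im z = Im (\<i> * of_real pi + of_real (real_of_int (2 * n) * pi) * \<i>)" by (rule arg_cong)
  then have "Im z = pi * (1 + 2 * real_of_int n)" by (simp add: algebra_simps)
  then have "pi * (-1) < pi * (1 + 2 * real_of_int n)" "pi * (1 + 2 * real_of_int n) < pi * 3" using assms by auto
  then have "-1 < 1 + 2 * real_of_int n" "1 + 2 * real_of_int n < 3"
    by (metis mult_less_cancel_left_pos pi_gt_zero)+
  then have "n = 0" by linarith
  then show ?thesis using n by simp
qed

text \<open>The residue theorem on the rectangle with vertices \<open>-R\<close>, \<open>R\<close>, \<open>R + 2\<pi>\<i>\<close>, \<open>-R + 2\<pi>\<i>\<close>.\<close>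

lemma sech_rectangle:
  fixes \<tau> R :: real and f :: "complex \<Rightarrow> complex"
  assumes R: "0 < R"
  defines "f \<equiv> \<lambda>z. 2 * exp ((\<i> * of_real \<tau> + 1 / 2) * z) / (1 + exp z)"
  shows "cmod ((1 + exp (- 2 * pi * \<tau>)) * integral {-R..R} (\<lambda>x. f (of_real x)) - 4 * pi * exp (- pi * \<tau>))
    \<le> 8 * pi * exp (2 * pi * \<bar>\<tau>\<bar>) * exp (R / 2) / (exp R - 1)"
proof -
  \<comment> \<open>An open convex neighbourhood of the rectangle that contains no pole but
    \<open>p\<close>, so that the residue theorem sees one residue.\<close>
  define S where "S = {z. - pi < Im z \<and> Im z < 3 * pi}"
  define p where "p = \<i> * of_real pi"
  have oS: "open S" unfolding S_def by (intro open_Collect_conj open_Collect_less continuous_intros)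
  have S_conv: "convex S"
    unfolding S_def using convex_halfspace_Im_gt convex_halfspace_Im_lt
    by (simp add: Collect_conj_eq convex_Int)
  have nz: "1 + exp z \<noteq> 0" if "z \<in> S - {p}" for z
    using exp_eq_minus_1_strip[of z] that by (auto simp: S_def p_def)
  have pS: "p \<in> S" by (auto simp: S_def p_def)
  have holo: "f holomorphic_on S - {p}"
    unfolding f_def by (intro holomorphic_intros) (use nz in auto)
  define a b c d where "a = complex_of_real (- R)" and "b = complex_of_real R"
    and "c = of_real R + 2 * \<i> * of_real pi" and "d = of_real (- R) + 2 * \<i> * of_real pi"
  have rp: "rectpath a c = linepath a b +++ linepath b c +++ linepath c d +++ linepath d a"
  proof -
    have "Complex (Re c) (Im a) = b" "Complex (Re a) (Im c) = d"
      by (simp_all add: complex_eq_iff a_def b_def c_def d_def)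
    then show ?thesis unfolding rectpath_def Let_def by simp
  qed
  have segS: "closed_segment u v \<subseteq> S - {p}"
    if "u \<in> {a, b, c, d}" "v \<in> {a, b, c, d}" "Im u = Im v \<or> Re u = Re v" for u v
  proof
    fix z assume z: "z \<in> closed_segment u v"
    have "closed_segment u v \<subseteq> S"
      by (rule closed_segment_subset[OF _ _ S_conv])
        (use that in \<open>auto simp: S_def a_def b_def c_def d_def\<close>)
    moreover have "z \<noteq> p"
    proof
      assume "z = p"
      with z obtain t where t: "0 \<le> t" "t \<le> 1" "p = (1 - t) *\<^sub>R u + t *\<^sub>R v" by (auto simp: closed_segment_def)
      from that(3) show False
      proof
        assume eq: "Im u = Im v"
        have "Im p = Im u" by (simp only: t(3)) (simp add: eq algebra_simps)
        moreover have "Im u = 0 \<or> Im u = 2 * pi" using that(1) by (auto simp: a_def b_def c_def d_def)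
        ultimately show False by (auto simp: p_def)
      next
        assume eq: "Re u = Re v"
        have "Re p = Re u" by (simp only: t(3)) (simp add: eq algebra_simps)
        moreover have "Re u = R \<or> Re u = - R" using that(1) by (auto simp: a_def b_def c_def d_def)
        ultimately show False using R by (auto simp: p_def)
      qed
    qed
    ultimately show "z \<in> S - {p}" using z by auto
  qed
  have cont: "continuous_on (S - {p}) f" by (rule holomorphic_on_imp_continuous_on[OF holo])
  have int: "f contour_integrable_on linepath u v"
    if "u \<in> {a, b, c, d}" "v \<in> {a, b, c, d}" "Im u = Im v \<or> Re u = Re v" for u v
    by (rule contour_integrable_continuous_linepath[OF continuous_on_subset[OF cont segS[OF that]]])
  have ints: "f contour_integrable_on linepath a b" "f contour_integrable_on linepath b c"
    "f contour_integrable_on linepath c d" "f contour_integrable_on linepath d a"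
    by (rule int; simp add: a_def b_def c_def d_def)+
  have main: "contour_integral (rectpath a c) f = 2 * pi * \<i> * (\<Sum>q\<in>{p}. winding_number (rectpath a c) q * residue f q)"
  proof (rule Residue_theorem[OF oS])
    show "connected S" using S_conv by (rule convex_connected)
    show "path_image (rectpath a c) \<subseteq> S - {p}"
      unfolding rp using segS by (auto simp: path_image_join a_def b_def c_def d_def)
    show "\<forall>z. z \<notin> S \<longrightarrow> winding_number (rectpath a c) z = 0"
    proof (intro allI impI)
      fix z assume "z \<notin> S"
      have "z \<notin> cbox a c"
      proof
        assume "z \<in> cbox a c"
        then have "0 \<le> Im z" "Im z \<le> 2 * pi" by (auto simp: in_cbox_complex_iff a_def c_def)
        then have "- pi < Im z" "Im z < 3 * pi" using pi_gt_zero by linarith+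
        then show False using \<open>z \<notin> S\<close> by (simp add: S_def)
      qed
      then show "winding_number (rectpath a c) z = 0"
        by (rule winding_number_rectpath_outside[rotated 2]) (use R in \<open>auto simp: a_def c_def\<close>)
    qed
  qed (use holo in auto)
  have wn: "winding_number (rectpath a c) p = 1"
    by (rule winding_number_rectpath) (use R in \<open>auto simp: in_box_complex_iff a_def c_def p_def\<close>)
  have rs: "residue f p = - 2 * \<i> * exp (- pi * \<tau>)"
  proof -
    have "residue f p = 2 * exp ((\<i> * of_real \<tau> + 1 / 2) * p) / exp p"
      unfolding f_def
    proof (rule residue_simple_pole_deriv[OF _ _ oS _ pS])
      show "((\<lambda>z. 1 + exp z) has_field_derivative exp p) (at p)"
        by (auto intro!: derivative_eq_intros)
      show "connected S" using S_conv by (rule convex_connected)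
    qed (auto intro!: holomorphic_intros simp: p_def)
    also have "(\<i> * of_real \<tau> + 1 / 2) * p = of_real (- pi * \<tau>) + \<i> * of_real (pi / 2)"
      by (simp add: p_def algebra_simps)
    also have "exp (of_real (- pi * \<tau>) + \<i> * of_real (pi / 2)) = of_real (exp (- pi * \<tau>)) * \<i>"
      by (simp only: exp_add exp_of_real cis_conv_exp[symmetric] cis_pi_half)
    also have "exp p = - 1" by (simp add: p_def)
    finally show ?thesis by simp
  qed
  have res: "contour_integral (rectpath a c) f = 4 * pi * exp (- pi * \<tau>)"
    unfolding main by (simp add: wn rs)
  have sum: "contour_integral (rectpath a c) f = contour_integral (linepath a b) f
     + (contour_integral (linepath b c) f + (contour_integral (linepath c d) f + contour_integral (linepath d a) f))"
    unfolding rp using ints by (simp add: contour_integral_join)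
  have bottom: "contour_integral (linepath a b) f = integral {-R..R} (\<lambda>x. f (of_real x))"
    using contour_integral_linepath_Reals_eq[of a b f] R by (simp add: a_def b_def)
  \<comment> \<open>Translation by the period of \<open>exp\<close> multiplies the integrand by a
    constant. The top side therefore contributes a multiple of the bottom integral, and the equation
    can be solved for the latter.\<close>
  have shift: "f (z + 2 * \<i> * of_real pi) = - exp (- 2 * pi * \<tau>) * f z" for z
  proof -
    have "2 * \<i> * of_real pi = 2 * of_real pi * \<i>" by simp
    then have 1: "exp (z + 2 * \<i> * of_real pi) = exp z" by (simp only: exp_add exp_two_pi_i) simp
    have "(\<i> * of_real \<tau> + 1 / 2) * (z + 2 * \<i> * of_real pi)
      = (\<i> * of_real \<tau> + 1 / 2) * z + (of_real (- 2 * pi * \<tau>) + \<i> * of_real pi)" by (simp add: algebra_simps)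
    then have "exp ((\<i> * of_real \<tau> + 1 / 2) * (z + 2 * \<i> * of_real pi))
      = exp ((\<i> * of_real \<tau> + 1 / 2) * z) * (of_real (exp (- 2 * pi * \<tau>)) * (-1))"
      by (simp only: exp_add exp_of_real exp_pi_i')
    then show ?thesis unfolding f_def 1 by simp
  qed
  have top: "contour_integral (linepath c d) f = exp (- 2 * pi * \<tau>) * contour_integral (linepath a b) f"
  proof -
    have "contour_integral (linepath c d) f = integral {0..1} (\<lambda>t. f (linepath c d t) * (d - c))"
      by (simp add: contour_integral_integral)
    also have "\<dots> = integral {0..1} (\<lambda>t. - exp (- 2 * pi * \<tau>) * (f (linepath b a t) * (a - b)))"
    proof (rule integral_cong)
      fix t
      have "linepath c d t = linepath b a t + 2 * \<i> * of_real pi"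
        by (simp add: linepath_def a_def b_def c_def d_def algebra_simps scaleR_conv_of_real)
      moreover have "d - c = a - b" by (simp add: a_def b_def c_def d_def)
      ultimately show "f (linepath c d t) * (d - c) = - exp (- 2 * pi * \<tau>) * (f (linepath b a t) * (a - b))"
        using shift[of "linepath b a t"] by simp
    qed
    also have "\<dots> = - exp (- 2 * pi * \<tau>) * contour_integral (linepath b a) f"
      by (simp add: contour_integral_integral)
    also have "contour_integral (linepath b a) f = - contour_integral (linepath a b) f"
      using contour_integral_reversepath[of "linepath a b" f] by simp
    finally show ?thesis by simp
  qed
  \<comment> \<open>On the vertical sides the modulus is controlled by
    \<open>exp (Re z / 2) / \<bar>exp (Re z) - 1\<bar>\<close>, which has the same value for the
    real parts \<open>R\<close> and \<open>- R\<close>; one constant serves both sides.\<close>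
  define B where "B = 2 * exp (2 * pi * \<bar>\<tau>\<bar>) * exp (R / 2) / (exp R - 1)"
  have eR: "1 < exp R" using R by simp
  have B0: "0 \<le> B" unfolding B_def using eR by simp
  have f_norm: "cmod (f z) = 2 * exp (- \<tau> * Im z) * exp (Re z / 2) / cmod (1 + exp z)" for z
  proof -
    have "Re ((\<i> * of_real \<tau> + 1 / 2) * z) = - \<tau> * Im z + Re z / 2" by simp
    then have "exp (Re ((\<i> * of_real \<tau> + 1 / 2) * z)) = exp (- \<tau> * Im z) * exp (Re z / 2)"
      by (simp only: exp_add)
    then show ?thesis unfolding f_def norm_divide norm_mult norm_exp_eq_Re by (simp only:) simp
  qed
  have side: "cmod (contour_integral (linepath u v) f) \<le> B * (2 * pi)"
    if uv: "(u, v) \<in> {(b, c), (d, a)}" for u v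
  proof -
    have "cmod (contour_integral (linepath u v) f) \<le> B * norm (v - u)"
    proof (rule contour_integral_bound_linepath)
      show "f contour_integrable_on linepath u v" using ints uv by auto
      fix z assume z: "z \<in> closed_segment u v"
      then obtain t where t: "0 \<le> t" "t \<le> 1" "z = (1 - t) *\<^sub>R u + t *\<^sub>R v" by (auto simp: closed_segment_def)
      have Re: "Re z = R \<or> Re z = - R"
      proof -
        have uv': "Re v = Re u" "Re u = R \<or> Re u = - R" using uv by (auto simp: a_def b_def c_def d_def)
        have "Re z = Re u" by (simp add: t(3) uv'(1) algebra_simps)
        then show ?thesis using uv'(2) by simp
      qed
      have "Im z = t * (2 * pi) \<or> Im z = (1 - t) * (2 * pi)"
        using uv by (auto simp: t(3) a_def b_def c_def d_def)
      then have Im: "0 \<le> Im z" "Im z \<le> 2 * pi"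
        using t(1,2) mult_right_mono[of t 1 "2 * pi"] mult_right_mono[of "1 - t" 1 "2 * pi"] by auto
      have "- \<tau> * Im z \<le> \<bar>\<tau>\<bar> * (2 * pi)"
        using Im by (metis abs_ge_minus_self abs_ge_zero mult_mono)
      then have 1: "exp (- \<tau> * Im z) \<le> exp (2 * pi * \<bar>\<tau>\<bar>)" by (simp add: mult.commute)
      have 2: "\<bar>exp (Re z) - 1\<bar> \<le> cmod (1 + exp z)"
        using norm_triangle_ineq3[of "exp z" "-1"] by (simp add: add.commute norm_exp_eq_Re)
      have 3: "exp (Re z / 2) / \<bar>exp (Re z) - 1\<bar> = exp (R / 2) / (exp R - 1)"
        using Re
      proof
        assume "Re z = - R"
        moreover have "exp (- R / 2) / (1 - exp (- R)) = exp (R / 2) / (exp R - 1)"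
        proof -
          have "exp (- R / 2) = exp (R / 2) * exp (- R)" by (simp flip: exp_add)
          moreover have "1 - exp (- R) = (exp R - 1) * exp (- R)" by (simp add: algebra_simps flip: exp_add)
          ultimately show ?thesis by simp
        qed
        ultimately show ?thesis using R by simp
      qed (use eR in auto)
      have pos: "0 < \<bar>exp (Re z) - 1\<bar>" using Re R by auto
      have "cmod (f z) \<le> 2 * exp (2 * pi * \<bar>\<tau>\<bar>) * exp (Re z / 2) / \<bar>exp (Re z) - 1\<bar>"
        unfolding f_norm using 1 2 pos by (intro frac_le mult_mono) auto
      also have "\<dots> = B" using 3 unfolding B_def by (metis times_divide_eq_right)
      finally show "cmod (f z) \<le> B" .
    qed (rule B0)
    also have "norm (v - u) = 2 * pi"
      using uv by (auto simp: a_def b_def c_def d_def norm_mult)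
    finally show ?thesis .
  qed
  have "(1 + exp (- 2 * pi * \<tau>)) * integral {-R..R} (\<lambda>x. f (of_real x)) - 4 * pi * exp (- pi * \<tau>)
    = - contour_integral (linepath b c) f - contour_integral (linepath d a) f"
    using res sum top bottom by (simp add: algebra_simps)
  also have "cmod \<dots> \<le> cmod (contour_integral (linepath b c) f) + cmod (contour_integral (linepath d a) f)"
    by (metis norm_minus_cancel norm_triangle_ineq4)
  also have "\<dots> \<le> B * (2 * pi) + B * (2 * pi)"
    by (intro add_mono side) auto
  also have "\<dots> = 8 * pi * exp (2 * pi * \<bar>\<tau>\<bar>) * exp (R / 2) / (exp R - 1)"
    by (simp add: B_def)
  finally show ?thesis by simp
qed

text \<open>The normalisation makes this a probability density, and \<open>sech_symbol\<close> is
  its Fourier transform, with value 1 at 0.\<close>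

definition sech_kernel :: "real \<Rightarrow> real" where
  "sech_kernel x = 1 / (2 * pi * cosh (x / 2))"

definition sech_symbol :: "real \<Rightarrow> real" where
  "sech_symbol \<tau> = 1 / cosh (pi * \<tau>)"

lemma sech_kernel_pos: "0 < sech_kernel x"
  by (simp add: sech_kernel_def cosh_real_pos)

lemma sech_kernel_minus: "sech_kernel (- x) = sech_kernel x"
  by (simp add: sech_kernel_def)

lemma continuous_on_sech_kernel [continuous_intros]:
  "continuous_on A f \<Longrightarrow> continuous_on A (\<lambda>x. sech_kernel (f x))"
  unfolding sech_kernel_def by (intro continuous_intros) auto

lemma sech_kernel_measurable [measurable]: "sech_kernel \<in> borel_measurable borel"
  by (intro borel_measurable_continuous_onI continuous_intros)

lemma integrable_sech_kernel: "integrable lborel sech_kernel"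
proof -
  have "sech_kernel = (\<lambda>x. 1 / (2 * pi) * (1 / cosh (x / 2)))" by (simp add: sech_kernel_def fun_eq_iff)
  then show ?thesis using integrable_sech by (metis integrable_mult_right)
qed

lemma integral_cis_sech:
  "(LINT x|lborel. cis (\<tau> * x) * of_real (1 / cosh (x / 2))) = of_real (2 * pi / cosh (pi * \<tau>))"
proof -
  define f where "f z = 2 * exp ((\<i> * of_real \<tau> + 1 / 2) * z) / (1 + exp z)" for z :: complex
  define h where "h x = cis (\<tau> * x) * of_real (1 / cosh (x / 2))" for x :: real
  have e: "2 * exp (x / 2) / (1 + exp x) = 1 / cosh (x / 2)" for x :: real
  proof -
    have "1 + exp x = exp (x / 2) * (2 * cosh (x / 2))"
    proof -
      have "exp (x / 2) * exp (x / 2) = exp x" "exp (x / 2) * exp (- (x / 2)) = 1"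
        by (simp_all flip: exp_add)
      then show ?thesis by (simp add: cosh_field_def algebra_simps)
    qed
    then show ?thesis by simp
  qed
  have fh: "f (of_real x) = h x" for x
  proof -
    have "(\<i> * of_real \<tau> + 1 / 2) * of_real x = \<i> * of_real (\<tau> * x) + complex_of_real (x / 2)" by (simp add: algebra_simps)
    then have "exp ((\<i> * of_real \<tau> + 1 / 2) * of_real x) = cis (\<tau> * x) * of_real (exp (x / 2))"
      by (simp only: exp_add exp_of_real cis_conv_exp)
    then have "f (of_real x) = cis (\<tau> * x) * of_real (2 * exp (x / 2) / (1 + exp x))"
      unfolding f_def by (simp flip: exp_of_real)
    then show ?thesis unfolding e h_def .
  qed
  have hm [measurable]: "h \<in> borel_measurable borel"
    unfolding h_def by (intro borel_measurable_continuous_onI continuous_intros) auto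
  have h: "integrable lborel h"
    by (rule Bochner_Integration.integrable_bound[OF integrable_sech]) (auto simp: h_def norm_divide)
  have lim: "(\<lambda>n. LINT x|lborel. indicator {- real n..real n} x *\<^sub>R h x) \<longlonglongrightarrow> (LINT x|lborel. h x)"
  proof (rule integral_dominated_convergence[where w = "\<lambda>x. norm (h x)"])
    show "AE x in lborel. (\<lambda>n. indicator {- real n..real n} x *\<^sub>R h x) \<longlonglongrightarrow> h x"
    proof (rule AE_I2)
      fix x :: real
      obtain n0 :: nat where "\<bar>x\<bar> < real n0" using reals_Archimedean2 by blast
      then have "indicator {- real n..real n} x *\<^sub>R h x = h x" if "n \<ge> n0" for n
        using that by (auto simp: indicator_def)
      then show "(\<lambda>n. indicator {- real n..real n} x *\<^sub>R h x) \<longlonglongrightarrow> h x"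
        by (intro tendsto_eventually) (use eventually_sequentially in blast)
    qed
  qed (use h in \<open>auto split: split_indicator\<close>)
  have HK: "integral {- real n..real n} (\<lambda>x. f (of_real x)) = (LINT x|lborel. indicator {- real n..real n} x *\<^sub>R h x)" for n
    using set_borel_integral_eq_integral(2)[of "{- real n..real n}" h] integrable_mult_indicator[of "{- real n..real n}" lborel h] h
    by (simp add: fh set_integrable_def set_lebesgue_integral_def)
  define J where "J = (LINT x|lborel. h x)"
  define c where "c = complex_of_real (1 + exp (- 2 * pi * \<tau>))"
  have "(\<lambda>n. c * (LINT x|lborel. indicator {- real n..real n} x *\<^sub>R h x) - 4 * pi * exp (- pi * \<tau>))
     \<longlonglongrightarrow> c * J - 4 * pi * exp (- pi * \<tau>)"
    unfolding J_def by (intro tendsto_intros lim)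
  moreover have "(\<lambda>n. c * (LINT x|lborel. indicator {- real n..real n} x *\<^sub>R h x) - 4 * pi * exp (- pi * \<tau>)) \<longlonglongrightarrow> 0"
  proof (rule Lim_null_comparison)
    show "\<forall>\<^sub>F n in sequentially. norm (c * (LINT x|lborel. indicator {- real n..real n} x *\<^sub>R h x) - 4 * pi * exp (- pi * \<tau>))
      \<le> 8 * pi * exp (2 * pi * \<bar>\<tau>\<bar>) * (exp (real n / 2) / (exp (real n) - 1))"
      using eventually_gt_at_top[of 0]
    proof eventually_elim
      case (elim n)
      then show ?case
        using sech_rectangle[of "real n" \<tau>] unfolding f_def[symmetric] HK[symmetric] c_def by simp
    qed
    have "(\<lambda>n::nat. exp (real n / 2) / (exp (real n) - 1)) \<longlonglongrightarrow> 0" by real_asymp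
    then show "(\<lambda>n::nat. 8 * pi * exp (2 * pi * \<bar>\<tau>\<bar>) * (exp (real n / 2) / (exp (real n) - 1))) \<longlonglongrightarrow> 0"
      by (rule tendsto_mult_right_zero)
  qed
  ultimately have "c * J - 4 * pi * exp (- pi * \<tau>) = 0" by (rule LIMSEQ_unique)
  then have "c * J = of_real (4 * pi * exp (- pi * \<tau>))" by simp
  also have "\<dots> = c * of_real (2 * pi / cosh (pi * \<tau>))"
  proof -
    have "exp (- (pi * \<tau>)) * exp (- (pi * \<tau>)) = exp (- (2 * pi * \<tau>))" "exp (- (pi * \<tau>)) * exp (pi * \<tau>) = 1"
      by (simp_all flip: exp_add)
    then have "1 + exp (- 2 * pi * \<tau>) = exp (- pi * \<tau>) * (2 * cosh (pi * \<tau>))"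
      by (simp add: cosh_field_def algebra_simps)
    then have "(1 + exp (- 2 * pi * \<tau>)) * (2 * pi / cosh (pi * \<tau>)) = 4 * pi * exp (- pi * \<tau>)" by simp
    then show ?thesis unfolding c_def of_real_mult[symmetric] by (simp only:)
  qed
  finally have "J = of_real (2 * pi / cosh (pi * \<tau>))"
  proof -
    have "1 + exp (- 2 * pi * \<tau>) \<noteq> 0" by (metis add_pos_pos exp_gt_zero less_irrefl zero_less_one)
    then have "c \<noteq> 0" unfolding c_def of_real_eq_0_iff .
    moreover assume "c * J = c * of_real (2 * pi / cosh (pi * \<tau>))"
    ultimately show ?thesis by (simp only: mult_cancel_left) simp
  qed
  then show ?thesis by (simp add: J_def h_def)
qed

lemma integrable_cos_sech_kernel: "integrable lborel (\<lambda>x. cos (\<tau> * x) * sech_kernel x)"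
  and integrable_sin_sech_kernel: "integrable lborel (\<lambda>x. sin (\<tau> * x) * sech_kernel x)"
  by (rule Bochner_Integration.integrable_bound[OF integrable_sech_kernel];
      auto simp: abs_mult less_imp_le[OF sech_kernel_pos] mult_left_le_one_le abs_of_pos[OF sech_kernel_pos])+

lemma cos_sech_kernel: "(LINT x|lborel. cos (\<tau> * x) * sech_kernel x) = sech_symbol \<tau>"
  and sin_sech_kernel: "(LINT x|lborel. sin (\<tau> * x) * sech_kernel x) = 0"
proof -
  have i: "integrable lborel (\<lambda>x. cis (\<tau> * x) * of_real (1 / cosh (x / 2)))"
    by (rule Bochner_Integration.integrable_bound[OF integrable_sech]) (auto simp: norm_divide intro!: borel_measurable_continuous_onI continuous_intros)
  have "(LINT x|lborel. Re (cis (\<tau> * x) * of_real (1 / cosh (x / 2)))) = 2 * pi / cosh (pi * \<tau>)"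
    "(LINT x|lborel. Im (cis (\<tau> * x) * of_real (1 / cosh (x / 2)))) = 0"
    unfolding integral_Re[OF i] integral_Im[OF i] integral_cis_sech by simp_all
  then have c: "(LINT x|lborel. cos (\<tau> * x) * (1 / cosh (x / 2))) = 2 * pi / cosh (pi * \<tau>)"
    and s: "(LINT x|lborel. sin (\<tau> * x) * (1 / cosh (x / 2))) = 0" by simp_all
  have "(\<lambda>x. cos (\<tau> * x) * sech_kernel x) = (\<lambda>x. 1 / (2 * pi) * (cos (\<tau> * x) * (1 / cosh (x / 2))))"
    "(\<lambda>x. sin (\<tau> * x) * sech_kernel x) = (\<lambda>x. 1 / (2 * pi) * (sin (\<tau> * x) * (1 / cosh (x / 2))))"
    by (simp_all add: sech_kernel_def fun_eq_iff)
  then show "(LINT x|lborel. cos (\<tau> * x) * sech_kernel x) = sech_symbol \<tau>"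
    "(LINT x|lborel. sin (\<tau> * x) * sech_kernel x) = 0"
    by (simp_all only: Bochner_Integration.integral_mult_right_zero c s) (simp_all add: sech_symbol_def)
qed

lemma sech_symbol_bounds: "0 < sech_symbol \<tau>" "sech_symbol \<tau> \<le> 1"
  by (simp_all add: sech_symbol_def cosh_real_pos cosh_real_ge_1)

lemma sech_symbol_measurable [measurable]: "sech_symbol \<in> borel_measurable borel"
  unfolding sech_symbol_def[abs_def] by (intro borel_measurable_continuous_onI continuous_intros) auto

lemma sech_symbol_decreasing: "strict_antimono_on {0<..} sech_symbol"
proof (rule monotone_onI)
  fix x y :: real assume "x \<in> {0<..}" "y \<in> {0<..}" "x < y"
  then have "cosh (pi * x) < cosh (pi * y)" by (intro cosh_real_strict_mono) auto
  then show "sech_symbol y < sech_symbol x" by (simp add: sech_symbol_def cosh_real_pos frac_less2)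
qed

lemma integral_sech_kernel: "(LINT x|lborel. sech_kernel x) = 1"
  using cos_sech_kernel[of 0] by (simp add: sech_symbol_def)

text \<open>The Fourier transform of the kernel is real, so the addition theorems make cosines and
  sines separately eigenfunctions of averaging with the kernel.\<close>

lemma shifted_sech_kernel:
  shows "integrable lborel (\<lambda>x. sech_kernel (x - y))"
    and "(LINT x|lborel. sech_kernel (x - y)) = 1"
    and "integrable lborel (\<lambda>x. cos (\<tau> * x) * sech_kernel (x - y))"
    and "(LINT x|lborel. cos (\<tau> * x) * sech_kernel (x - y)) = cos (\<tau> * y) * sech_symbol \<tau>"
    and "integrable lborel (\<lambda>x. sin (\<tau> * x) * sech_kernel (x - y))"
    and "(LINT x|lborel. sin (\<tau> * x) * sech_kernel (x - y)) = sin (\<tau> * y) * sech_symbol \<tau>"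
proof -
  show 1: "integrable lborel (\<lambda>x. sech_kernel (x - y))"
    using lborel_integrable_real_affine[OF integrable_sech_kernel, of 1 "- y"] by (simp add: add.commute)
  show "(LINT x|lborel. sech_kernel (x - y)) = 1"
    using lborel_integral_real_affine[of 1 sech_kernel "- y"] by (simp add: integral_sech_kernel add.commute)
  show "integrable lborel (\<lambda>x. cos (\<tau> * x) * sech_kernel (x - y))"
    by (rule Bochner_Integration.integrable_bound[OF 1])
      (auto simp: abs_mult abs_of_pos[OF sech_kernel_pos] less_imp_le[OF sech_kernel_pos] mult_left_le_one_le)
  show "integrable lborel (\<lambda>x. sin (\<tau> * x) * sech_kernel (x - y))"
    by (rule Bochner_Integration.integrable_bound[OF 1])
      (auto simp: abs_mult abs_of_pos[OF sech_kernel_pos] less_imp_le[OF sech_kernel_pos] mult_left_le_one_le)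
  note i = integrable_cos_sech_kernel[of \<tau>] integrable_sin_sech_kernel[of \<tau>]
  have "(LINT x|lborel. cos (\<tau> * x) * sech_kernel (x - y)) = (LINT x|lborel. cos (\<tau> * (y + x)) * sech_kernel x)"
    by (subst lborel_integral_real_affine[of 1 _ y]) auto
  also have "\<dots> = (LINT x|lborel. cos (\<tau> * y) * (cos (\<tau> * x) * sech_kernel x) - sin (\<tau> * y) * (sin (\<tau> * x) * sech_kernel x))"
    by (simp add: distrib_left cos_add algebra_simps)
  also have "\<dots> = cos (\<tau> * y) * sech_symbol \<tau>"
    using i by (subst Bochner_Integration.integral_diff) (auto simp: cos_sech_kernel sin_sech_kernel)
  finally show "(LINT x|lborel. cos (\<tau> * x) * sech_kernel (x - y)) = cos (\<tau> * y) * sech_symbol \<tau>" .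
  have "(LINT x|lborel. sin (\<tau> * x) * sech_kernel (x - y)) = (LINT x|lborel. sin (\<tau> * (y + x)) * sech_kernel x)"
    by (subst lborel_integral_real_affine[of 1 _ y]) auto
  also have "\<dots> = (LINT x|lborel. sin (\<tau> * y) * (cos (\<tau> * x) * sech_kernel x) + cos (\<tau> * y) * (sin (\<tau> * x) * sech_kernel x))"
    by (simp add: distrib_left sin_add algebra_simps)
  also have "\<dots> = sin (\<tau> * y) * sech_symbol \<tau>"
    using i by (subst Bochner_Integration.integral_add) (auto simp: cos_sech_kernel sin_sech_kernel)
  finally show "(LINT x|lborel. sin (\<tau> * x) * sech_kernel (x - y)) = sin (\<tau> * y) * sech_symbol \<tau>" .
qed

section \<open>Self-convolution of the sech kernel and the spectral weight\<close>

lemma sech_kernel_convolution: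
  assumes "x \<noteq> 0"
  shows "(LINT y|lborel. sech_kernel (x - y) * sech_kernel y) = x / (2 * pi\<^sup>2 * sinh (x / 2))"
proof -
  define c where "c = 1 / (2 * pi\<^sup>2 * sinh (x / 2))"
  have s0: "sinh (x / 2) \<noteq> 0" using assms by simp
  \<comment> \<open>The addition theorem for \<open>sinh\<close> splits the product of the two
    reciprocals into a difference of hyperbolic tangents, whose antiderivative is the logarithm of a
    quotient of \<open>cosh\<close> values and tends to x/2 and -x/2 at the two ends. The splitting
    divides by \<open>sinh (x / 2)\<close>, hence \<open>x \<noteq> 0\<close>.\<close>
  have "(LBINT y=-\<infinity>..\<infinity>. sech_kernel (x - y) * sech_kernel y) = c * (x / 2) - c * (- x / 2)"
  proof (rule interval_integral_FTC_nonneg(2)[where F = "\<lambda>y. c * (ln (cosh (y / 2)) - ln (cosh ((y - x) / 2)))"])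
    fix y :: real
    have sd: "sinh (y / 2) * cosh ((y - x) / 2) - cosh (y / 2) * sinh ((y - x) / 2) = sinh (x / 2)"
      using sinh_diff[of "y / 2" "(y - x) / 2"] by (simp add: field_simps)
    have cp: "cosh (y / 2) > 0" "cosh ((y - x) / 2) > 0" by (simp_all add: cosh_real_pos)
    have ev: "sech_kernel (x - y) = 1 / (2 * pi * cosh ((y - x) / 2))"
      unfolding sech_kernel_def by (metis cosh_minus minus_diff_eq minus_divide_left)
    have "c * (sinh (y / 2) * (1 / 2) / cosh (y / 2) - sinh ((y - x) / 2) * (1 / 2) / cosh ((y - x) / 2))
      = c * ((sinh (y / 2) * cosh ((y - x) / 2) - cosh (y / 2) * sinh ((y - x) / 2)) / (2 * cosh (y / 2) * cosh ((y - x) / 2)))"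
      using cp by (simp add: field_simps)
    also have "\<dots> = sech_kernel (x - y) * sech_kernel y"
    proof -
      have "1 / (2 * p\<^sup>2 * S) * (S / (2 * P * Q)) = 1 / (2 * p * Q) * (1 / (2 * p * P))" if "S \<noteq> 0" for p S P Q :: real
        using that by (simp add: power2_eq_square)
      from this[OF s0, of pi] show ?thesis unfolding sd c_def ev sech_kernel_def[of y] .
    qed
    finally have eq: "c * (sinh (y / 2) * (1 / 2) / cosh (y / 2) - sinh ((y - x) / 2) * (1 / 2) / cosh ((y - x) / 2))
      = sech_kernel (x - y) * sech_kernel y" .
    have "((\<lambda>y. ln (cosh (y / 2))) has_real_derivative sinh (y / 2) * (1 / 2) / cosh (y / 2)) (at y)"
      by (rule derivative_eq_intros refl cp | simp)+
    moreover have "((\<lambda>y. ln (cosh ((y - x) / 2))) has_real_derivative sinh ((y - x) / 2) * (1 / 2) / cosh ((y - x) / 2)) (at y)"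
      by (rule derivative_eq_intros refl cp | simp)+
    ultimately show "((\<lambda>y. c * (ln (cosh (y / 2)) - ln (cosh ((y - x) / 2)))) has_real_derivative
        sech_kernel (x - y) * sech_kernel y) (at y)"
      unfolding eq[symmetric] by (intro DERIV_cmult DERIV_diff)
    show "isCont (\<lambda>y. sech_kernel (x - y) * sech_kernel y) y"
      unfolding sech_kernel_def by (intro continuous_intros) auto
  next
    have "((\<lambda>y. ln (cosh (y / 2)) - ln (cosh ((y - x) / 2))) \<longlongrightarrow> - x / 2) at_bot"
      unfolding cosh_field_def by real_asymp (simp add: ln_div)
    from tendsto_mult_left[OF this, of c] show "(((\<lambda>y. c * (ln (cosh (y / 2)) - ln (cosh ((y - x) / 2)))) \<circ> real_of_ereal) \<longlongrightarrow> c * (- x / 2)) (at_right (-\<infinity>))"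
      by (simp add: ereal_tendsto_simps)
    have "((\<lambda>y. ln (cosh (y / 2)) - ln (cosh ((y - x) / 2))) \<longlongrightarrow> x / 2) at_top"
      unfolding cosh_field_def by real_asymp (simp add: ln_div)
    from tendsto_mult_left[OF this, of c] show "(((\<lambda>y. c * (ln (cosh (y / 2)) - ln (cosh ((y - x) / 2)))) \<circ> real_of_ereal) \<longlongrightarrow> c * (x / 2)) (at_left \<infinity>)"
      by (simp add: ereal_tendsto_simps)
  qed (auto intro!: AE_I2 mult_nonneg_nonneg less_imp_le[OF sech_kernel_pos])
  then have "(LINT y|lborel. sech_kernel (x - y) * sech_kernel y) = c * (x / 2) - c * (- x / 2)"
    by (simp add: interval_lebesgue_integral_def set_lebesgue_integral_def)
  then show ?thesis by (simp add: c_def)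
qed

definition sech_convolution :: "real \<Rightarrow> real" where
  "sech_convolution x = (LINT y|lborel. sech_kernel (x - y) * sech_kernel y)"

text \<open>The convolution theorem for this kernel, by Fubini and the eigenfunction property of
  cosines: each of the two averages contributes one factor of the symbol.\<close>

lemma sech_convolution_cos:
  shows "integrable lborel (\<lambda>x. cos (\<tau> * x) * sech_convolution x)"
    and "(LINT x|lborel. cos (\<tau> * x) * sech_convolution x) = (sech_symbol \<tau>)\<^sup>2"
proof -
  define f where "f y x = cos (\<tau> * x) * (sech_kernel (x - y) * sech_kernel y)" for y x :: real
  have i: "integrable lborel (\<lambda>x. f y x)" for y
    using integrable_mult_left[OF shifted_sech_kernel(3)[of \<tau> y], of "sech_kernel y"] by (simp add: f_def mult.assoc)
  have n: "(LINT x|lborel. norm (f y x)) \<le> sech_kernel y" for y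
  proof -
    have "(LINT x|lborel. norm (f y x)) \<le> (LINT x|lborel. sech_kernel (x - y) * sech_kernel y)"
    proof (rule integral_mono)
      show "integrable lborel (\<lambda>x. norm (f y x))" using i by auto
      show "integrable lborel (\<lambda>x. sech_kernel (x - y) * sech_kernel y)" using shifted_sech_kernel(1) by auto
      show "norm (f y x) \<le> sech_kernel (x - y) * sech_kernel y" for x
        by (simp add: f_def abs_mult abs_of_pos[OF sech_kernel_pos] mult_left_le_one_le less_imp_le[OF sech_kernel_pos])
    qed
    then show ?thesis by (simp add: shifted_sech_kernel)
  qed
  have pair: "integrable (lborel \<Otimes>\<^sub>M lborel) (case_prod f)"
  proof (rule lborel_pair.Fubini_integrable)
    show "integrable lborel (\<lambda>y. LINT x|lborel. norm (case_prod f (y, x)))"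
    proof (rule Bochner_Integration.integrable_bound[OF integrable_sech_kernel])
      show "AE y in lborel. norm (LINT x|lborel. norm (case_prod f (y, x))) \<le> norm (sech_kernel y)"
        using n by (intro AE_I2) (simp add: Bochner_Integration.integral_nonneg abs_of_pos[OF sech_kernel_pos])
    qed (auto simp: f_def)
  qed (auto simp: f_def[abs_def] i[unfolded f_def])
  have eq: "(LINT y|lborel. f y x) = cos (\<tau> * x) * sech_convolution x" for x
    by (simp add: f_def sech_convolution_def)
  show "integrable lborel (\<lambda>x. cos (\<tau> * x) * sech_convolution x)"
    using lborel_pair.integrable_snd[OF pair] by (simp add: eq)
  have "(LINT x|lborel. cos (\<tau> * x) * sech_convolution x) = (LINT y|lborel. LINT x|lborel. f y x)"
    unfolding eq[symmetric] by (rule lborel_pair.Fubini_integral[OF pair])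
  also have "\<dots> = (LINT y|lborel. (cos (\<tau> * y) * sech_kernel y) * sech_symbol \<tau>)"
  proof (rule Bochner_Integration.integral_cong)
    fix y
    have "(LINT x|lborel. f y x) = (LINT x|lborel. (cos (\<tau> * x) * sech_kernel (x - y)) * sech_kernel y)"
      by (simp add: f_def mult.assoc)
    also have "\<dots> = cos (\<tau> * y) * sech_symbol \<tau> * sech_kernel y"
      by (simp only: Bochner_Integration.integral_mult_left_zero shifted_sech_kernel)
    finally show "(LINT x|lborel. f y x) = (cos (\<tau> * y) * sech_kernel y) * sech_symbol \<tau>" by simp
  qed simp
  also have "\<dots> = (sech_symbol \<tau>)\<^sup>2"
    by (simp add: cos_sech_kernel power2_eq_square)
  finally show "(LINT x|lborel. cos (\<tau> * x) * sech_convolution x) = (sech_symbol \<tau>)\<^sup>2" .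
qed

text \<open>On the positive half line this is
  \<open>2 * pi * sech_convolution (4 * pi * \<tau>)\<close>, so that its cosine transform is again
  a squared hyperbolic secant.\<close>

definition spectral_weight :: "real \<Rightarrow> real" where
  "spectral_weight \<tau> = (if 0 < \<tau> then 4 * \<tau> / sinh (2 * pi * \<tau>) else 0)"

lemma spectral_weight_measurable [measurable]: "spectral_weight \<in> borel_measurable borel"
proof -
  have "(\<lambda>\<tau>. indicator {0<..} \<tau> *\<^sub>R (4 * \<tau> / sinh (2 * pi * \<tau>))) \<in> borel_measurable borel"
    by (intro borel_measurable_continuous_on_indicator continuous_intros) auto
  also have "(\<lambda>\<tau>. indicator {0<..} \<tau> *\<^sub>R (4 * \<tau> / sinh (2 * pi * \<tau>))) = spectral_weight"
    by (auto simp: spectral_weight_def fun_eq_iff)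
  finally show ?thesis .
qed

lemma spectral_weight_nonneg: "0 \<le> spectral_weight \<tau>"
  and spectral_weight_pos: "0 < \<tau> \<Longrightarrow> 0 < spectral_weight \<tau>"
  and spectral_weight_0: "\<tau> \<le> 0 \<Longrightarrow> spectral_weight \<tau> = 0"
  by (simp_all add: spectral_weight_def)

lemma spectral_weight_cos:
  shows "integrable lborel (\<lambda>\<tau>. spectral_weight \<tau> * cos (\<tau> * x))"
    and "(LINT \<tau>|lborel. spectral_weight \<tau> * cos (\<tau> * x)) = 1 / (4 * (cosh (x / 4))\<^sup>2)"
proof -
  define g where "g u = cos (x / (4 * pi) * u) * sech_convolution u" for u
  have g: "integrable lborel g" "(LINT u|lborel. g u) = (sech_symbol (x / (4 * pi)))\<^sup>2"
    unfolding g_def by (rule sech_convolution_cos)+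
  have gs: "g (4 * pi * \<tau>) = cos (\<tau> * x) * (2 * \<tau> / (pi * sinh (2 * pi * \<tau>)))" if "\<tau> \<noteq> 0" for \<tau>
  proof -
    have "sech_convolution (4 * pi * \<tau>) = 2 * \<tau> / (pi * sinh (2 * pi * \<tau>))"
      unfolding sech_convolution_def using that
      by (subst sech_kernel_convolution) (auto simp: power2_eq_square)
    then show ?thesis by (simp add: g_def mult.commute)
  qed
  have ig: "integrable lborel (\<lambda>\<tau>. 2 * pi * g (4 * pi * \<tau>))"
    using lborel_integrable_real_affine[OF g(1), of "4 * pi" 0] by simp
  have "(sech_symbol (x / (4 * pi)))\<^sup>2 = 4 * pi * (LINT \<tau>|lborel. g (4 * pi * \<tau>))"
    unfolding g(2)[symmetric] by (subst lborel_integral_real_affine[of "4 * pi" _ 0]) auto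
  then have Ig: "(LINT \<tau>|lborel. 2 * pi * g (4 * pi * \<tau>)) = (sech_symbol (x / (4 * pi)))\<^sup>2 / 2" by simp
  have w1: "spectral_weight \<tau> * cos (\<tau> * x) = indicator {0<..} \<tau> *\<^sub>R (2 * pi * g (4 * pi * \<tau>))" for \<tau>
    using gs[of \<tau>] by (auto simp: spectral_weight_def)
  show i: "integrable lborel (\<lambda>\<tau>. spectral_weight \<tau> * cos (\<tau> * x))"
    unfolding w1 using ig by (intro integrable_mult_indicator) auto
  \<comment> \<open>The weight lives on a half line. Adding its reflection recovers the scaled
    convolution on the whole line, and both halves contribute the same.\<close>
  have im: "integrable lborel (\<lambda>\<tau>. spectral_weight (- \<tau>) * cos (- \<tau> * x))"
    using lborel_integrable_real_affine[OF i, of "-1" 0] by simp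
  have "(LINT \<tau>|lborel. spectral_weight (- \<tau>) * cos (- \<tau> * x)) = (LINT \<tau>|lborel. spectral_weight \<tau> * cos (\<tau> * x))"
    using lborel_integral_real_affine[of "-1" "\<lambda>\<tau>. spectral_weight \<tau> * cos (\<tau> * x)" 0] by simp
  then have "2 * (LINT \<tau>|lborel. spectral_weight \<tau> * cos (\<tau> * x))
    = (LINT \<tau>|lborel. spectral_weight \<tau> * cos (\<tau> * x) + spectral_weight (- \<tau>) * cos (- \<tau> * x))"
    using i im by (subst Bochner_Integration.integral_add) auto
  also have "\<dots> = (LINT \<tau>|lborel. 2 * pi * g (4 * pi * \<tau>))"
  proof (rule integral_cong_AE)
    show "AE \<tau> in lborel. spectral_weight \<tau> * cos (\<tau> * x) + spectral_weight (- \<tau>) * cos (- \<tau> * x) = 2 * pi * g (4 * pi * \<tau>)"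
      using AE_lborel_singleton[of "0::real"]
      by eventually_elim (auto simp: gs spectral_weight_def)
  qed (use ig in auto)
  also have "\<dots> = 1 / (cosh (x / 4))\<^sup>2 / 2" unfolding Ig by (simp add: sech_symbol_def power_divide)
  finally show "(LINT \<tau>|lborel. spectral_weight \<tau> * cos (\<tau> * x)) = 1 / (4 * (cosh (x / 4))\<^sup>2)" by simp
qed

lemma integrable_spectral_weight: "integrable lborel spectral_weight"
  using spectral_weight_cos(1)[of 0] by simp

section \<open>The space carrying the sines, and their Gram matrix\<close>

abbreviation spectral_space :: "real measure" where
  "spectral_space \<equiv> density lborel (\<lambda>\<tau>. ennreal (spectral_weight \<tau>))"

text \<open>The form in which the integral over an interval appears;
  \<open>gram_eq_difference\<close> rewrites it as the difference that the product-to-sum formula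
  yields for the sines.\<close>

definition gram :: "real \<Rightarrow> real \<Rightarrow> real" where
  "gram t s = sinh (t / 2) * sinh (s / 2) / (2 * (cosh (t / 2) + cosh (s / 2))\<^sup>2)"

definition sine :: "real \<Rightarrow> real \<Rightarrow> complex" where
  "sine t \<tau> = of_real (sin (\<tau> * t))"

lemma sine_measurable [measurable]: "sine t \<in> borel_measurable borel"
  unfolding sine_def[abs_def] by measurable

lemma gram_eq_difference: "gram t s = (1 / (cosh ((t - s) / 4))\<^sup>2 - 1 / (cosh ((t + s) / 4))\<^sup>2) / 8"
proof -
  define p q where "p = (t + s) / 4" and "q = (t - s) / 4"
  have t: "t / 2 = p + q" "s / 2 = p - q" by (simp_all add: p_def q_def field_simps)
  have c: "cosh p > 0" "cosh q > 0" by (simp_all add: cosh_real_pos)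
  have "cosh (p + q) + cosh (p - q) = 2 * cosh p * cosh q" by (simp add: cosh_add cosh_diff)
  moreover have "sinh (p + q) * sinh (p - q) = (cosh p)\<^sup>2 - (cosh q)\<^sup>2"
  proof -
    have "sinh (p + q) * sinh (p - q) = (sinh p)\<^sup>2 * (cosh q)\<^sup>2 - (cosh p)\<^sup>2 * (sinh q)\<^sup>2"
      by (simp add: sinh_add sinh_diff power2_eq_square algebra_simps)
    then show ?thesis by (simp add: sinh_square_eq algebra_simps)
  qed
  ultimately have "gram t s = ((cosh p)\<^sup>2 - (cosh q)\<^sup>2) / (2 * (2 * cosh p * cosh q)\<^sup>2)"
    by (simp add: gram_def t)
  also have "\<dots> = (1 / (cosh q)\<^sup>2 - 1 / (cosh p)\<^sup>2) / 8"
    using c by (simp add: field_simps power2_eq_square)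
  finally show ?thesis by (simp add: p_def q_def)
qed

lemma sine_L2: "sine t \<in> L2 spectral_space"
proof -
  have "integrable spectral_space (\<lambda>\<tau>. 1::real)"
    using integrable_spectral_weight by (simp add: integrable_density spectral_weight_nonneg)
  then have "integrable spectral_space (\<lambda>\<tau>. (cmod (sine t \<tau>))\<^sup>2)"
  proof (rule Bochner_Integration.integrable_bound)
    show "AE \<tau> in spectral_space. norm ((cmod (sine t \<tau>))\<^sup>2) \<le> norm (1::real)"
      by (intro AE_I2) (simp add: sine_def abs_square_le_1)
  qed (simp add: sine_def)
  then show ?thesis by (simp add: L2_def sine_def)
qed

lemma sine_gram: "L2_inner spectral_space (sine t) (sine s) = of_real (gram t s)"
proof -
  have "L2_inner spectral_space (sine t) (sine s) = (LINT \<tau>|lborel. of_real (spectral_weight \<tau> * (sin (\<tau> * t) * sin (\<tau> * s))))"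
    unfolding L2_inner_def
    by (subst integral_density) (auto simp: sine_def scaleR_conv_of_real spectral_weight_nonneg)
  also have "\<dots> = of_real (LINT \<tau>|lborel. spectral_weight \<tau> * (sin (\<tau> * t) * sin (\<tau> * s)))"
    by (rule integral_complex_of_real)
  also have "(LINT \<tau>|lborel. spectral_weight \<tau> * (sin (\<tau> * t) * sin (\<tau> * s)))
    = (LINT \<tau>|lborel. (spectral_weight \<tau> * cos (\<tau> * (t - s)) - spectral_weight \<tau> * cos (\<tau> * (t + s))) / 2)"
  proof -
    have "sin (\<tau> * t) * sin (\<tau> * s) = (cos (\<tau> * (t - s)) - cos (\<tau> * (t + s))) / 2" for \<tau>
      by (simp only: sin_times_sin right_diff_distrib distrib_left)
    then show ?thesis by (simp only: right_diff_distrib times_divide_eq_right)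
  qed
  also have "\<dots> = gram t s"
    by (simp add: spectral_weight_cos gram_eq_difference)
  finally show ?thesis .
qed

text \<open>Fubini, with integrability from the uniform norm bound on the family and Cauchy-Schwarz.
  That \<open>h\<close> equals the average only almost everywhere fits transforms that are computed
  away from the common endpoint 0.\<close>

lemma L2_inner_kernel_average:
  fixes k :: "real \<Rightarrow> real"
  assumes M: "sigma_finite_measure M"
    and joint[measurable]: "(\<lambda>(s, x). a s x) \<in> borel_measurable (lborel \<Otimes>\<^sub>M M)"
    and a: "\<And>s. a s \<in> L2 M" "\<And>s. L2_norm M (a s) \<le> C"
    and k: "integrable lborel k"
    and h: "h \<in> borel_measurable M" "AE x in M. h x = (LINT s|lborel. of_real (k s) * a s x)"
    and g: "g \<in> L2 M"
  shows "L2_inner M h g = (LINT s|lborel. of_real (k s) * L2_inner M (a s) g)"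
proof -
  interpret M: sigma_finite_measure M by (rule M)
  interpret P: pair_sigma_finite lborel M ..
  have [measurable]: "g \<in> borel_measurable M" "k \<in> borel_measurable borel" "h \<in> borel_measurable M"
    using g k h L2_measurable by auto
  define f where "f s x = of_real (k s) * a s x * cnj (g x)" for s x
  have fm [measurable]: "case_prod f \<in> borel_measurable (lborel \<Otimes>\<^sub>M M)"
    unfolding f_def[abs_def] using joint by measurable
  have i: "integrable M (f s)" for s
    using L2_inner_integrable[OF a(1) g, of s] by (simp add: f_def[abs_def] mult.assoc)
  have n: "(LINT x|M. norm (f s x)) \<le> \<bar>k s\<bar> * (C * L2_norm M g)" for s
  proof -
    have L: "(\<lambda>x. of_real (cmod (a s x))) \<in> L2 M" "(\<lambda>x. of_real (cmod (g x))) \<in> L2 M"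
      using a(1)[of s] g by (auto simp: L2_def)
    have "(LINT x|M. cmod (a s x) * cmod (g x)) = Re (L2_inner M (\<lambda>x. of_real (cmod (a s x))) (\<lambda>x. of_real (cmod (g x))))"
      unfolding L2_inner_def by (simp flip: of_real_mult)
    also have "\<dots> \<le> cmod (L2_inner M (\<lambda>x. of_real (cmod (a s x))) (\<lambda>x. of_real (cmod (g x))))" by (rule complex_Re_le_cmod)
    also have "\<dots> \<le> L2_norm M (\<lambda>x. of_real (cmod (a s x))) * L2_norm M (\<lambda>x. of_real (cmod (g x)))"
      by (rule L2_Cauchy_Schwarz[OF L])
    also have "\<dots> = L2_norm M (a s) * L2_norm M g" by (simp add: L2_norm_def)
    also have "\<dots> \<le> C * L2_norm M g" by (intro mult_right_mono a L2_norm_nonneg)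
    finally have "(LINT x|M. cmod (a s x) * cmod (g x)) \<le> C * L2_norm M g" .
    then have "\<bar>k s\<bar> * (LINT x|M. cmod (a s x) * cmod (g x)) \<le> \<bar>k s\<bar> * (C * L2_norm M g)"
      by (intro mult_left_mono) auto
    then show ?thesis by (simp add: f_def norm_mult mult.assoc)
  qed
  have pair: "integrable (lborel \<Otimes>\<^sub>M M) (case_prod f)"
  proof (rule P.Fubini_integrable[OF fm])
    show "integrable lborel (\<lambda>s. LINT x|M. norm (case_prod f (s, x)))"
    proof (rule Bochner_Integration.integrable_bound)
      show "integrable lborel (\<lambda>s. \<bar>k s\<bar> * (C * L2_norm M g))" using k by auto
      show "AE s in lborel. norm (LINT x|M. norm (case_prod f (s, x))) \<le> norm (\<bar>k s\<bar> * (C * L2_norm M g))"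
      proof (rule AE_I2)
        fix s
        have "0 \<le> (LINT x|M. norm (f s x))" by (simp add: Bochner_Integration.integral_nonneg)
        then show "norm (LINT x|M. norm (case_prod f (s, x))) \<le> norm (\<bar>k s\<bar> * (C * L2_norm M g))" using n[of s] by simp
      qed
    qed measurable
  qed (use i in auto)
  have "L2_inner M h g = (LINT x|M. LINT s|lborel. f s x)"
    unfolding L2_inner_def
  proof (rule integral_cong_AE)
    show "AE x in M. h x * cnj (g x) = (LINT s|lborel. f s x)"
      using h(2) by eventually_elim (simp add: f_def)
  qed measurable
  also have "\<dots> = (LINT s|lborel. LINT x|M. f s x)" by (rule P.Fubini_integral[OF pair])
  also have "\<dots> = (LINT s|lborel. of_real (k s) * L2_inner M (a s) g)"
    by (simp add: f_def L2_inner_def mult.assoc)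
  finally show ?thesis .
qed

section \<open>The convolution model\<close>

lemma sine_average: "(LINT s|lborel. of_real (sech_kernel (s - t)) * sine s \<tau>) = of_real (sech_symbol \<tau>) * sine t \<tau>"
proof -
  have "(LINT s|lborel. of_real (sech_kernel (s - t)) * sine s \<tau>) = (LINT s|lborel. complex_of_real (sin (\<tau> * s) * sech_kernel (s - t)))"
    by (simp add: sine_def mult.commute)
  also have "\<dots> = of_real (sin (\<tau> * t) * sech_symbol \<tau>)"
    unfolding integral_complex_of_real shifted_sech_kernel ..
  finally show ?thesis by (simp add: sine_def mult.commute)
qed

text \<open>Crude, as the diagonal is at most 1/8; it provides the uniform norm bound that
  \<open>L2_inner_kernel_average\<close> requires.\<close>

lemma gram_diag_le: "gram t t \<le> 1"
proof -
  have "(sinh (t / 2))\<^sup>2 \<le> (cosh (t / 2))\<^sup>2" by (simp add: cosh_square_eq)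
  moreover have "0 < (cosh (t / 2))\<^sup>2" by (simp add: cosh_real_pos)
  moreover have "gram t t = (sinh (t / 2))\<^sup>2 / (8 * (cosh (t / 2))\<^sup>2)"
    by (simp add: gram_def power2_eq_square)
  ultimately show ?thesis by (simp add: divide_le_eq_1_pos)
      (rule order_trans, assumption, simp)
qed

lemma L2_norm_le_1_of_gram:
  assumes "L2_inner M v v = of_real (gram t t)" shows "L2_norm M v \<le> 1"
proof -
  have "(L2_norm M v)\<^sup>2 \<le> 1\<^sup>2" using assms gram_diag_le[of t] by (simp add: L2_norm_sq_inner)
  then show ?thesis by (rule power2_le_imp_le) simp
qed

lemma sine_joint_measurable: "(\<lambda>(s, \<tau>). sine s \<tau>) \<in> borel_measurable (lborel \<Otimes>\<^sub>M spectral_space)"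
  unfolding sine_def by measurable

lemma integrable_shifted_sech_kernel: "integrable lborel (\<lambda>s. sech_kernel (s - t))"
  by (rule shifted_sech_kernel)

lemma sigma_finite_spectral_space: "sigma_finite_measure spectral_space"
proof -
  have "finite_measure spectral_space"
  proof (rule finite_measureI)
    show "emeasure spectral_space (space spectral_space) \<noteq> \<infinity>"
      using emeasure_density_eq_integral[OF integrable_spectral_weight spectral_weight_nonneg, of UNIV] by simp
  qed
  then interpret finite_measure spectral_space .
  show ?thesis ..
qed

lemma multiplied_sine_inner:
  assumes "g \<in> L2 spectral_space"
  shows "L2_inner spectral_space (\<lambda>\<tau>. of_real (sech_symbol \<tau>) * sine t \<tau>) g
    = (LINT s|lborel. of_real (sech_kernel (s - t)) * L2_inner spectral_space (sine s) g)"
  by (rule L2_inner_kernel_average[OF sigma_finite_spectral_space sine_joint_measurable sine_L2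
        L2_norm_le_1_of_gram[OF sine_gram] integrable_shifted_sech_kernel _ _ assms])
    (auto simp: sine_average)

text \<open>The orthogonal complement of the sines is invariant under multiplication by \<open>sech (\<pi> \<tau>)\<close>.\<close>

lemma total_family_sine: "total_family spectral_space sine"
  unfolding total_family_def
proof (intro conjI allI ballI impI sine_L2)
  let ?N = "spectral_space"
  fix \<phi> assume \<phi>: "\<phi> \<in> L2 ?N" and 0: "\<forall>t. L2_inner ?N \<phi> (sine t) = 0"
  have [measurable]: "\<phi> \<in> borel_measurable borel" using L2_measurable[OF \<phi>] by simp
  \<comment> \<open>Each factor of the symbol can be moved onto the sine, where it becomes an
    average of sines; so orthogonality to all sines persists, and the moments of
    \<open>\<phi>\<close> under the symbol vanish.\<close>
  define \<phi>n where "\<phi>n n \<tau> = of_real (sech_symbol \<tau> ^ n) * \<phi> \<tau>" for n \<tau>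
  have \<phi>n: "\<phi>n n \<in> L2 ?N" for n
    unfolding \<phi>n_def
    by (rule L2_bounded_mult[where C = 1, OF \<phi>])
      (auto simp: sech_symbol_bounds abs_of_pos norm_power power_le_one less_imp_le[OF sech_symbol_bounds(1)])
  have orth: "L2_inner ?N (sine t) (\<phi>n n) = 0" for n t
  proof (induction n arbitrary: t)
    case 0
    have "L2_inner ?N (sine t) (\<phi>n 0) = cnj (L2_inner ?N \<phi> (sine t))"
      by (subst L2_inner_commute) (simp add: \<phi>n_def[abs_def])
    then show ?case using \<open>\<forall>t. L2_inner ?N \<phi> (sine t) = 0\<close> by simp
  next
    case (Suc n)
    have "L2_inner ?N (sine t) (\<phi>n (Suc n)) = L2_inner ?N (\<lambda>\<tau>. of_real (sech_symbol \<tau>) * sine t \<tau>) (\<phi>n n)"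
      by (simp add: L2_inner_def \<phi>n_def mult_ac)
    also have "\<dots> = 0" using Suc by (simp add: multiplied_sine_inner \<phi>n)
    finally show ?case .
  qed
  \<comment> \<open>The single sine of index 1 suffices as a test function, because its zeros are
    countable.\<close>
  define h where "h \<tau> = of_real (spectral_weight \<tau>) * (cnj (\<phi> \<tau>) * sine 1 \<tau>)" for \<tau>
  have "AE \<tau> in lborel. h \<tau> = 0"
  proof (rule moments_zero_decreasing_imp_AE_zero[where m = sech_symbol and S = "{0<..}"])
    have "integrable ?N (\<lambda>\<tau>. sine 1 \<tau> * cnj (\<phi> \<tau>))" by (rule L2_inner_integrable[OF sine_L2 \<phi>])
    then have "integrable lborel (\<lambda>\<tau>. spectral_weight \<tau> *\<^sub>R (sine 1 \<tau> * cnj (\<phi> \<tau>)))"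
      by (subst (asm) integrable_density) (auto simp: spectral_weight_nonneg)
    then show "integrable lborel h" by (simp add: h_def[abs_def] scaleR_conv_of_real mult_ac)
    show "(LINT \<tau>|lborel. of_real (sech_symbol \<tau> ^ n) * h \<tau>) = 0" for n
    proof -
      have "0 = L2_inner ?N (sine 1) (\<phi>n n)" by (simp add: orth)
      also have "\<dots> = (LINT \<tau>|lborel. spectral_weight \<tau> *\<^sub>R (sine 1 \<tau> * cnj (\<phi>n n \<tau>)))"
        unfolding L2_inner_def by (rule integral_density) (auto simp: spectral_weight_nonneg \<phi>n_def[abs_def])
      also have "\<dots> = (LINT \<tau>|lborel. of_real (sech_symbol \<tau> ^ n) * h \<tau>)"
        by (simp add: h_def \<phi>n_def scaleR_conv_of_real mult_ac)
      finally show ?thesis by simp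
    qed
  qed (auto simp: h_def spectral_weight_0 sech_symbol_bounds sech_symbol_decreasing intro: less_imp_le)
  moreover have "AE \<tau> in lborel. sin \<tau> \<noteq> (0::real)"
  proof (rule AE_not_in[where N = "{\<tau>. sin \<tau> = (0::real)}", simplified])
    have "{\<tau>. sin \<tau> = (0::real)} = range (\<lambda>n::int. of_int n * pi)" by (auto simp: sin_zero_iff_int2)
    then show "{\<tau>. sin \<tau> = (0::real)} \<in> null_sets lborel" by (simp add: countable_imp_null_set_lborel)
  qed
  ultimately have "AE \<tau> in lborel. 0 < ennreal (spectral_weight \<tau>) \<longrightarrow> \<phi> \<tau> = 0"
    by eventually_elim (auto simp: h_def sine_def)
  then show "AE \<tau> in ?N. \<phi> \<tau> = 0" by (subst AE_density) auto
qed

text \<open>On the positive half line the squared symbol has the inverse \<open>g\<close>, which is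
  differentiable on (0, 1), and differentiable images of null sets are null.\<close>

lemma null_sets_sech_symbol_vimage:
  assumes Z: "Z \<in> null_sets lborel"
  shows "{\<tau>. 0 < \<tau> \<and> (sech_symbol \<tau>)\<^sup>2 \<in> Z} \<in> null_sets lborel"
proof -
  have [measurable]: "Z \<in> sets borel" using Z by auto
  define g where "g y = arcosh (inverse (sqrt y)) / pi" for y :: real
  let ?S = "{\<tau>. 0 < \<tau> \<and> (sech_symbol \<tau>)\<^sup>2 \<in> Z}"
  have m: "?S \<in> sets borel" by measurable
  have "?S \<subseteq> g ` (Z \<inter> {0<..<1})"
  proof
    fix \<tau> assume \<tau>: "\<tau> \<in> ?S"
    then have "cosh (pi * 0) < cosh (pi * \<tau>)" by (intro cosh_real_strict_mono) auto
    then have c1: "1 < cosh (pi * \<tau>)" by simp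
    have "sqrt ((sech_symbol \<tau>)\<^sup>2) = sech_symbol \<tau>" using sech_symbol_bounds[of \<tau>] by simp
    then have "g ((sech_symbol \<tau>)\<^sup>2) = arcosh (cosh (pi * \<tau>)) / pi" by (simp add: g_def) (simp add: sech_symbol_def)
    also have "\<dots> = \<tau>" using \<tau> by (simp add: arcosh_cosh_real)
    finally have "\<tau> = g ((sech_symbol \<tau>)\<^sup>2)" by simp
    moreover have "(sech_symbol \<tau>)\<^sup>2 < 1" "0 < (sech_symbol \<tau>)\<^sup>2"
      using c1 sech_symbol_bounds[of \<tau>] by (auto simp: sech_symbol_def power_less_one_iff abs_square_less_1)
    ultimately show "\<tau> \<in> g ` (Z \<inter> {0<..<1})" using \<tau> by (intro image_eqI[of _ _ "(sech_symbol \<tau>)\<^sup>2"]) auto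
  qed
  moreover have "negligible (g ` (Z \<inter> {0<..<1}))"
  proof (rule negligible_differentiable_image_negligible)
    have "negligible Z" using null_sets_completionI[OF Z] by (simp add: negligible_iff_null_sets)
    then show "negligible (Z \<inter> {0<..<1})" by (rule negligible_subset) auto
    show "g differentiable_on Z \<inter> {0<..<1}"
      unfolding differentiable_on_def
    proof
      fix y assume y: "y \<in> Z \<inter> {0<..<1}"
      then have 1: "1 < inverse (sqrt y)" by (simp add: one_less_inverse)
      have "((\<lambda>y. inverse (sqrt y)) has_real_derivative - (inverse (sqrt y) * (inverse (sqrt y) / 2) * inverse (sqrt y))) (at y)"
        by (rule DERIV_inverse'[OF DERIV_real_sqrt]) (use y in auto)
      from DERIV_cdivide[OF DERIV_chain2[OF arcosh_real_has_field_derivative[OF 1] this], of pi]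
      have "\<exists>D. (g has_real_derivative D) (at y)" unfolding g_def by blast
      then show "g differentiable at y within Z \<inter> {0<..<1}"
        using differentiable_at_withinI by (metis real_differentiable_def)
    qed
  qed simp
  ultimately have "negligible ?S" using negligible_subset by blast
  then show ?thesis using m by (simp add: negligible_iff_null_sets null_sets_completion_iff)
qed

text \<open>The right-hand side involves the family only through \<open>gram\<close>. Two families
  with this Gram matrix therefore have averages with equal Gram matrices, which compares transformed
  vectors on an interval with multiplied sines.\<close>

lemma kernel_average_gram:
  assumes M: "sigma_finite_measure M"
    and joint: "(\<lambda>(s, x). a s x) \<in> borel_measurable (lborel \<Otimes>\<^sub>M M)"
    and a: "\<And>s. a s \<in> L2 M" and gram: "\<And>s r. L2_inner M (a s) (a r) = of_real (gram s r)"
    and h: "\<And>t. h t \<in> L2 M" "\<And>t. AE x in M. h t x = (LINT s|lborel. of_real (sech_kernel (s - t)) * a s x)"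
  shows "L2_inner M (h t) (h s)
    = (LINT r|lborel. of_real (sech_kernel (r - t)) * cnj (LINT q|lborel. of_real (sech_kernel (q - s)) * of_real (gram q r)))"
proof -
  have avg: "L2_inner M (h t) g = (LINT r|lborel. of_real (sech_kernel (r - t)) * L2_inner M (a r) g)" if "g \<in> L2 M" for t g
    by (rule L2_inner_kernel_average[OF M joint a L2_norm_le_1_of_gram[OF gram] integrable_shifted_sech_kernel
          L2_measurable[OF h(1)] h(2) that])
  have "L2_inner M (a r) (h s) = cnj (LINT q|lborel. of_real (sech_kernel (q - s)) * of_real (gram q r))" for r
    by (subst L2_inner_commute) (simp add: avg a gram del: of_real_mult)
  then show ?thesis by (simp add: avg h)
qed

text \<open>The hypotheses say that \<open>H\<close> acts on the family \<open>a\<close> as convolution with the sech kernel in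
  the index; the sines in \<open>L\<^sup>2(spectral_space)\<close> have the same Gram matrix, and there the convolution
  is multiplication by \<open>sech (\<pi> \<tau>)\<close>.\<close>

theorem sech_convolution_model:
  fixes M :: "'a measure" and M' :: "'b measure"
  assumes a: "total_family M a" and a_gram: "\<And>t s. L2_inner M (a t) (a s) = of_real (gram t s)"
    and M': "sigma_finite_measure M'"
    and b_joint: "(\<lambda>(s, x). b s x) \<in> borel_measurable (lborel \<Otimes>\<^sub>M M')"
    and b: "\<And>s. b s \<in> L2 M'" and b_gram: "\<And>s r. L2_inner M' (b s) (b r) = of_real (gram s r)"
    and H_form: "AE x in M'. \<exists>k\<in>L2 M. \<forall>f\<in>L2 M. H f x = L2_inner M f k"
    and H_measurable: "\<And>f. f \<in> L2 M \<Longrightarrow> H f \<in> borel_measurable M'"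
    and H_a: "\<And>t. H (a t) \<in> L2 M'"
      "\<And>t. AE x in M'. H (a t) x = (LINT s|lborel. of_real (sech_kernel (s - t)) * b s x)"
  shows "simple_spectrum M (\<lambda>f. L2_adjoint M M' H (H f)) \<and> purely_ac_spectrum M (\<lambda>f. L2_adjoint M M' H (H f))"
proof -
  let ?N = "spectral_space"
  define m where "m \<phi> \<tau> = of_real (sech_symbol \<tau>) * \<phi> \<tau>" for \<phi> :: "real \<Rightarrow> complex" and \<tau>
  have aL: "\<And>t. a t \<in> L2 M" using a by (simp add: total_family_def)
  obtain U where U: "L2_unitary M ?N U"
    and Udist: "\<And>f cs. f \<in> L2 M \<Longrightarrow> L2_norm ?N (\<lambda>x. U f x - lin_comb sine cs x) = L2_norm M (\<lambda>x. f x - lin_comb a cs x)"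
    by (rule equal_gram_imp_unitary[OF a total_family_sine]) (auto simp: a_gram sine_gram)
  have m_L2: "m \<phi> \<in> L2 ?N" and m_norm: "L2_norm ?N (m \<phi>) \<le> L2_norm ?N \<phi>" if "\<phi> \<in> L2 ?N" for \<phi>
    unfolding m_def using that
    by (auto intro!: L2_bounded_mult[where C = 1] L2_norm_mult_le simp: sech_symbol_bounds abs_of_pos)
  have m_diff: "(\<lambda>x. m \<phi> x - m \<psi> x) = m (\<lambda>x. \<phi> x - \<psi> x)" for \<phi> \<psi>
    by (simp add: m_def fun_eq_iff right_diff_distrib)
  have m_lin: "lin_comb (\<lambda>t. m (sine t)) cs = m (lin_comb sine cs)" for cs
    by (induction cs) (auto simp: lin_comb_Nil lin_comb_Cons m_def fun_eq_iff algebra_simps)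
  define h where "h t = H (a t)" for t
  have msL: "m (sine t) \<in> L2 ?N" for t by (rule m_L2[OF sine_L2])
  have h_gram: "L2_inner M' (h t) (h s) = L2_inner ?N (m (sine t)) (m (sine s))" for t s
    unfolding h_def
    by (subst kernel_average_gram[OF M' b_joint b b_gram H_a],
        subst kernel_average_gram[OF sigma_finite_spectral_space sine_joint_measurable sine_L2 sine_gram])
      (auto simp: sine_average msL, simp add: m_def)
  have hL: "h t \<in> L2 M'" for t unfolding h_def by (rule H_a)
  note lc_h = L2_lin_comb[of h, OF hL] and lc_s = L2_lin_comb[of sine, OF sine_L2]
  have lc_gram: "L2_inner M' (lin_comb h cs) (lin_comb h ds) = L2_inner ?N (m (lin_comb sine cs)) (m (lin_comb sine ds))" for cs ds
    unfolding m_lin[symmetric] by (rule gram_lin_comb[OF hL msL h_gram])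
  have approx: "\<exists>cs. H f \<in> L2 M' \<and> (\<lambda>n. L2_norm M' (\<lambda>x. H f x - lin_comb h (cs n) x)) \<longlonglongrightarrow> 0 \<and>
      (\<lambda>n. L2_norm ?N (\<lambda>x. m (U f) x - m (lin_comb sine (cs n)) x)) \<longlonglongrightarrow> 0"
    if f: "f \<in> L2 M" for f
  proof -
    have Uf: "U f \<in> L2 ?N" by (rule L2_unitary_L2[OF U f])
    obtain cs where cs: "(\<lambda>n. L2_norm M (\<lambda>x. f x - lin_comb a (cs n) x)) \<longlonglongrightarrow> 0"
      using total_family_seq[OF a f] by blast
    have 1: "(\<lambda>n. L2_norm ?N (\<lambda>x. m (U f) x - m (lin_comb sine (cs n)) x)) \<longlonglongrightarrow> 0"
    proof (rule Lim_null_comparison[OF _ cs])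
      show "\<forall>\<^sub>F n in sequentially. norm (L2_norm ?N (\<lambda>x. m (U f) x - m (lin_comb sine (cs n)) x))
          \<le> L2_norm M (\<lambda>x. f x - lin_comb a (cs n) x)"
        using m_norm[OF L2_diff[OF Uf lc_s]] by (simp add: m_diff Udist[OF f] L2_norm_nonneg)
    qed
    have Cauchy: "\<exists>K. \<forall>p\<ge>K. \<forall>q\<ge>K. L2_norm M' (\<lambda>x. lin_comb h (cs p) x - lin_comb h (cs q) x) < e" if e: "0 < e" for e
    proof -
      obtain K where K: "\<forall>n\<ge>K. norm (L2_norm ?N (\<lambda>x. m (U f) x - m (lin_comb sine (cs n)) x) - 0) < e / 2"
        using LIMSEQ_D[OF 1, of "e / 2"] e by auto
      have "L2_norm M' (\<lambda>x. lin_comb h (cs p) x - lin_comb h (cs q) x) < e" if "p \<ge> K" "q \<ge> K" for p q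
      proof -
        have "L2_norm M' (\<lambda>x. lin_comb h (cs p) x - lin_comb h (cs q) x)
          = L2_norm ?N (\<lambda>x. m (lin_comb sine (cs p)) x - m (lin_comb sine (cs q)) x)"
          by (intro L2_norm_diff_eqI lc_h lc_gram m_L2 lc_s)
        also have "\<dots> \<le> L2_norm ?N (\<lambda>x. m (lin_comb sine (cs p)) x - m (U f) x)
            + L2_norm ?N (\<lambda>x. m (U f) x - m (lin_comb sine (cs q)) x)"
          by (intro L2_norm_triangle3 m_L2 lc_s Uf)
        also have "\<dots> < e"
          using K[rule_format, OF that(1)] K[rule_format, OF that(2)]
          unfolding L2_norm_minus_commute[of ?N "m (lin_comb sine (cs p))" "m (U f)"]
          by (simp add: L2_norm_nonneg)
        finally show ?thesis .
      qed
      then show ?thesis by blast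
    qed
    \<comment> \<open>For fixed \<open>x\<close> the value \<open>H f x\<close> is an inner product
      with a fixed vector, so norm convergence of the combinations gives pointwise convergence of
      their images. Together with the Cauchy property this shows that \<open>H f\<close> is
      square-integrable and is the norm limit.\<close>
    have "AE x in M'. (\<lambda>n. lin_comb h (cs n) x) \<longlonglongrightarrow> H f x"
      using H_form
    proof eventually_elim
      case (elim x)
      then obtain k where k: "k \<in> L2 M" "\<And>f. f \<in> L2 M \<Longrightarrow> H f x = L2_inner M f k" by blast
      have "lin_comb h (cs n) x = L2_inner M (lin_comb a (cs n)) k" for n
        unfolding L2_inner_lin_comb_left[of a, OF aL k(1)] by (simp add: lin_comb_def h_def k aL)
      moreover have "(\<lambda>n. L2_inner M (lin_comb a (cs n)) k) \<longlonglongrightarrow> L2_inner M f k"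
        by (rule L2_inner_tendsto[where v = "\<lambda>n. k"]) (use f k cs L2_lin_comb[of a, OF aL] in \<open>auto simp: L2_norm_def\<close>)
      ultimately show ?case by (simp add: k f)
    qed
    note lim = L2_Cauchy_AE_limit[of "\<lambda>n. lin_comb h (cs n)", OF lc_h H_measurable[OF f] this Cauchy]
    show ?thesis using lim 1 by blast
  qed
  have H_L2: "H f \<in> L2 M'" if "f \<in> L2 M" for f using approx[OF that] by blast
  have H_inner: "L2_inner M' (H f) (H g) = L2_inner ?N (m (U f)) (m (U g))" if f: "f \<in> L2 M" and g: "g \<in> L2 M" for f g
  proof -
    obtain cs ds where
      c: "(\<lambda>n. L2_norm M' (\<lambda>x. H f x - lin_comb h (cs n) x)) \<longlonglongrightarrow> 0"
        "(\<lambda>n. L2_norm ?N (\<lambda>x. m (U f) x - m (lin_comb sine (cs n)) x)) \<longlonglongrightarrow> 0"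
      and d: "(\<lambda>n. L2_norm M' (\<lambda>x. H g x - lin_comb h (ds n) x)) \<longlonglongrightarrow> 0"
        "(\<lambda>n. L2_norm ?N (\<lambda>x. m (U g) x - m (lin_comb sine (ds n)) x)) \<longlonglongrightarrow> 0"
      using approx[OF f] approx[OF g] by blast
    have "(\<lambda>n. L2_inner M' (lin_comb h (cs n)) (lin_comb h (ds n))) \<longlonglongrightarrow> L2_inner M' (H f) (H g)"
      by (rule L2_inner_tendsto[OF lc_h lc_h H_L2[OF f] H_L2[OF g] c(1) d(1)])
    moreover have "(\<lambda>n. L2_inner ?N (m (lin_comb sine (cs n))) (m (lin_comb sine (ds n)))) \<longlonglongrightarrow> L2_inner ?N (m (U f)) (m (U g))"
      by (rule L2_inner_tendsto[OF m_L2[OF lc_s] m_L2[OF lc_s] m_L2[OF L2_unitary_L2[OF U f]] m_L2[OF L2_unitary_L2[OF U g]] c(2) d(2)])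
    ultimately show ?thesis unfolding lc_gram by (rule LIMSEQ_unique)
  qed
  have mm: "L2_inner ?N (m (U f)) (m (U g)) = L2_inner ?N (U f) (\<lambda>\<tau>. of_real ((sech_symbol \<tau>)\<^sup>2) * U g \<tau>)" for f g
    by (simp add: L2_inner_def m_def power2_eq_square mult_ac)
  define A where "A f = L2_adjoint M M' H (H f)" for f
  have A: "A g \<in> L2 M \<and> (\<forall>f\<in>L2 M. L2_inner M' (H f) (H g) = L2_inner M f (A g))" if g: "g \<in> L2 M" for g
  proof -
    \<comment> \<open>The adjoint vector is the one whose image under \<open>U\<close> is
      \<open>U g\<close> multiplied twice by the symbol. Its existence makes the choice in
      \<open>L2_adjoint\<close> meaningful on the range of \<open>H\<close>.\<close>
    have mmU: "m (m (U g)) \<in> L2 ?N" by (intro m_L2 L2_unitary_L2[OF U g])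
    then obtain k where k: "k \<in> L2 M" "AE \<tau> in ?N. U k \<tau> = m (m (U g)) \<tau>" using L2_unitary_surj[OF U] by blast
    have "L2_inner M' (H f) (H g) = L2_inner M f k" if f: "f \<in> L2 M" for f
    proof -
      have "L2_inner M f k = L2_inner ?N (U f) (U k)" by (rule L2_unitary_inner[OF U f k(1), symmetric])
      also have "\<dots> = L2_inner ?N (U f) (m (m (U g)))"
        using k(2) L2_unitary_L2[OF U f] L2_unitary_L2[OF U k(1)] mmU
        by (intro L2_inner_cong_AE L2_measurable) auto
      also have "\<dots> = L2_inner ?N (m (U f)) (m (U g))" by (simp add: L2_inner_def m_def mult_ac)
      finally show ?thesis by (simp add: H_inner f g)
    qed
    then have "\<exists>k. k \<in> L2 M \<and> (\<forall>f\<in>L2 M. L2_inner M' (H f) (H g) = L2_inner M f k)" using k(1) by blast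
    from someI_ex[OF this] show ?thesis unfolding A_def L2_adjoint_def .
  qed
  interpret multiplication_model M spectral_weight "\<lambda>\<tau>. (sech_symbol \<tau>)\<^sup>2" U A
  proof
    show "strict_antimono_on {0<..} (\<lambda>\<tau>. (sech_symbol \<tau>)\<^sup>2)"
    proof (rule monotone_onI)
      fix x y :: real assume "x \<in> {0<..}" "y \<in> {0<..}" "x < y"
      from monotone_onD[OF sech_symbol_decreasing this] show "(sech_symbol y)\<^sup>2 < (sech_symbol x)\<^sup>2"
        using sech_symbol_bounds(1)[of y] by (intro power_strict_mono) auto
    qed
    show "{\<tau>. 0 < \<tau> \<and> (sech_symbol \<tau>)\<^sup>2 \<in> Z} \<in> null_sets lborel" if "Z \<in> null_sets lborel" for Z
      using that by (rule null_sets_sech_symbol_vimage)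
    show "(sech_symbol \<tau>)\<^sup>2 \<le> 1" for \<tau>
      using sech_symbol_bounds[of \<tau>] by (intro power_le_one) auto
    show "L2_inner M f (A g) = L2_inner ?N (U f) (\<lambda>\<tau>. of_real ((sech_symbol \<tau>)\<^sup>2) * U g \<tau>)"
      if "f \<in> L2 M" "g \<in> L2 M" for f g
      using A[OF that(2)] that(1) H_inner[OF that] mm by simp
  qed (use U A integrable_spectral_weight spectral_weight_nonneg spectral_weight_0 spectral_weight_pos in auto)
  show ?thesis using simple_and_ac unfolding A_def .
qed

section \<open>The total family on an interval\<close>

text \<open>For the interval \<open>[0,b]\<close> with neighbour of length \<open>a\<close>, the Moebius map is
  \<open>v = (2 a b / y - (a - b)) / (a + b)\<close>; up to the factor \<open>(a + b) y / 2\<close> the quantity \<open>v + cosh t\<close> is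
  \<open>half_den a b t y\<close>, and \<open>half_vec a b t\<close> is the transplanted \<open>- r_t\<close>.\<close>

definition half_den :: "real \<Rightarrow> real \<Rightarrow> real \<Rightarrow> real \<Rightarrow> real" where
  "half_den a b t y = a * b + ((a + b) * (cosh (t / 2))\<^sup>2 - a) * y"

definition half_vec :: "real \<Rightarrow> real \<Rightarrow> real \<Rightarrow> real \<Rightarrow> real" where
  "half_vec a b t y = (a + b) * sqrt (a * b) / 2 * (sinh (t / 2) * cosh (t / 2)) * (sqrt y / sqrt (half_den a b t y) ^ 3)"

text \<open>On [0, b] the first form gives growth in \<open>t\<close>. The second shows the lower
  bound \<open>a * b\<close> and the linear dependence on
  \<open>(a + b) * (sinh (t / 2))\<^sup>2\<close>, the parameter that is later
  differentiated.\<close>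

lemma half_den_alt:
  "half_den a b t y = a * (b - y) + (a + b) * (cosh (t / 2))\<^sup>2 * y"
  "half_den a b t y = b * (a + y) + (a + b) * (sinh (t / 2))\<^sup>2 * y"
  by (simp_all add: half_den_def cosh_square_eq algebra_simps)

lemma half_den_pos:
  assumes "0 < a" "0 < b" "0 \<le> y"
  shows "0 < half_den a b t y"
proof -
  have "0 < b * (a + y)" "0 \<le> (a + b) * (sinh (t / 2))\<^sup>2 * y" using assms by simp_all
  then show ?thesis unfolding half_den_alt(2) by linarith
qed

lemma half_vec_measurable [measurable]: "(\<lambda>(t, y). half_vec a b t y) \<in> borel_measurable (lborel \<Otimes>\<^sub>M lborel)"
proof -
  have [measurable]: "(\<lambda>t. sinh (t / 2)) \<in> borel_measurable (borel::real measure)" "(\<lambda>t. cosh (t / 2)) \<in> borel_measurable (borel::real measure)"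
    by (intro borel_measurable_continuous_onI continuous_intros; simp)+
  have [measurable]: "(\<lambda>p. sinh ((fst p::real) / 2)) \<in> borel_measurable (lborel \<Otimes>\<^sub>M (lborel::real measure))"
    "(\<lambda>p. cosh ((fst p::real) / 2)) \<in> borel_measurable (lborel \<Otimes>\<^sub>M (lborel::real measure))"
    by measurable
  show ?thesis unfolding half_vec_def half_den_def case_prod_unfold by measurable
qed

lemma half_vec_measurable1 [measurable]: "half_vec a b t \<in> borel_measurable borel"
  unfolding half_vec_def[abs_def] half_den_def by measurable

section \<open>The Gram matrix on an interval, by an explicit antiderivative\<close>

lemma gram_antiderivative_algebra:
  fixes X Y c p q y :: real
  assumes "0 < X" "0 < Y" "p * y = X\<^sup>2 - c" "q * y = Y\<^sup>2 - c"
  defines "W \<equiv> X * Y * (X + Y)\<^sup>2"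
    and "W' \<equiv> (p / (2 * X) * Y + X * (q / (2 * Y))) * (X + Y)\<^sup>2 + X * Y * (2 * (X + Y) * (p / (2 * X) + q / (2 * Y)))"
  shows "(2 * y * W - y\<^sup>2 * W') / (W * W) = c * y / (2 * X ^ 3 * Y ^ 3)"
proof -
  \<comment> \<open>Multiplying by \<open>y\<close> eliminates \<open>p\<close> and \<open>q\<close>
    through the two hypotheses, so that only an identity between rational functions of
    \<open>X\<close>, \<open>Y\<close> and \<open>c\<close> remains.\<close>
  have "y * W' = ((p * y) / (2 * X) * Y + X * ((q * y) / (2 * Y))) * (X + Y)\<^sup>2
      + X * Y * (2 * (X + Y) * ((p * y) / (2 * X) + (q * y) / (2 * Y)))"
    unfolding W'_def by (simp add: algebra_simps add_divide_distrib)
  also have "\<dots> = 2 * W - c * (X + Y) ^ 4 / (2 * X * Y)"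
    unfolding assms(3,4) W_def using assms(1,2)
    by (simp add: field_simps) (simp add: algebra_simps power2_eq_square power3_eq_cube power4_eq_xxxx)
  finally have yW': "y * W' = 2 * W - c * (X + Y) ^ 4 / (2 * X * Y)" .
  have "2 * y * W - y\<^sup>2 * W' = y * (2 * W - y * W')" by (simp add: algebra_simps power2_eq_square)
  also have "\<dots> = y * (c * (X + Y) ^ 4 / (2 * X * Y))" unfolding yW' by simp
  also have "\<dots> / (W * W) = c * y / (2 * X ^ 3 * Y ^ 3)"
  proof -
    have 4: "(X + Y) ^ 4 = (X + Y)\<^sup>2 * (X + Y)\<^sup>2" by (simp add: power4_eq_xxxx power2_eq_square)
    have "Z * Z * (c * y) / (2 * X * Y) / (X * Y * Z * (X * Y * Z)) = c * y / (2 * X ^ 3 * Y ^ 3)" if "Z \<noteq> 0" for Z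
      using that assms(1,2) by (simp add: power3_eq_cube field_simps)
    from this[of "(X + Y)\<^sup>2"] show ?thesis
      unfolding 4 W_def using assms(1,2) by (simp add: mult_ac)
  qed
  finally show ?thesis .
qed

lemma gram_antiderivative:
  fixes c p q y :: real
  assumes "0 < c + p * y" "0 < c + q * y"
  shows "((\<lambda>y. y\<^sup>2 / (sqrt (c + p * y) * sqrt (c + q * y) * (sqrt (c + p * y) + sqrt (c + q * y))\<^sup>2))
    has_real_derivative c * y / (2 * sqrt (c + p * y) ^ 3 * sqrt (c + q * y) ^ 3)) (at y)"
proof -
  let ?X = "\<lambda>y. sqrt (c + p * y)" and ?Y = "\<lambda>y. sqrt (c + q * y)"
  have d: "((\<lambda>y. sqrt (c + p * y)) has_real_derivative p / (2 * sqrt (c + p * y))) (at y)"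
    if "0 < c + p * y" for p y
  proof -
    have "((\<lambda>y. c + p * y) has_real_derivative p) (at y)" by (auto intro!: derivative_eq_intros)
    from DERIV_chain2[OF DERIV_real_sqrt[OF that] this] show ?thesis by (simp add: field_simps)
  qed
  note X = d[OF assms(1)] and Y = d[OF assms(2)]
  have S: "((\<lambda>y. (?X y + ?Y y)\<^sup>2) has_real_derivative 2 * (?X y + ?Y y) * (p / (2 * ?X y) + q / (2 * ?Y y))) (at y)"
  proof -
    have "((\<lambda>y. (g y)\<^sup>2) has_real_derivative 2 * g y * D) (at y)" if "(g has_real_derivative D) (at y)" for g D
      using that by (auto intro!: derivative_eq_intros)
    from this[OF DERIV_add[OF X Y]] show ?thesis .
  qed
  have pos: "0 < ?X y" "0 < ?Y y" using assms by simp_all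
  have W: "((\<lambda>y. ?X y * ?Y y * (?X y + ?Y y)\<^sup>2) has_real_derivative
      (p / (2 * ?X y) * ?Y y + ?X y * (q / (2 * ?Y y))) * (?X y + ?Y y)\<^sup>2
        + ?X y * ?Y y * (2 * (?X y + ?Y y) * (p / (2 * ?X y) + q / (2 * ?Y y)))) (at y)"
    using DERIV_mult[OF DERIV_mult[OF X Y] S] by (simp add: mult.commute add.commute)
  have y2: "((\<lambda>y. y\<^sup>2) has_real_derivative 2 * y) (at y)" by (auto intro!: derivative_eq_intros)
  have "0 < ?X y * ?Y y * (?X y + ?Y y)\<^sup>2" by (intro mult_pos_pos zero_less_power add_pos_pos pos)
  then have "?X y * ?Y y * (?X y + ?Y y)\<^sup>2 \<noteq> 0" by linarith
  from DERIV_divide[OF y2 W this] gram_antiderivative_algebra[of "?X y" "?Y y" p y c q] assms pos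
  show ?thesis by simp
qed

text \<open>At \<open>y = b\<close> the two radicals reduce to \<open>sqrt ((a + b) * b)\<close>
  times hyperbolic cosines, at 0 the antiderivative vanishes, and the prefactor of
  \<open>half_vec\<close> is chosen to cancel all lengths. Hence the families on both intervals
  share one Gram matrix.\<close>

lemma half_vec_gram:
  assumes "0 < a" "0 < b"
  shows "(LINT y|interval_lborel 0 b. half_vec a b t y * half_vec a b s y) = gram t s"
proof -
  define C C' S S' where "C = cosh (t / 2)" and "C' = cosh (s / 2)" and "S = sinh (t / 2)" and "S' = sinh (s / 2)"
  define p q where "p = (a + b) * C\<^sup>2 - a" and "q = (a + b) * C'\<^sup>2 - a"
  define K where "K = (a + b)\<^sup>2 / 2 * (S * C * S' * C')"
  let ?X = "\<lambda>y. sqrt (a * b + p * y)" and ?Y = "\<lambda>y. sqrt (a * b + q * y)"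
  have dX: "half_den a b t y = a * b + p * y" and dY: "half_den a b s y = a * b + q * y" for y
    by (simp_all add: half_den_def p_def q_def C_def C'_def)
  have pos: "0 < a * b + p * y" "0 < a * b + q * y" if "0 \<le> y" for y
    using half_den_pos[OF assms that, of t] half_den_pos[OF assms that, of s] dX dY by simp_all
  have C0: "0 < C" "0 < C'" by (simp_all add: C_def C'_def cosh_real_pos)
  define f where "f y = K * (a * b * y / (2 * ?X y ^ 3 * ?Y y ^ 3))" for y
  define F where "F y = K * (y\<^sup>2 / (?X y * ?Y y * (?X y + ?Y y)\<^sup>2))" for y
  have "(LINT y|interval_lborel 0 b. half_vec a b t y * half_vec a b s y)
    = (LINT y|lborel. f y * indicator {0..b} y)"
  proof -
    have "half_vec a b t y * half_vec a b s y = f y" if "0 \<le> y" for y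
    proof -
      have sq: "sqrt (a * b) * sqrt (a * b) = a * b" "sqrt y * sqrt y = y" using assms that by simp_all
      have "half_vec a b t y * half_vec a b s y
        = ((a + b) * (a + b) / 4 * (S * C * S' * C')) * ((sqrt (a * b) * sqrt (a * b)) * (sqrt y * sqrt y)) / (?X y ^ 3 * ?Y y ^ 3)"
        by (simp add: half_vec_def dX dY C_def C'_def S_def S'_def mult_ac)
      also have "\<dots> = f y" unfolding sq by (simp add: f_def K_def power2_eq_square mult_ac)
      finally show ?thesis .
    qed
    then show ?thesis
      by (subst integral_restrict_space) (auto intro!: Bochner_Integration.integral_cong split: split_indicator)
  qed
  also have "\<dots> = F b - F 0"
  proof (rule integral_FTC_Icc_real)
    fix y assume y: "0 \<le> y" "y \<le> b"
    show "(F has_real_derivative f y) (at y)"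
      unfolding F_def f_def by (rule DERIV_cmult[OF gram_antiderivative]) (use pos y in auto)
    show "isCont f y"
      unfolding f_def using pos[OF y(1)] by (intro continuous_intros) auto
  qed (use assms in simp)
  also have "\<dots> = gram t s"
  proof -
    have k: "0 < a + b" using assms by simp
    have "a * b + p * b = ((a + b) * b) * C\<^sup>2" "a * b + q * b = ((a + b) * b) * C'\<^sup>2"
      by (simp_all add: p_def q_def algebra_simps)
    then have X: "?X b = sqrt ((a + b) * b) * C" "?Y b = sqrt ((a + b) * b) * C'"
      using C0 by (simp_all add: real_sqrt_mult)
    define h where "h = sqrt ((a + b) * b)"
    have h2: "h * h = (a + b) * b" and h0: "0 < h" using assms by (simp_all add: h_def)
    have "F b = K * (b\<^sup>2 / ((h * C) * (h * C') * (h * C + h * C')\<^sup>2))"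
      unfolding F_def X h_def ..
    also have "(h * C) * (h * C') * (h * C + h * C')\<^sup>2 = (h * h) * (h * h) * (C * C' * (C + C')\<^sup>2)"
      by (simp add: algebra_simps power2_eq_square)
    also have "K * (b\<^sup>2 / ((h * h) * (h * h) * (C * C' * (C + C')\<^sup>2))) = S * S' / (2 * (C + C')\<^sup>2)"
      unfolding h2 K_def using C0 k assms by (simp add: power2_eq_square)
    finally show ?thesis by (simp add: F_def gram_def C_def C'_def S_def S'_def)
  qed
  finally show ?thesis .
qed

section \<open>Square integrability and totality of the vectors on an interval\<close>

definition half_cvec :: "real \<Rightarrow> real \<Rightarrow> real \<Rightarrow> real \<Rightarrow> complex" where
  "half_cvec a b t y = of_real (half_vec a b t y)"

lemma continuous_on_half_vec:
  assumes "0 < a" "0 < b" shows "continuous_on {0..b} (half_vec a b t)"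
proof -
  have "half_den a b t y \<noteq> 0" if "y \<in> {0..b}" for y using half_den_pos[OF assms, of y t] that by auto
  then show ?thesis
    unfolding half_vec_def[abs_def] by (intro continuous_intros) (auto simp: half_den_def[abs_def] intro!: continuous_intros)
qed

lemma half_cvec_L2:
  assumes "0 < a" "0 < b" shows "half_cvec a b t \<in> L2 (interval_lborel 0 b)"
proof -
  have "set_integrable lborel {0..b} (\<lambda>y. (half_vec a b t y)\<^sup>2)"
    by (intro borel_integrable_atLeastAtMost' continuous_intros continuous_on_half_vec assms)
  then have "integrable (interval_lborel 0 b) (\<lambda>y. (half_vec a b t y)\<^sup>2)"
    by (subst integrable_restrict_space) (auto simp: set_integrable_def)
  moreover have "half_cvec a b t \<in> borel_measurable (interval_lborel 0 b)"
    unfolding half_cvec_def[abs_def] by (intro measurable_restrict_space1) measurable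
  ultimately show ?thesis by (simp add: L2_def half_cvec_def)
qed

lemma half_cvec_gram:
  assumes "0 < a" "0 < b"
  shows "L2_inner (interval_lborel 0 b) (half_cvec a b t) (half_cvec a b s) = of_real (gram t s)"
  unfolding L2_inner_def half_cvec_def half_vec_gram[OF assms, symmetric]
  by (simp flip: of_real_mult)

text \<open>Differentiation in the parameter \<open>p\<close> under the integral sign.\<close>

lemma integral_powr_zero_step:
  fixes f :: "real \<Rightarrow> complex"
  assumes ab: "0 < a" "0 < b" and f: "integrable lborel f" and f0: "\<And>y. y \<notin> {0..b} \<Longrightarrow> f y = 0"
    and \<alpha>: "\<alpha> < 0"
    and 0: "\<And>p. 0 < p \<Longrightarrow> (LINT y|lborel. of_real ((b * (a + y) + p * y) powr \<alpha>) * f y) = 0"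
    and p: "0 < p"
  shows "(LINT y|lborel. of_real (y * (b * (a + y) + p * y) powr (\<alpha> - 1)) * f y) = 0"
proof -
  have [measurable]: "f \<in> borel_measurable borel" using f by auto
  let ?B = "\<lambda>p y. b * (a + y) + p * y"
  have B: "a * b \<le> ?B p y" if "0 \<le> p" "0 \<le> y" for p y using ab that by (simp add: algebra_simps)
  have ab0: "0 < a * b" using ab by simp
  have i: "integrable lborel (\<lambda>y. of_real (?B p y powr \<alpha>) * f y)" if "0 \<le> p" for p
  proof (rule Bochner_Integration.integrable_bound)
    show "integrable lborel (\<lambda>y. (a * b) powr \<alpha> * norm (f y))" using f by auto
    show "AE y in lborel. norm (of_real (?B p y powr \<alpha>) * f y) \<le> norm ((a * b) powr \<alpha> * norm (f y))"
    proof (rule AE_I2)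
      fix y
      show "norm (of_real (?B p y powr \<alpha>) * f y) \<le> norm ((a * b) powr \<alpha> * norm (f y))"
      proof (cases "y \<in> {0..b}")
        case True
        then have "?B p y powr \<alpha> \<le> (a * b) powr \<alpha>"
          using B[OF that, of y] ab0 \<alpha> by (intro powr_mono2') auto
        then show ?thesis by (simp add: norm_mult mult_right_mono)
      qed (simp add: f0)
    qed
  qed measurable
  define h where "h j = inverse (real (Suc j))" for j
  have h: "0 < h j" for j by (simp add: h_def)
  \<comment> \<open>Difference quotients in the parameter. The mean value theorem bounds them
    uniformly, because the base of the power never drops below \<open>a * b\<close>.\<close>
  define g where "g j y = (?B (p + h j) y powr \<alpha> - ?B p y powr \<alpha>) / h j" for j y
  have gm [measurable]: "g j \<in> borel_measurable borel" for j unfolding g_def[abs_def] by measurable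
  have g_int: "(LINT y|lborel. of_real (g j y) * f y) = 0" for j
  proof -
    have "(LINT y|lborel. of_real (g j y) * f y)
      = (LINT y|lborel. (of_real (?B (p + h j) y powr \<alpha>) * f y - of_real (?B p y powr \<alpha>) * f y) / of_real (h j))"
      by (simp add: g_def left_diff_distrib)
    also have "\<dots> = 0"
      using i[of "p + h j"] i[of p] 0[of "p + h j"] 0[of p] p h[of j] by simp
    finally show ?thesis .
  qed
  have D: "((\<lambda>p. ?B p y powr \<alpha>) has_real_derivative \<alpha> * y * ?B q y powr (\<alpha> - 1)) (at q)" if "0 \<le> q" "0 \<le> y" for q y
  proof -
    have "0 < ?B q y" using B[OF that] ab0 by linarith
    then show ?thesis by (auto intro!: derivative_eq_intros simp: mult_ac)
  qed
  have bound: "\<bar>g j y\<bar> \<le> \<bar>\<alpha>\<bar> * b * (a * b) powr (\<alpha> - 1)" if y: "0 \<le> y" "y \<le> b" for j y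
  proof -
    obtain z where z: "p < z" "z < p + h j"
      "?B (p + h j) y powr \<alpha> - ?B p y powr \<alpha> = (p + h j - p) * (\<alpha> * y * ?B z y powr (\<alpha> - 1))"
      using MVT2[of p "p + h j" "\<lambda>p. ?B p y powr \<alpha>" "\<lambda>q. \<alpha> * y * ?B q y powr (\<alpha> - 1)"] D p h[of j] y by auto
    then have "g j y = \<alpha> * y * ?B z y powr (\<alpha> - 1)" using h[of j] by (simp add: g_def)
    moreover have "?B z y powr (\<alpha> - 1) \<le> (a * b) powr (\<alpha> - 1)"
      using B[of z y] z p y ab0 \<alpha> by (intro powr_mono2') auto
    ultimately show ?thesis
      using y by (auto simp: abs_mult intro!: mult_mono)
  qed
  have "(\<lambda>j. LINT y|lborel. of_real (g j y) * f y) \<longlonglongrightarrow> (LINT y|lborel. of_real (\<alpha> * y * ?B p y powr (\<alpha> - 1)) * f y)"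
  proof (rule integral_dominated_convergence[where w = "\<lambda>y. \<bar>\<alpha>\<bar> * b * (a * b) powr (\<alpha> - 1) * norm (f y)"])
    show "AE y in lborel. (\<lambda>j. of_real (g j y) * f y) \<longlonglongrightarrow> of_real (\<alpha> * y * ?B p y powr (\<alpha> - 1)) * f y"
    proof (rule AE_I2)
      fix y
      show "(\<lambda>j. of_real (g j y) * f y) \<longlonglongrightarrow> of_real (\<alpha> * y * ?B p y powr (\<alpha> - 1)) * f y"
      proof (cases "y \<in> {0..b}")
        case True
        then have "((\<lambda>h. (?B (p + h) y powr \<alpha> - ?B p y powr \<alpha>) / h) \<longlongrightarrow> \<alpha> * y * ?B p y powr (\<alpha> - 1)) (at 0)"
          using D[of p y] p unfolding DERIV_def by auto
        moreover have "filterlim h (at 0) sequentially"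
          unfolding filterlim_at h_def using LIMSEQ_inverse_real_of_nat by auto
        ultimately have "(\<lambda>j. g j y) \<longlonglongrightarrow> \<alpha> * y * ?B p y powr (\<alpha> - 1)"
          unfolding g_def by (rule filterlim_compose)
        then show ?thesis by (intro tendsto_mult tendsto_of_real tendsto_const)
      qed (simp add: f0)
    qed
    show "AE y in lborel. norm (of_real (g j y) * f y) \<le> \<bar>\<alpha>\<bar> * b * (a * b) powr (\<alpha> - 1) * norm (f y)" for j
    proof (rule AE_I2)
      fix y
      show "norm (of_real (g j y) * f y) \<le> \<bar>\<alpha>\<bar> * b * (a * b) powr (\<alpha> - 1) * norm (f y)"
        using bound[of y j] by (cases "y \<in> {0..b}") (auto simp: f0 norm_mult intro!: mult_right_mono)
    qed
  qed (use f in auto)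
  then have "(LINT y|lborel. of_real (\<alpha> * y * ?B p y powr (\<alpha> - 1)) * f y) = 0"
    by (simp add: g_int LIMSEQ_const_iff)
  moreover have "(LINT y|lborel. of_real (\<alpha> * y * ?B p y powr (\<alpha> - 1)) * f y)
    = of_real \<alpha> * (LINT y|lborel. of_real (y * ?B p y powr (\<alpha> - 1)) * f y)"
    by (simp add: mult.assoc flip: integral_mult_right_zero)
  ultimately show ?thesis using \<alpha> by simp
qed

text \<open>Each differentiation in the parameter lowers the exponent by 1 and brings out a factor
  \<open>y\<close>. So the vanishing integrals for one exponent yield all moments in the quotient of
  \<open>y\<close> by the base of the power.\<close>

lemma integral_powr_zero_all:
  fixes f :: "real \<Rightarrow> complex"
  assumes ab: "0 < a" "0 < b" and f: "integrable lborel f" and f0: "\<And>y. y \<notin> {0..b} \<Longrightarrow> f y = 0"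
    and 0: "\<And>p. 0 < p \<Longrightarrow> (LINT y|lborel. of_real ((b * (a + y) + p * y) powr (- 3 / 2)) * f y) = 0"
    and p: "0 < p"
  shows "(LINT y|lborel. of_real (y ^ n * (b * (a + y) + p * y) powr (- 3 / 2 - real n)) * f y) = 0"
  using p
proof (induction n arbitrary: p)
  case 0
  then show ?case using \<open>\<And>p. 0 < p \<Longrightarrow> (LINT y|lborel. of_real ((b * (a + y) + p * y) powr (- 3 / 2)) * f y) = 0\<close> by simp
next
  case (Suc n)
  have [measurable]: "f \<in> borel_measurable borel" using f by auto
  have "(LINT y|lborel. of_real (y * (b * (a + y) + p * y) powr (- 3 / 2 - real n - 1)) * (of_real (y ^ n) * f y)) = 0"
  proof (rule integral_powr_zero_step[OF ab])
    show "integrable lborel (\<lambda>y. of_real (y ^ n) * f y)"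
    proof (rule Bochner_Integration.integrable_bound)
      show "integrable lborel (\<lambda>y. b ^ n * norm (f y))" using f by auto
      show "AE y in lborel. norm (of_real (y ^ n) * f y) \<le> norm (b ^ n * norm (f y))"
      proof (rule AE_I2)
        fix y
        show "norm (of_real (y ^ n) * f y) \<le> norm (b ^ n * norm (f y))"
          using ab by (cases "y \<in> {0..b}") (auto simp: f0 norm_mult norm_power intro!: mult_right_mono power_mono)
      qed
    qed measurable
    show "(LINT y|lborel. of_real ((b * (a + y) + p * y) powr (- 3 / 2 - real n)) * (of_real (y ^ n) * f y)) = 0" if "0 < p" for p
      using Suc.IH[OF that] by (simp add: mult_ac)
  qed (use f0 Suc.prems in auto)
  then show ?case by (simp add: mult_ac diff_diff_eq add.commute)
qed

lemma half_vec_orthogonal_imp_0: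
  fixes f :: "real \<Rightarrow> complex"
  assumes ab: "0 < a" "0 < b" and f: "integrable lborel f" and f0: "\<And>y. y \<notin> {0..b} \<Longrightarrow> f y = 0"
    and orth: "\<And>t. (LINT y|lborel. of_real (half_vec a b t y) * f y) = 0"
  shows "AE y in lborel. f y = 0"
proof -
  have [measurable]: "f \<in> borel_measurable borel" using f by auto
  define F where "F y = of_real (sqrt y) * f y" for y
  have F: "integrable lborel F"
  proof (rule Bochner_Integration.integrable_bound)
    show "integrable lborel (\<lambda>y. sqrt b * norm (f y))" using f by auto
    show "AE y in lborel. norm (F y) \<le> norm (sqrt b * norm (f y))"
    proof (rule AE_I2)
      fix y show "norm (F y) \<le> norm (sqrt b * norm (f y))"
        using ab by (cases "y \<in> {0..b}") (auto simp: F_def f0 norm_mult intro!: mult_right_mono)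
    qed
  qed (simp add: F_def[abs_def])
  have "(LINT y|lborel. of_real ((b * (a + y) + p * y) powr (- 3 / 2)) * F y) = 0" if p: "0 < p" for p
  proof -
    \<comment> \<open>Every positive parameter \<open>p\<close> comes from an index:
      \<open>t\<close> solves \<open>(a + b) * (sinh (t / 2))\<^sup>2 = p\<close>.\<close>
    define t where "t = 2 * arsinh (sqrt (p / (a + b)))"
    have sh: "sinh (t / 2) = sqrt (p / (a + b))" by (simp add: t_def)
    then have s: "(a + b) * (sinh (t / 2))\<^sup>2 = p" "0 < sinh (t / 2)" using ab p by simp_all
    define c where "c = (a + b) * sqrt (a * b) / 2 * (sinh (t / 2) * cosh (t / 2))"
    have c0: "c \<noteq> 0" using ab s(2) cosh_real_pos[of "t / 2"] by (simp add: c_def)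
    have "of_real (half_vec a b t y) * f y = of_real c * (of_real ((b * (a + y) + p * y) powr (- 3 / 2)) * F y)" for y
    proof (cases "y \<in> {0..b}")
      case True
      then have d0: "0 < half_den a b t y" using half_den_pos[OF ab] by simp
      have d: "half_den a b t y = b * (a + y) + p * y" using half_den_alt(2)[of a b t y] s(1) by simp
      have "sqrt d ^ 3 = d powr (3 / 2)" if "0 < d" for d
        using that by (simp add: powr_half_sqrt[symmetric] powr_powr flip: powr_realpow)
      then have "half_vec a b t y = c * ((b * (a + y) + p * y) powr (- 3 / 2) * sqrt y)"
        using d0 unfolding half_vec_def c_def[symmetric] d by (simp add: powr_minus_divide)
      then show ?thesis by (simp add: F_def)
    qed (simp add: F_def f0)
    then have "of_real c * (LINT y|lborel. of_real ((b * (a + y) + p * y) powr (- 3 / 2)) * F y) = 0"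
      using orth[of t] by simp
    then show ?thesis using c0 by simp
  qed
  from integral_powr_zero_all[OF ab F _ this, of 1]
  have mom: "(LINT y|lborel. of_real (y ^ n * (b * (a + y) + y) powr (- 3 / 2 - real n)) * F y) = 0" for n
    by (simp add: F_def f0)
  \<comment> \<open>At parameter 1 the vanishing integrals are the moments of \<open>h\<close> under
    this function, which is strictly increasing on \<open>{0..b}\<close> because its denominator is
    affine in \<open>y\<close> with the positive constant term \<open>a * b\<close>.\<close>
  define m where "m y = indicator {0..b} y * (y / (b * (a + y) + y))" for y
  define h where "h y = of_real ((b * (a + y) + y) powr (- 3 / 2)) * F y" for y
  have [measurable]: "m \<in> borel_measurable borel" unfolding m_def[abs_def] by measurable
  have B: "0 < b * (a + y) + y" if "0 \<le> y" for y using ab that by (simp add: add_pos_nonneg)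
  have "AE y in lborel. h y = 0"
  proof (rule moments_zero_increasing_imp_AE_zero[where m = m and S = "{0..b}"])
    show "integrable lborel h"
    proof (rule Bochner_Integration.integrable_bound)
      show "integrable lborel (\<lambda>y. (a * b) powr (- 3 / 2) * norm (F y))" using F by auto
      show "AE y in lborel. norm (h y) \<le> norm ((a * b) powr (- 3 / 2) * norm (F y))"
      proof (rule AE_I2)
        fix y
        show "norm (h y) \<le> norm ((a * b) powr (- 3 / 2) * norm (F y))"
        proof (cases "y \<in> {0..b}")
          case True
          then have "(b * (a + y) + y) powr (- 3 / 2) \<le> (a * b) powr (- 3 / 2)"
            using ab by (intro powr_mono2') (auto simp: algebra_simps)
          then show ?thesis by (simp add: h_def norm_mult mult_right_mono)
        qed (simp add: h_def F_def f0)
      qed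
    qed (simp add: h_def[abs_def] F_def)
    show "0 \<le> m y \<and> m y \<le> 1" for y
      using B[of y] ab by (auto simp: m_def divide_le_eq_1 split: split_indicator)
    show "strict_mono_on {0..b} m"
    proof (rule strict_mono_onI)
      fix x y assume *: "x \<in> {0..b}" "y \<in> {0..b}" "x < y"
      have "x * (a * b) < y * (a * b)" using * ab by simp
      then have "x * (b * (a + y) + y) < y * (b * (a + x) + x)" by (simp add: algebra_simps)
      then show "m x < m y" using * B[of x] B[of y] by (simp add: m_def divide_less_eq pos_less_divide_eq mult_ac)
    qed
    show "(LINT y|lborel. of_real (m y ^ n) * h y) = 0" for n
    proof -
      have "of_real (m y ^ n) * h y = of_real (y ^ n * (b * (a + y) + y) powr (- 3 / 2 - real n)) * F y" for y
      proof (cases "y \<in> {0..b}")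
        case True
        then have "(b * (a + y) + y) powr (- 3 / 2 - real n) = (b * (a + y) + y) powr (- 3 / 2) / (b * (a + y) + y) ^ n"
          using B[of y] by (simp add: powr_diff powr_realpow)
        then show ?thesis using True by (simp add: m_def h_def power_divide)
      qed (simp add: h_def F_def f0)
      then show ?thesis using mom[of n] by simp
    qed
  qed (auto simp: h_def F_def f0)
  then show ?thesis
    using AE_lborel_singleton[of 0]
  proof eventually_elim
    case (elim y)
    show ?case
    proof (cases "y \<in> {0..b}")
      case True
      then have "0 < (b * (a + y) + y) powr (- 3 / 2)" "0 < sqrt y" using B[of y] elim by auto
      then show ?thesis using elim(1) by (simp add: h_def F_def)
    qed (simp add: f0)
  qed
qed

lemma total_family_half_cvec:
  assumes ab: "0 < a" "0 < b"
  shows "total_family (interval_lborel 0 b) (half_cvec a b)"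
  unfolding total_family_def
proof (intro conjI allI ballI impI half_cvec_L2 ab)
  let ?M = "interval_lborel 0 b"
  fix f assume f: "f \<in> L2 ?M" and 0: "\<forall>t. L2_inner ?M f (half_cvec a b t) = 0"
  define g where "g y = indicator {0..b} y *\<^sub>R f y" for y
  have "finite_measure ?M"
    by (rule finite_measureI) (use ab in \<open>simp add: emeasure_restrict_space space_restrict_space\<close>)
  then have one: "(\<lambda>x. 1) \<in> L2 ?M" by (simp add: L2_def finite_measure.integrable_const)
  have "AE y in lborel. g y = 0"
  proof (rule half_vec_orthogonal_imp_0[OF ab])
    show "integrable lborel g"
      using L2_mult_integrable[OF f one] unfolding g_def by (subst (asm) integrable_restrict_space) auto
    show "(LINT y|lborel. of_real (half_vec a b t y) * g y) = 0" for t
    proof -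
      have "0 = (LINT y|?M. f y * cnj (half_cvec a b t y))" using 0 by (simp add: L2_inner_def)
      also have "\<dots> = (LINT y|lborel. of_real (half_vec a b t y) * g y)"
        by (subst integral_restrict_space) (auto simp: g_def half_cvec_def scaleR_conv_of_real mult_ac)
      finally show ?thesis by simp
    qed
  qed (simp add: g_def)
  then show "AE y in ?M. f y = 0"
    by (subst AE_restrict_space_iff) (auto simp: g_def elim: eventually_mono)
qed

section \<open>The action of the finite Hilbert transforms\<close>

lemma half_vec_minus: "half_vec a b (- t) y = - half_vec a b t y"
  by (simp add: half_vec_def half_den_def)

text \<open>For \<open>y\<close> in the interval, \<open>half_den\<close> is at least
  \<open>(a + b) * y * (cosh (t / 2))\<^sup>2\<close>, so the denominator contributes a cube of
  \<open>cosh\<close> that absorbs the product of \<open>sinh\<close> and \<open>cosh\<close>.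
  Uniformity in \<open>t\<close> makes the averages over the index converge.\<close>

lemma half_vec_index_bounded:
  assumes ab: "0 < a" "0 < b" and y: "0 < y" "y \<le> b"
  shows "\<bar>half_vec a b t y\<bar> \<le> (a + b) * sqrt (a * b) / 2 * (sqrt y / sqrt ((a + b) * y) ^ 3)"
proof -
  define C S where "C = cosh (t / 2)" and "S = sinh (t / 2)"
  have C: "1 \<le> C" by (simp add: C_def cosh_real_ge_1)
  have SC: "\<bar>S\<bar> \<le> C" unfolding S_def C_def
    by (rule power2_le_imp_le) (auto simp: cosh_square_eq cosh_real_nonneg)
  have pos: "0 < sqrt ((a + b) * y)" using ab y by simp
  have "0 \<le> a * (b - y)" using ab y by simp
  then have "(a + b) * y * C\<^sup>2 \<le> half_den a b t y" unfolding half_den_alt(1) C_def by (simp add: mult_ac)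
  then have "sqrt ((a + b) * y * C\<^sup>2) \<le> sqrt (half_den a b t y)" by simp
  then have "sqrt ((a + b) * y) * C \<le> sqrt (half_den a b t y)" using C by (simp add: real_sqrt_mult)
  then have "(sqrt ((a + b) * y) * C) ^ 3 \<le> sqrt (half_den a b t y) ^ 3"
    using pos C by (intro power_mono) auto
  moreover have "sqrt ((a + b) * y) ^ 3 * (\<bar>S\<bar> * C) \<le> (sqrt ((a + b) * y) * C) ^ 3"
  proof -
    have "\<bar>S\<bar> * C \<le> C * C" using SC C by (intro mult_right_mono) auto
    also have "\<dots> \<le> C ^ 3" using C by (simp add: power3_eq_cube mult_left_mono)
    finally show ?thesis using pos by (simp add: power_mult_distrib)
  qed
  ultimately have le: "sqrt ((a + b) * y) ^ 3 * (\<bar>S\<bar> * C) \<le> sqrt (half_den a b t y) ^ 3" by linarith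
  have dpos: "0 < sqrt (half_den a b t y) ^ 3" using half_den_pos[OF ab, of y t] y by simp
  have "(\<bar>S\<bar> * C) / sqrt (half_den a b t y) ^ 3 \<le> 1 / sqrt ((a + b) * y) ^ 3"
    using le dpos pos by (simp add: divide_simps mult.commute)
  then have "((a + b) * sqrt (a * b) / 2 * sqrt y) * ((\<bar>S\<bar> * C) / sqrt (half_den a b t y) ^ 3)
    \<le> ((a + b) * sqrt (a * b) / 2 * sqrt y) * (1 / sqrt ((a + b) * y) ^ 3)"
    using ab y by (intro mult_left_mono) auto
  moreover have "\<bar>half_vec a b t y\<bar> = ((a + b) * sqrt (a * b) / 2 * sqrt y) * ((\<bar>S\<bar> * C) / sqrt (half_den a b t y) ^ 3)"
    using ab y C half_den_pos[OF ab, of y t] by (simp add: half_vec_def S_def C_def abs_mult mult_ac)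
  ultimately show ?thesis by (simp add: mult_ac)
qed

lemma integrable_kernel_half_vec:
  assumes ab: "0 < a" "0 < b" and y: "0 < y" "y \<le> b"
  shows "integrable lborel (\<lambda>x. sech_kernel (x - t) * half_vec a b x y)"
proof (rule Bochner_Integration.integrable_bound)
  define K where "K = (a + b) * sqrt (a * b) / 2 * (sqrt y / sqrt ((a + b) * y) ^ 3)"
  have K: "\<bar>half_vec a b x y\<bar> \<le> K" for x unfolding K_def by (rule half_vec_index_bounded[OF ab y])
  show "integrable lborel (\<lambda>x. sech_kernel (x - t) * K)"
    using shifted_sech_kernel(1) by (intro integrable_mult_left)
  show "AE x in lborel. norm (sech_kernel (x - t) * half_vec a b x y) \<le> norm (sech_kernel (x - t) * K)"
  proof (rule AE_I2)
    fix x
    have "0 \<le> K" using K[of x] by linarith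
    then show "norm (sech_kernel (x - t) * half_vec a b x y) \<le> norm (sech_kernel (x - t) * K)"
      using K[of x] sech_kernel_pos[of "x - t"] by (simp add: abs_mult)
  qed
  have [measurable]: "(\<lambda>x. half_vec a b x y) \<in> borel_measurable borel"
    using measurable_compose[OF _ half_vec_measurable, of "\<lambda>x. (x, y)" borel a b] by simp
  show "(\<lambda>x. sech_kernel (x - t) * half_vec a b x y) \<in> borel_measurable lborel" by measurable
qed

text \<open>The substitution \<open>y = b s w\<^sup>2 / (C\<^sup>2 (b + s) + s w\<^sup>2)\<close> with \<open>w = sinh (x / 2)\<close> and
  \<open>C = cosh (t / 2)\<close> turns the integral over \<open>(0, b)\<close> into one over the index \<open>x\<close>.\<close>

lemma substitution_algebra:
  fixes a b s C w c1 :: real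
  assumes ab: "0 < a" "0 < b" "0 < s" "0 < C" "0 < w"
  defines "Z \<equiv> C\<^sup>2 * (b + s) + s * w\<^sup>2" and "D' \<equiv> a * (b + s) + (a + b) * w\<^sup>2 * s"
  defines "y \<equiv> b * s * w\<^sup>2 / Z"
  shows "sqrt y / sqrt (a * b + ((a + b) * C\<^sup>2 - a) * y) ^ 3 / (y + s) * (b * s * w * c1 * C\<^sup>2 * (b + s) / Z\<^sup>2)
    = sqrt s * w\<^sup>2 * c1 / (C * sqrt D' ^ 3 * (C\<^sup>2 + w\<^sup>2))"
proof -
  have Z: "0 < Z" and D': "0 < D'" unfolding Z_def D'_def using ab by (simp_all add: add_pos_pos)
  have bs: "0 < b + s" and Cw: "0 < C\<^sup>2 + w\<^sup>2" using ab by (simp_all add: add_pos_pos)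
  have Dy: "a * b + ((a + b) * C\<^sup>2 - a) * y = b * C\<^sup>2 * D' / Z"
  proof -
    have "(a * b + ((a + b) * C\<^sup>2 - a) * y) * Z = a * b * Z + ((a + b) * C\<^sup>2 - a) * (b * s * w\<^sup>2)"
      using Z by (simp add: y_def algebra_simps)
    also have "\<dots> = b * C\<^sup>2 * D'" by (simp add: Z_def D'_def algebra_simps)
    finally show ?thesis using Z by (simp add: field_simps)
  qed
  have ys: "y + s = s * (b + s) * (C\<^sup>2 + w\<^sup>2) / Z"
  proof -
    have "(y + s) * Z = b * s * w\<^sup>2 + s * Z" using Z by (simp add: y_def distrib_right)
    also have "\<dots> = s * (b + s) * (C\<^sup>2 + w\<^sup>2)" by (simp add: Z_def algebra_simps)
    finally show ?thesis using Z by (simp add: field_simps)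
  qed
  define rb rs rZ rD where "rb = sqrt b" and "rs = sqrt s" and "rZ = sqrt Z" and "rD = sqrt D'"
  have r: "0 < rb" "0 < rs" "0 < rZ" "0 < rD" using ab Z D' by (simp_all add: rb_def rs_def rZ_def rD_def)
  have sq: "b = rb\<^sup>2" "s = rs\<^sup>2" "Z = rZ\<^sup>2" using ab Z by (simp_all add: rb_def rs_def rZ_def)
  have 1: "sqrt y = rb * rs * w / rZ"
    using ab by (simp add: y_def real_sqrt_divide real_sqrt_mult rb_def rs_def rZ_def)
  have 2: "sqrt (b * C\<^sup>2 * D' / Z) = rb * C * rD / rZ"
    using ab by (simp add: real_sqrt_divide real_sqrt_mult rb_def rD_def rZ_def)
  have "sqrt y / sqrt (a * b + ((a + b) * C\<^sup>2 - a) * y) ^ 3 / (y + s) * (b * s * w * c1 * C\<^sup>2 * (b + s) / Z\<^sup>2)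
    = (rb * rs * w / rZ) / (rb * C * rD / rZ) ^ 3 / (s * (b + s) * (C\<^sup>2 + w\<^sup>2) / Z) * (b * s * w * c1 * C\<^sup>2 * (b + s) / Z\<^sup>2)"
    unfolding Dy ys 1 2 ..
  also have "\<dots> = rs * w\<^sup>2 * c1 / (C * rD ^ 3 * (C\<^sup>2 + w\<^sup>2))"
  proof -
    have "(rb * rs * w / rZ) / (rb * C * rD / rZ) ^ 3 / (rs\<^sup>2 * B * G / rZ\<^sup>2) * (rb\<^sup>2 * rs\<^sup>2 * w * c1 * C\<^sup>2 * B / (rZ\<^sup>2)\<^sup>2)
      = rs * w\<^sup>2 * c1 / (C * rD ^ 3 * G)" if "B \<noteq> 0" "G \<noteq> 0" for B G
      using r ab(4) that by (simp add: power2_eq_square power3_eq_cube divide_simps)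
    moreover have "b + s \<noteq> 0" "C\<^sup>2 + w\<^sup>2 \<noteq> 0" using bs Cw by linarith+
    ultimately show ?thesis unfolding sq[symmetric] by blast
  qed
  finally show ?thesis by (simp add: rs_def rD_def)
qed

text \<open>\<open>half_vec\<close> is odd in its index, so its averages see only this difference of
  kernels; the closed form supplies the factor \<open>1 / (C\<^sup>2 + w\<^sup>2)\<close> that the
  substitution produces.\<close>

lemma sech_kernel_difference:
  "sech_kernel (x - t) - sech_kernel (x + t)
    = sinh (t / 2) * sinh (x / 2) / (pi * ((cosh (t / 2))\<^sup>2 + (sinh (x / 2))\<^sup>2))"
proof -
  define p q where "p = x / 2" and "q = t / 2"
  have e: "(x - t) / 2 = p - q" "(x + t) / 2 = p + q" by (simp_all add: p_def q_def field_simps)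
  have c: "cosh (p - q) > 0" "cosh (p + q) > 0" by (simp_all add: cosh_real_pos)
  have "cosh (p - q) * cosh (p + q) = (cosh q)\<^sup>2 + (sinh p)\<^sup>2"
  proof -
    have "cosh (p - q) * cosh (p + q) = (cosh p)\<^sup>2 * (cosh q)\<^sup>2 - (sinh p)\<^sup>2 * (sinh q)\<^sup>2"
      by (simp add: cosh_add cosh_diff power2_eq_square algebra_simps)
    then show ?thesis by (simp add: cosh_square_eq algebra_simps)
  qed
  moreover have "cosh (p + q) - cosh (p - q) = 2 * (sinh q * sinh p)" by (simp add: cosh_add cosh_diff)
  moreover have "1 / (2 * pi * A) - 1 / (2 * pi * B) = (B - A) / (2 * pi * (A * B))" if "0 < A" "0 < B" for A B
    using that by (simp add: field_simps)
  ultimately show ?thesis using c by (simp add: sech_kernel_def e p_def[symmetric] q_def[symmetric])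
qed

text \<open>The left side is a transform evaluated at the point \<open>- s\<close> of the
  neighbouring interval, whose reflected family is \<open>half_vec b a\<close>. The substitution
  carries the index line, folded at 0, monotonically onto (0, b).\<close>

lemma stieltjes_half_vec:
  assumes ab: "0 < a" "0 < b" and s: "0 < s" "s \<le> a"
  shows "(LINT y|interval_lborel 0 b. half_vec a b t y / (y + s)) / pi
    = (LINT x|lborel. sech_kernel (x - t) * half_vec b a x s)"
proof (cases "t = 0")
  \<comment> \<open>Both sides vanish here, the right one by oddness; the other case divides by
    \<open>sinh (t / 2)\<close>.\<close>
  case True
  have half0: "half_vec a b 0 y = 0" for y by (simp add: half_vec_def)
  have "(LINT x|lborel. sech_kernel x * half_vec b a x s) = (LINT x|lborel. sech_kernel (- x) * half_vec b a (- x) s)"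
    using lborel_integral_real_affine[of "-1" "\<lambda>x. sech_kernel x * half_vec b a x s" 0] by simp
  then have "(LINT x|lborel. sech_kernel x * half_vec b a x s) = 0"
    by (simp add: sech_kernel_minus half_vec_minus)
  then show ?thesis by (simp add: True half0)
next
  case False
  define C S where "C = cosh (t / 2)" and "S = sinh (t / 2)"
  have C: "0 < C" and S: "S \<noteq> 0" using False by (simp_all add: C_def S_def cosh_real_pos)
  define c0 where "c0 = (a + b) * sqrt (a * b) / 2"
  have c0: "0 < c0" using ab by (simp add: c0_def)
  define Z where "Z x = C\<^sup>2 * (b + s) + s * (sinh (x / 2))\<^sup>2" for x
  have Z: "0 < Z x" for x unfolding Z_def using C ab s by (simp add: add_pos_nonneg)
  define g where "g x = b * s * (sinh (x / 2))\<^sup>2 / Z x" for x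
  define g' where "g' x = b * s * sinh (x / 2) * cosh (x / 2) * C\<^sup>2 * (b + s) / (Z x)\<^sup>2" for x
  define f where "f y = sqrt y / sqrt (half_den a b t y) ^ 3 / (y + s)" for y
  define \<psi> where "\<psi> x = sech_kernel (x - t) * half_vec b a x s" for x
  \<comment> \<open>Up to a constant, the substituted integrand is the folded one: adding
    \<open>\<psi> (- x)\<close> combines the kernels at \<open>x - t\<close> and
    \<open>x + t\<close>.\<close>
  have fg: "c0 * S * C / pi * (f (g x) * g' x) = \<psi> x + \<psi> (- x)" if "0 < x" for x
  proof -
    have w: "0 < sinh (x / 2)" using that by simp
    have D': "half_den b a x s = a * (b + s) + (a + b) * (sinh (x / 2))\<^sup>2 * s"
      unfolding half_den_alt(2) by (simp add: add.commute)
    have "f (g x) * g' x = sqrt s * (sinh (x / 2))\<^sup>2 * cosh (x / 2)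
        / (C * sqrt (half_den b a x s) ^ 3 * (C\<^sup>2 + (sinh (x / 2))\<^sup>2))"
      using substitution_algebra[OF ab s(1) C w, of "cosh (x / 2)"]
      unfolding f_def g_def g'_def Z_def D' half_den_def[of a b] C_def[symmetric] by simp
    moreover have "\<psi> x + \<psi> (- x) = (sech_kernel (x - t) - sech_kernel (x + t)) * half_vec b a x s"
      using sech_kernel_minus[of "x + t"] by (simp add: \<psi>_def half_vec_minus left_diff_distrib)
    moreover have "c0 * S * C / pi * (sqrt s * w\<^sup>2 * c1 / (C * D * G)) = S * w / (pi * G) * (c0 * (w * c1) * (sqrt s / D))" for w c1 D G
      using C by (simp add: power2_eq_square mult_ac)
    moreover have "half_vec b a x s = c0 * (sinh (x / 2) * cosh (x / 2)) * (sqrt s / sqrt (half_den b a x s) ^ 3)"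
      by (simp add: half_vec_def c0_def add.commute mult.commute)
    ultimately show ?thesis
      unfolding sech_kernel_difference C_def[symmetric] S_def[symmetric] by simp
  qed
  have \<psi>: "integrable lborel \<psi>"
    unfolding \<psi>_def by (rule integrable_kernel_half_vec[OF ab(2,1) s])
  have \<psi>m: "integrable lborel (\<lambda>x. \<psi> (- x))" using lborel_integrable_real_affine[OF \<psi>, of "-1" 0] by simp
  have "(LINT x|lborel. \<psi> x) = (LINT x|lborel. indicator {0<..} x *\<^sub>R (\<psi> x + \<psi> (- x)))"
  proof -
    have i: "integrable lborel (\<lambda>x. indicator {0<..} x *\<^sub>R \<psi> x)" "integrable lborel (\<lambda>x. indicator {..<0} x *\<^sub>R \<psi> x)"
      "integrable lborel (\<lambda>x. indicator {0<..} x *\<^sub>R \<psi> (- x))"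
      by (intro integrable_mult_indicator \<psi> \<psi>m; simp)+
    have "(LINT x|lborel. \<psi> x) = (LINT x|lborel. indicator {0<..} x *\<^sub>R \<psi> x + indicator {..<0} x *\<^sub>R \<psi> x)"
      by (rule integral_cong_AE)
        (use \<psi> i AE_lborel_singleton[of "0::real"] in \<open>auto elim!: eventually_mono split: split_indicator\<close>)
    also have "\<dots> = (LINT x|lborel. indicator {0<..} x *\<^sub>R \<psi> x) + (LINT x|lborel. indicator {..<0} x *\<^sub>R \<psi> x)"
      by (rule Bochner_Integration.integral_add[OF i(1,2)])
    also have "(LINT x|lborel. indicator {..<0} x *\<^sub>R \<psi> x) = (LINT x|lborel. indicator {0<..} x *\<^sub>R \<psi> (- x))"
      using lborel_integral_real_affine[of "-1" "\<lambda>x. indicator {..<0} x *\<^sub>R \<psi> x" 0]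
      by (simp add: indicator_def)
    also have "(LINT x|lborel. indicator {0<..} x *\<^sub>R \<psi> x) + (LINT x|lborel. indicator {0<..} x *\<^sub>R \<psi> (- x))
      = (LINT x|lborel. indicator {0<..} x *\<^sub>R \<psi> x + indicator {0<..} x *\<^sub>R \<psi> (- x))"
      by (rule Bochner_Integration.integral_add[OF i(1,3), symmetric])
    finally show ?thesis by (simp add: distrib_left)
  qed
  also have "\<dots> = (LINT x|lborel. c0 * S * C / pi * (indicator {0<..} x *\<^sub>R (f (g x) * g' x)))"
    by (intro Bochner_Integration.integral_cong) (auto simp: fg[symmetric] split: split_indicator)
  also have "\<dots> = c0 * S * C / pi * (LINT x|lborel. indicator {0<..} x *\<^sub>R (f (g x) * g' x))" by simp
  also have "(LINT x|lborel. indicator {0<..} x *\<^sub>R (f (g x) * g' x)) = (LINT y|lborel. indicator {0<..<b} y *\<^sub>R f y)"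
  proof -
    have int: "set_integrable lborel {0<..} (\<lambda>x. f (g x) * g' x)"
    proof -
      have "integrable lborel (\<lambda>x. pi / (c0 * S * C) * (indicator {0<..} x *\<^sub>R (\<psi> x + \<psi> (- x))))"
        using \<psi> \<psi>m by (intro integrable_mult_right integrable_mult_indicator Bochner_Integration.integrable_add) auto
      moreover have "pi / (c0 * S * C) * (indicator {0<..} x *\<^sub>R (\<psi> x + \<psi> (- x))) = indicator {0<..} x *\<^sub>R (f (g x) * g' x)" for x
        using fg[of x, symmetric] c0 S C by (auto split: split_indicator)
      ultimately show ?thesis by (simp add: set_integrable_def)
    qed
    have gpos: "0 < g x" if "0 < x" for x using that ab s Z[of x] by (simp add: g_def)
    have "(LBINT y=ereal 0..ereal b. f y) = (LBINT x=ereal 0..\<infinity>. f (g x) * g' x)"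
    proof (rule interval_integral_substitution_nonneg(2))
      fix x assume x: "ereal 0 < ereal x"
      then have x0: "0 < x" by simp
      have "(Z has_real_derivative s * (sinh (x / 2) * cosh (x / 2))) (at x)"
        unfolding Z_def by (auto intro!: derivative_eq_intros)
      moreover have "((\<lambda>x. b * s * (sinh (x / 2))\<^sup>2) has_real_derivative b * s * (sinh (x / 2) * cosh (x / 2))) (at x)"
        by (auto intro!: derivative_eq_intros)
      ultimately have "(g has_real_derivative (b * s * (sinh (x / 2) * cosh (x / 2)) * Z x
          - b * s * (sinh (x / 2))\<^sup>2 * (s * (sinh (x / 2) * cosh (x / 2)))) / (Z x * Z x)) (at x)"
        unfolding g_def using Z[of x] by (intro DERIV_divide) auto
      moreover have "b * s * (sinh (x / 2) * cosh (x / 2)) * Z x - b * s * (sinh (x / 2))\<^sup>2 * (s * (sinh (x / 2) * cosh (x / 2)))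
        = b * s * sinh (x / 2) * cosh (x / 2) * C\<^sup>2 * (b + s)"
        by (simp add: Z_def algebra_simps)
      ultimately show "(g has_real_derivative g' x) (at x)" by (simp add: g'_def power2_eq_square)
      have "0 < half_den a b t (g x)" using half_den_pos[OF ab, of "g x" t] gpos[OF x0] by simp
      then show "isCont f (g x)"
        unfolding f_def half_den_def using gpos[OF x0] s by (intro continuous_intros) (auto simp: half_den_def)
      have "Z x \<noteq> 0" using Z[of x] by simp
      then show "isCont g' x" unfolding g'_def Z_def by (intro continuous_intros) auto
      show "0 \<le> f (g x)"
        unfolding f_def using gpos[OF x0] s half_den_pos[OF ab, of "g x" t] by simp
    next
      fix x assume "ereal 0 \<le> ereal x"
      then show "0 \<le> g' x" unfolding g'_def using ab s by (simp add: cosh_real_nonneg)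
    next
      have "(g \<longlongrightarrow> g 0) (at_right 0)"
      proof -
        have "isCont Z 0" unfolding Z_def by (intro continuous_intros) auto
        moreover have "Z 0 \<noteq> 0" using Z[of 0] by linarith
        ultimately have "isCont g 0" unfolding g_def by (intro continuous_intros) auto
        then show ?thesis by (simp add: continuous_within isCont_def filterlim_at_split)
      qed
      moreover have "g 0 = 0" by (simp add: g_def)
      ultimately have "((\<lambda>x. ereal (g x)) \<longlongrightarrow> ereal 0) (at_right 0)" by simp
      then show "((ereal \<circ> g \<circ> real_of_ereal) \<longlongrightarrow> ereal 0) (at_right (ereal 0))"
        unfolding ereal_tendsto_simps unfolding comp_def by simp
      have "filterlim (\<lambda>x::real. sinh (x / 2)) at_top at_top" by real_asymp
      then have "filterlim (\<lambda>x. s * (sinh (x / 2))\<^sup>2) at_top at_top"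
        using s by (intro filterlim_tendsto_pos_mult_at_top[OF tendsto_const] filterlim_pow_at_top) auto
      then have "filterlim Z at_top at_top" unfolding Z_def
        by (intro filterlim_tendsto_add_at_top[OF tendsto_const])
      then have "((\<lambda>x. b - b * C\<^sup>2 * (b + s) / Z x) \<longlongrightarrow> b - 0) at_top"
        by (intro tendsto_diff tendsto_const tendsto_divide_0[OF tendsto_const] filterlim_at_top_imp_at_infinity)
      moreover have "b - b * C\<^sup>2 * (b + s) / Z x = g x" for x
      proof -
        have "b * Z x = b * s * (sinh (x / 2))\<^sup>2 + b * C\<^sup>2 * (b + s)" by (simp add: Z_def algebra_simps)
        then show ?thesis using Z[of x] by (simp add: g_def field_simps)
      qed
      ultimately have "(g \<longlongrightarrow> b) at_top" by simp
      then have "((\<lambda>x. ereal (g x)) \<longlongrightarrow> ereal b) at_top" by simp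
      then show "((ereal \<circ> g \<circ> real_of_ereal) \<longlongrightarrow> ereal b) (at_left \<infinity>)"
        unfolding ereal_tendsto_simps unfolding comp_def by simp
    qed (use int in auto)
    then show ?thesis
      using ab by (simp add: interval_lebesgue_integral_def set_lebesgue_integral_def)
  qed
  also have "c0 * S * C / pi * (LINT y|lborel. indicator {0<..<b} y *\<^sub>R f y)
    = (LINT y|interval_lborel 0 b. half_vec a b t y / (y + s)) / pi"
  proof -
    have "(LINT y|interval_lborel 0 b. half_vec a b t y / (y + s)) = (LINT y|lborel. indicator {0..b} y *\<^sub>R (half_vec a b t y / (y + s)))"
      by (subst integral_restrict_space) auto
    also have "\<dots> = (LINT y|lborel. c0 * S * C * (indicator {0<..<b} y *\<^sub>R f y))"
    proof (rule integral_cong_AE)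
      show "AE y in lborel. indicator {0..b} y *\<^sub>R (half_vec a b t y / (y + s)) = c0 * S * C * (indicator {0<..<b} y *\<^sub>R f y)"
        using AE_lborel_singleton[of "0::real"] AE_lborel_singleton[of b]
        by eventually_elim (auto simp: half_vec_def f_def c0_def C_def S_def mult_ac split: split_indicator)
      show "(\<lambda>y. indicator {0..b} y *\<^sub>R (half_vec a b t y / (y + s))) \<in> borel_measurable lborel" by measurable
      show "(\<lambda>y. c0 * S * C * (indicator {0<..<b} y *\<^sub>R f y)) \<in> borel_measurable lborel"
        unfolding f_def half_den_def by measurable
    qed
    finally show ?thesis by simp
  qed
  finally show ?thesis by (simp add: \<psi>_def)
qed

section \<open>Reflection, measurability and square integrability on the intervals\<close>

lemma finite_measure_interval_lborel: "finite_measure (interval_lborel p q)"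
  by (rule finite_measureI) (simp add: emeasure_restrict_space space_restrict_space emeasure_lborel_Icc_eq)

lemma sigma_finite_interval_lborel: "sigma_finite_measure (interval_lborel p q)"
proof -
  interpret finite_measure "interval_lborel p q" by (rule finite_measure_interval_lborel)
  show ?thesis ..
qed

lemma L2_interval_lborel_bounded:
  assumes "f \<in> borel_measurable (interval_lborel p q)" "\<And>x. x \<in> {p..q} \<Longrightarrow> cmod (f x) \<le> C"
  shows "f \<in> L2 (interval_lborel p q)"
proof -
  interpret finite_measure "interval_lborel p q" by (rule finite_measure_interval_lborel)
  have "(\<lambda>x. 1) \<in> L2 (interval_lborel p q)" by (simp add: L2_def)
  from L2_bounded_mult[OF this assms(1), of C] assms(2) show ?thesis
    by (simp add: space_restrict_space)
qed

lemma integral_interval_lborel_reflect: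
  fixes f :: "real \<Rightarrow> 'a :: {banach, second_countable_topology}"
  shows "(LINT x|interval_lborel (- c) 0. f x) = (LINT x|interval_lborel 0 c. f (- x))"
proof -
  have "(LINT x|lborel. indicator {- c..0} x *\<^sub>R f x) = (LINT x|lborel. indicator {- c..0} (- x) *\<^sub>R f (- x))"
    using lborel_integral_real_affine[of "-1" "\<lambda>x. indicator {- c..0} x *\<^sub>R f x" 0] by simp
  also have "\<dots> = (LINT x|lborel. indicator {0..c} x *\<^sub>R f (- x))"
    by (intro Bochner_Integration.integral_cong) (auto split: split_indicator)
  finally show ?thesis by (simp add: integral_restrict_space)
qed

lemma integrable_interval_lborel_reflect:
  fixes f :: "real \<Rightarrow> 'a :: {banach, second_countable_topology}"
  shows "integrable (interval_lborel (- c) 0) f \<longleftrightarrow> integrable (interval_lborel 0 c) (\<lambda>x. f (- x))"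
proof -
  have "integrable lborel (\<lambda>x. indicator {- c..0} x *\<^sub>R f x) \<longleftrightarrow> integrable lborel (\<lambda>x. indicator {- c..0} (- x) *\<^sub>R f (- x))"
    using lborel_integrable_real_affine_iff[of "-1" "\<lambda>x. indicator {- c..0} x *\<^sub>R f x" 0] by simp
  also have "(\<lambda>x. indicator {- c..0} (- x) *\<^sub>R f (- x)) = (\<lambda>x. indicator {0..c} x *\<^sub>R f (- x))"
    by (auto simp: fun_eq_iff split: split_indicator)
  finally show ?thesis by (simp add: integrable_restrict_space)
qed

lemma measurable_interval_lborel_reflect:
  "f \<in> borel_measurable (interval_lborel (- c) 0) \<Longrightarrow> (\<lambda>x. f (- x)) \<in> borel_measurable (interval_lborel 0 c)"
  "f \<in> borel_measurable (interval_lborel 0 c) \<Longrightarrow> (\<lambda>x. f (- x)) \<in> borel_measurable (interval_lborel (- c) 0)"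
proof -
  have "uminus \<in> measurable (interval_lborel 0 c) (interval_lborel (- c) 0)"
    "uminus \<in> measurable (interval_lborel (- c) 0) (interval_lborel 0 c)"
    by (rule measurable_restrict_space3; auto)+
  then show "f \<in> borel_measurable (interval_lborel (- c) 0) \<Longrightarrow> (\<lambda>x. f (- x)) \<in> borel_measurable (interval_lborel 0 c)"
    "f \<in> borel_measurable (interval_lborel 0 c) \<Longrightarrow> (\<lambda>x. f (- x)) \<in> borel_measurable (interval_lborel (- c) 0)"
    using measurable_compose by blast+
qed

lemma L2_interval_lborel_reflect:
  "f \<in> L2 (interval_lborel (- c) 0) \<Longrightarrow> (\<lambda>x. f (- x)) \<in> L2 (interval_lborel 0 c)"
  "f \<in> L2 (interval_lborel 0 c) \<Longrightarrow> (\<lambda>x. f (- x)) \<in> L2 (interval_lborel (- c) 0)"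
  using measurable_interval_lborel_reflect
  by (auto simp: L2_def integrable_interval_lborel_reflect)

lemma total_family_reflect:
  assumes "total_family (interval_lborel 0 c) a"
  shows "total_family (interval_lborel (- c) 0) (\<lambda>t x. a t (- x))"
  unfolding total_family_def
proof (intro conjI allI ballI impI)
  show "(\<lambda>x. a t (- x)) \<in> L2 (interval_lborel (- c) 0)" for t
    using assms by (auto simp: total_family_def intro: L2_interval_lborel_reflect)
  fix f assume f: "f \<in> L2 (interval_lborel (- c) 0)"
    and 0: "\<forall>t. L2_inner (interval_lborel (- c) 0) f (\<lambda>x. a t (- x)) = 0"
  note f' = L2_interval_lborel_reflect(1)[OF f]
  have "L2_inner (interval_lborel 0 c) (\<lambda>x. f (- x)) (a t) = 0" for t
    using 0 by (simp add: L2_inner_def integral_interval_lborel_reflect)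
  then have "AE x in interval_lborel 0 c. f (- x) = 0"
    using assms f' by (auto simp: total_family_def)
  \<comment> \<open>Passing through the norm transports vanishing almost everywhere under the
    reflection.\<close>
  then have "L2_norm (interval_lborel 0 c) (\<lambda>x. f (- x)) = 0" using L2_norm_eq_0[OF f'] by simp
  then have "L2_norm (interval_lborel (- c) 0) f = 0" by (simp add: L2_norm_def integral_interval_lborel_reflect)
  then show "AE x in interval_lborel (- c) 0. f x = 0" using L2_norm_eq_0[OF f] by simp
qed

lemma half_cvec_joint_measurable:
  assumes [measurable]: "g \<in> borel_measurable M"
  shows "(\<lambda>(s, x). half_cvec a b s (g x)) \<in> borel_measurable (lborel \<Otimes>\<^sub>M M)"
proof -
  have "(\<lambda>p. (fst p, g (snd p))) \<in> measurable (lborel \<Otimes>\<^sub>M M) (lborel \<Otimes>\<^sub>M lborel)" by measurable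
  from measurable_compose[OF this half_vec_measurable, of a b]
  have "(\<lambda>p. half_vec a b (fst p) (g (snd p))) \<in> borel_measurable (lborel \<Otimes>\<^sub>M M)" by simp
  then show ?thesis unfolding half_cvec_def case_prod_unfold by simp
qed

text \<open>The vector is bounded by a multiple of \<open>sqrt y\<close>, so the integrand is
  dominated by a multiple of \<open>1 / sqrt y\<close> uniformly in \<open>s\<close>. The
  transformed vectors are therefore bounded off 0, hence square-integrable on the neighbouring
  interval.\<close>

lemma stieltjes_half_vec_bounded:
  assumes ab: "0 < a" "0 < b"
  obtains K where "\<And>s. 0 < s \<Longrightarrow> \<bar>LINT y|interval_lborel 0 b. half_vec a b t y / (y + s)\<bar> \<le> K"
proof -
  have "set_integrable lborel (einterval (ereal 0) (ereal b)) (\<lambda>y. 1 / sqrt y)"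
  proof (rule interval_integral_FTC_nonneg(1)[where F = "\<lambda>y. 2 * sqrt y" and A = 0 and B = "2 * sqrt b"])
    fix y assume "ereal 0 < ereal y" "ereal y < ereal b"
    then have y: "0 < y" by simp
    show "((\<lambda>y. 2 * sqrt y) has_real_derivative 1 / sqrt y) (at y)"
      using DERIV_cmult[OF DERIV_real_sqrt[OF y], of 2] by (simp add: inverse_eq_divide)
    show "isCont (\<lambda>y. 1 / sqrt y) y" using y by (intro continuous_intros) auto
  next
    have "((\<lambda>y. 2 * sqrt y) \<longlongrightarrow> 2 * sqrt 0) (at_right 0)" "((\<lambda>y. 2 * sqrt y) \<longlongrightarrow> 2 * sqrt b) (at_left b)"
      by (intro tendsto_intros)+
    then show "(((\<lambda>y. 2 * sqrt y) \<circ> real_of_ereal) \<longlongrightarrow> 0) (at_right (ereal 0))"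
      "(((\<lambda>y. 2 * sqrt y) \<circ> real_of_ereal) \<longlongrightarrow> 2 * sqrt b) (at_left (ereal b))"
      by (simp_all add: ereal_tendsto_simps)
  qed (use ab in auto)
  then have i: "integrable lborel (\<lambda>y. indicator {0<..<b} y *\<^sub>R (1 / sqrt y))"
    by (simp add: set_integrable_def)
  define c where "c = (a + b) * sqrt (a * b) / 2 * (\<bar>sinh (t / 2)\<bar> * cosh (t / 2)) / sqrt (a * b) ^ 3"
  have c0: "0 \<le> c" using ab by (simp add: c_def cosh_real_nonneg)
  have bound: "\<bar>half_vec a b t y / (y + s)\<bar> \<le> c * (1 / sqrt y)" if y: "0 < y" and s: "0 < s" for y s
  proof -
    have "a * b \<le> half_den a b t y" unfolding half_den_alt(2) using ab y by (simp add: algebra_simps)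
    then have "sqrt (a * b) ^ 3 \<le> sqrt (half_den a b t y) ^ 3" using ab by (intro power_mono) auto
    then have "sqrt y / sqrt (half_den a b t y) ^ 3 \<le> sqrt y / sqrt (a * b) ^ 3"
      using ab y by (intro divide_left_mono mult_pos_pos) (auto intro!: zero_less_power half_den_pos)
    then have "(a + b) * sqrt (a * b) / 2 * (\<bar>sinh (t / 2)\<bar> * cosh (t / 2)) * (sqrt y / sqrt (half_den a b t y) ^ 3)
      \<le> (a + b) * sqrt (a * b) / 2 * (\<bar>sinh (t / 2)\<bar> * cosh (t / 2)) * (sqrt y / sqrt (a * b) ^ 3)"
      using ab by (intro mult_left_mono) (auto simp: cosh_real_nonneg)
    moreover have "\<bar>half_vec a b t y\<bar> = (a + b) * sqrt (a * b) / 2 * (\<bar>sinh (t / 2)\<bar> * cosh (t / 2)) * (sqrt y / sqrt (half_den a b t y) ^ 3)"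
      using ab y half_den_pos[OF ab, of y t] by (simp add: half_vec_def abs_mult cosh_real_nonneg)
    ultimately have "\<bar>half_vec a b t y\<bar> \<le> c * sqrt y" by (simp add: c_def)
    then have "\<bar>half_vec a b t y\<bar> / (y + s) \<le> c * sqrt y / y"
      using y s c0 by (intro frac_le) auto
    also have "\<dots> = c * (1 / sqrt y)" using y by (simp add: real_div_sqrt field_simps)
    finally show ?thesis using y s by simp
  qed
  show thesis
  proof (rule that)
    fix s :: real assume s: "0 < s"
    have "\<bar>LINT y|interval_lborel 0 b. half_vec a b t y / (y + s)\<bar> = norm (LINT y|lborel. indicator {0..b} y *\<^sub>R (half_vec a b t y / (y + s)))"
      by (subst integral_restrict_space) auto
    also have "\<dots> \<le> (LINT y|lborel. c * (indicator {0<..<b} y *\<^sub>R (1 / sqrt y)))"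
    proof (rule order_trans[OF integral_norm_bound integral_mono_AE'])
      show "AE y in lborel. norm (indicator {0..b} y *\<^sub>R (half_vec a b t y / (y + s))) \<le> c * (indicator {0<..<b} y *\<^sub>R (1 / sqrt y))"
        using AE_lborel_singleton[of "0::real"] AE_lborel_singleton[of b]
      proof eventually_elim
        case (elim y)
        then show ?case using bound[of y s] s by (cases "y \<in> {0<..<b}") (auto split: split_indicator)
      qed
      show "integrable lborel (\<lambda>y. c * (indicator {0<..<b} y *\<^sub>R (1 / sqrt y)))"
        by (rule integrable_mult_right[OF i])
      show "AE y in lborel. 0 \<le> c * (indicator {0<..<b} y *\<^sub>R (1 / sqrt y))"
        using c0 by (intro AE_I2) (auto split: split_indicator)
    qed
    finally show "\<bar>LINT y|interval_lborel 0 b. half_vec a b t y / (y + s)\<bar> \<le> (LINT y|lborel. c * (indicator {0<..<b} y *\<^sub>R (1 / sqrt y)))" .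
  qed
qed

text \<open>At a point off the interval the kernel is bounded; it is the vector that represents
  evaluation of the transform there as an inner product.\<close>

lemma Cauchy_kernel_L2:
  assumes "0 < d" "\<And>y. y \<in> {p..q} \<Longrightarrow> d \<le> \<bar>y - x\<bar>"
  shows "(\<lambda>y. of_real (c / (y - x)) :: complex) \<in> L2 (interval_lborel p q)"
proof (rule L2_interval_lborel_bounded)
  show "cmod (of_real (c / (y - x))) \<le> \<bar>c\<bar> / d" if "y \<in> {p..q}" for y
  proof -
    have "cmod (of_real (c / (y - x))) = \<bar>c\<bar> / \<bar>y - x\<bar>" by (simp only: norm_of_real abs_divide)
    also have "\<dots> \<le> \<bar>c\<bar> / d" using assms(1) assms(2)[OF that] by (intro frac_le) auto
    finally show ?thesis .
  qed
  show "(\<lambda>y. of_real (c / (y - x)) :: complex) \<in> borel_measurable (interval_lborel p q)"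
    by (intro measurable_restrict_space1) measurable
qed

lemma Cauchy_transform_measurable:
  assumes [measurable]: "f \<in> borel_measurable (interval_lborel p q)"
  shows "(\<lambda>x. LINT y|interval_lborel p q. f y / complex_of_real (y - x)) \<in> borel_measurable (interval_lborel p' q')"
proof -
  interpret sigma_finite_measure "interval_lborel p q" by (rule sigma_finite_interval_lborel)
  have [measurable]: "(\<lambda>z. z) \<in> borel_measurable (interval_lborel p q)" "(\<lambda>z. z) \<in> borel_measurable (interval_lborel p' q')"
    by (auto intro: measurable_restrict_space1)
  show ?thesis by measurable
qed

lemma AE_interval_lborel:
  assumes "\<And>x. p \<le> x \<Longrightarrow> x \<le> q \<Longrightarrow> x \<noteq> 0 \<Longrightarrow> P x"
  shows "AE x in interval_lborel p q. P x"
  by (subst AE_restrict_space_iff) (use AE_lborel_singleton[of "0::real"] assms in \<open>auto elim!: eventually_mono\<close>)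

text \<open>The endpoint 0 is common to both intervals, and no bound on the transforms is
  established there; altering a function at this one point is harmless.\<close>

lemma L2_interval_lborel_bounded_punctured:
  assumes f: "f \<in> borel_measurable (interval_lborel p q)" and C: "\<And>x. x \<in> {p..q} \<Longrightarrow> x \<noteq> 0 \<Longrightarrow> cmod (f x) \<le> C"
  shows "f \<in> L2 (interval_lborel p q)"
proof (rule L2_AE_cong[OF _ f])
  have "(\<lambda>x. of_real (indicator (- {0}) x) :: complex) \<in> borel_measurable (interval_lborel p q)"
    by (intro measurable_restrict_space1) measurable
  then have "(\<lambda>x. of_real (indicator (- {0}) x) * f x) \<in> borel_measurable (interval_lborel p q)"
    using f by (rule borel_measurable_times)
  then show "(\<lambda>x. of_real (indicator (- {0}) x) * f x) \<in> L2 (interval_lborel p q)"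
    by (rule L2_interval_lborel_bounded[where C = "\<bar>C\<bar>"])
      (use C in \<open>force simp: norm_mult split: split_indicator\<close>)
  show "AE x in interval_lborel p q. of_real (indicator (- {0}) x) * f x = f x"
    by (rule AE_interval_lborel) simp
qed

lemma abs_le_divide_pi: "\<bar>x\<bar> \<le> K \<Longrightarrow> \<bar>x\<bar> / pi \<le> K"
proof -
  assume K: "\<bar>x\<bar> \<le> K"
  have "\<bar>x\<bar> / pi \<le> \<bar>x\<bar> / 1" using pi_ge_two by (intro divide_left_mono) auto
  then show "\<bar>x\<bar> / pi \<le> K" using K by simp
qed

section \<open>The two transforms as instances of the convolution model\<close>

lemma fht_R_half_cvec_eq:
  "fht_R b (half_cvec a b t) x = of_real ((LINT y|interval_lborel 0 b. half_vec a b t y / (y + - x)) / pi)"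
  by (simp add: fht_R_def half_cvec_def flip: of_real_divide of_real_diff)

lemma fht_L_reflected_half_cvec:
  "fht_L (- a) (\<lambda>x. half_cvec b a t (- x)) y = of_real (- ((LINT s|interval_lborel 0 a. half_vec b a t s / (s + y)) / pi))"
proof -
  have "fht_L (- a) (\<lambda>x. half_cvec b a t (- x)) y = 1 / of_real pi * (LINT s|interval_lborel 0 a. of_real (- (half_vec b a t s / (s + y))))"
  proof -
    have "of_real u / of_real (- s - y) = complex_of_real (- (u / (s + y)))" for u s
      by (metis minus_add_distrib minus_divide_right of_real_divide uminus_add_conv_diff add.commute diff_minus_eq_add minus_diff_eq)
    then show ?thesis unfolding fht_L_def integral_interval_lborel_reflect half_cvec_def by simp
  qed
  also have "\<dots> = of_real (- ((LINT s|interval_lborel 0 a. half_vec b a t s / (s + y)) / pi))"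
    by (simp only: integral_complex_of_real) simp
  finally show ?thesis .
qed

lemma fht_R_half_cvec:
  assumes "0 < a" "0 < b" "0 < s" "s \<le> a"
  shows "fht_R b (half_cvec a b t) (- s) = (LINT x|lborel. of_real (sech_kernel (x - t)) * half_cvec b a x s)"
proof -
  have "fht_R b (half_cvec a b t) (- s) = of_real (LINT x|lborel. sech_kernel (x - t) * half_vec b a x s)"
    unfolding fht_R_half_cvec_eq minus_minus stieltjes_half_vec[OF assms] ..
  then show ?thesis by (simp add: half_cvec_def flip: of_real_mult)
qed

lemma fht_L_half_cvec:
  assumes "0 < a" "0 < b" "0 < y" "y \<le> b"
  shows "fht_L (- a) (\<lambda>x. half_cvec b a t (- x)) y = (LINT x|lborel. of_real (sech_kernel (x - t)) * - half_cvec a b x y)"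
proof -
  have "fht_L (- a) (\<lambda>x. half_cvec b a t (- x)) y = of_real (- (LINT x|lborel. sech_kernel (x - t) * half_vec a b x y))"
    unfolding fht_L_reflected_half_cvec stieltjes_half_vec[OF assms(2,1,3,4)] by simp
  then show ?thesis by (simp add: half_cvec_def flip: of_real_mult)
qed

lemma fht_R_simple_and_ac:
  assumes ab: "0 < a" "0 < b"
  shows "simple_spectrum (interval_lborel 0 b) (fht_R_adj_R (- a) b) \<and> purely_ac_spectrum (interval_lborel 0 b) (fht_R_adj_R (- a) b)"
proof -
  let ?M = "interval_lborel 0 b" and ?M' = "interval_lborel (- a) 0"
  have "simple_spectrum ?M (\<lambda>f. L2_adjoint ?M ?M' (fht_R b) (fht_R b f))
    \<and> purely_ac_spectrum ?M (\<lambda>f. L2_adjoint ?M ?M' (fht_R b) (fht_R b f))"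
  proof (rule sech_convolution_model[where b = "\<lambda>s x. half_cvec b a s (- x)"])
    show "total_family ?M (half_cvec a b)" by (rule total_family_half_cvec[OF ab])
    show "L2_inner ?M (half_cvec a b t) (half_cvec a b s) = of_real (gram t s)" for t s
      by (rule half_cvec_gram[OF ab])
    show "sigma_finite_measure ?M'" by (rule sigma_finite_interval_lborel)
    show "(\<lambda>(s, x). half_cvec b a s (- x)) \<in> borel_measurable (lborel \<Otimes>\<^sub>M ?M')"
      by (rule half_cvec_joint_measurable) (intro measurable_restrict_space1, measurable)
    show "(\<lambda>x. half_cvec b a s (- x)) \<in> L2 ?M'" for s
      by (rule L2_interval_lborel_reflect(2)[OF half_cvec_L2[OF ab(2,1)]])
    show "L2_inner ?M' (\<lambda>x. half_cvec b a s (- x)) (\<lambda>x. half_cvec b a r (- x)) = of_real (gram s r)" for s r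
      using half_cvec_gram[OF ab(2,1), of s r] by (simp add: L2_inner_def integral_interval_lborel_reflect)
    show "AE x in ?M'. \<exists>k\<in>L2 ?M. \<forall>f\<in>L2 ?M. fht_R b f x = L2_inner ?M f k"
    proof (rule AE_interval_lborel)
      fix x :: real assume x: "- a \<le> x" "x \<le> 0" "x \<noteq> 0"
      have "(\<lambda>y. of_real (1 / pi / (y - x)) :: complex) \<in> L2 ?M"
        by (rule Cauchy_kernel_L2[of "- x"]) (use x in auto)
      moreover have "fht_R b f x = L2_inner ?M f (\<lambda>y. of_real (1 / pi / (y - x)))" for f
        by (simp add: fht_R_def L2_inner_def mult_ac divide_inverse flip: integral_mult_right_zero)
      ultimately show "\<exists>k\<in>L2 ?M. \<forall>f\<in>L2 ?M. fht_R b f x = L2_inner ?M f k" by blast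
    qed
    show m: "fht_R b f \<in> borel_measurable ?M'" if "f \<in> L2 ?M" for f
      unfolding fht_R_def[abs_def]
      by (intro borel_measurable_times borel_measurable_const Cauchy_transform_measurable L2_measurable that)
    show "AE x in ?M'. fht_R b (half_cvec a b t) x = (LINT s|lborel. of_real (sech_kernel (s - t)) * half_cvec b a s (- x))" for t
      by (rule AE_interval_lborel) (use fht_R_half_cvec[OF ab, of "- _" t] in auto)
    show "fht_R b (half_cvec a b t) \<in> L2 ?M'" for t
    proof -
      obtain K where K: "\<And>s. 0 < s \<Longrightarrow> \<bar>LINT y|interval_lborel 0 b. half_vec a b t y / (y + s)\<bar> \<le> K"
        using stieltjes_half_vec_bounded[OF ab] by blast
      show ?thesis
      proof (rule L2_interval_lborel_bounded_punctured[OF m[OF half_cvec_L2[OF ab]]])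
        fix x :: real assume x: "x \<in> {- a..0}" "x \<noteq> 0"
        show "cmod (fht_R b (half_cvec a b t) x) \<le> K"
          unfolding fht_R_half_cvec_eq norm_of_real using K[of "- x"] x pi_ge_two
          by (simp add: abs_le_divide_pi)
      qed
    qed
  qed
  then show ?thesis unfolding fht_R_adj_R_def[abs_def] .
qed

lemma fht_L_simple_and_ac:
  assumes ab: "0 < a" "0 < b"
  shows "simple_spectrum (interval_lborel (- a) 0) (fht_L_adj_L (- a) b) \<and> purely_ac_spectrum (interval_lborel (- a) 0) (fht_L_adj_L (- a) b)"
proof -
  let ?M = "interval_lborel (- a) 0" and ?M' = "interval_lborel 0 b"
  let ?v = "\<lambda>t x. half_cvec b a t (- x)"
  have v: "?v t \<in> L2 ?M" for t by (rule L2_interval_lborel_reflect(2)[OF half_cvec_L2[OF ab(2,1)]])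
  \<comment> \<open>The kernel \<open>1 / (x - y)\<close> is negative for \<open>x < 0 < y\<close>,
    hence the minus sign in the averaged family below; it leaves the Gram matrix unchanged.\<close>
  have "simple_spectrum ?M (\<lambda>f. L2_adjoint ?M ?M' (fht_L (- a)) (fht_L (- a) f))
    \<and> purely_ac_spectrum ?M (\<lambda>f. L2_adjoint ?M ?M' (fht_L (- a)) (fht_L (- a) f))"
  proof (rule sech_convolution_model[where a = ?v and b = "\<lambda>s y. - half_cvec a b s y"])
    show "total_family ?M ?v" by (rule total_family_reflect[OF total_family_half_cvec[OF ab(2,1)]])
    show "L2_inner ?M (?v t) (?v s) = of_real (gram t s)" for t s
      using half_cvec_gram[OF ab(2,1), of t s] by (simp add: L2_inner_def integral_interval_lborel_reflect)
    show "sigma_finite_measure ?M'" by (rule sigma_finite_interval_lborel)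
    have "(\<lambda>(s, y). half_cvec a b s y) \<in> borel_measurable (lborel \<Otimes>\<^sub>M ?M')"
      by (rule half_cvec_joint_measurable) (intro measurable_restrict_space1, measurable)
    from borel_measurable_uminus[OF this]
    show "(\<lambda>(s, y). - half_cvec a b s y) \<in> borel_measurable (lborel \<Otimes>\<^sub>M ?M')" by (simp add: case_prod_unfold)
    show "(\<lambda>y. - half_cvec a b s y) \<in> L2 ?M'" for s
      using L2_scale[OF half_cvec_L2[OF ab, of s], of "-1"] by simp
    show "L2_inner ?M' (\<lambda>y. - half_cvec a b s y) (\<lambda>y. - half_cvec a b r y) = of_real (gram s r)" for s r
      using half_cvec_gram[OF ab, of s r] by (simp add: L2_inner_def)
    show "AE y in ?M'. \<exists>k\<in>L2 ?M. \<forall>f\<in>L2 ?M. fht_L (- a) f y = L2_inner ?M f k"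
    proof (rule AE_interval_lborel)
      fix y :: real assume y: "0 \<le> y" "y \<le> b" "y \<noteq> 0"
      have "(\<lambda>x. of_real (1 / pi / (x - y)) :: complex) \<in> L2 ?M"
        by (rule Cauchy_kernel_L2[of y]) (use y in auto)
      moreover have "fht_L (- a) f y = L2_inner ?M f (\<lambda>x. of_real (1 / pi / (x - y)))" for f
        by (simp add: fht_L_def L2_inner_def mult_ac divide_inverse flip: integral_mult_right_zero)
      ultimately show "\<exists>k\<in>L2 ?M. \<forall>f\<in>L2 ?M. fht_L (- a) f y = L2_inner ?M f k" by blast
    qed
    show m: "fht_L (- a) f \<in> borel_measurable ?M'" if "f \<in> L2 ?M" for f
      unfolding fht_L_def[abs_def]
      by (intro borel_measurable_times borel_measurable_const Cauchy_transform_measurable L2_measurable that)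
    show "AE y in ?M'. fht_L (- a) (?v t) y = (LINT s|lborel. of_real (sech_kernel (s - t)) * - half_cvec a b s y)" for t
      by (rule AE_interval_lborel) (rule fht_L_half_cvec[OF ab], auto)
    show "fht_L (- a) (?v t) \<in> L2 ?M'" for t
    proof -
      obtain K where K: "\<And>y. 0 < y \<Longrightarrow> \<bar>LINT s|interval_lborel 0 a. half_vec b a t s / (s + y)\<bar> \<le> K"
        using stieltjes_half_vec_bounded[OF ab(2,1)] by blast
      show ?thesis
      proof (rule L2_interval_lborel_bounded_punctured[OF m[OF v]])
        fix y :: real assume y: "y \<in> {0..b}" "y \<noteq> 0"
        show "cmod (fht_L (- a) (?v t) y) \<le> K"
          unfolding fht_L_reflected_half_cvec norm_of_real using K[of y] y pi_ge_two
          by (simp add: abs_le_divide_pi)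
      qed
    qed
  qed
  then show ?thesis unfolding fht_L_adj_L_def[abs_def] .
qed

theorem theorem3p12:
  fixes bL bR :: real
  assumes "bL < 0" and "0 < bR"
  shows "simple_spectrum (interval_lborel 0 bR) (fht_R_adj_R bL bR) \<and>
         purely_ac_spectrum (interval_lborel 0 bR) (fht_R_adj_R bL bR) \<and>
         simple_spectrum (interval_lborel bL 0) (fht_L_adj_L bL bR) \<and>
         purely_ac_spectrum (interval_lborel bL 0) (fht_L_adj_L bL bR)"
  using fht_R_simple_and_ac[of "- bL" bR] fht_L_simple_and_ac[of "- bL" bR] assms by simp

end
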